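(* Let $k$ be a positive integer. The modified graded dimensions of the principal subspaces of the level $k$ standard $\widehat{\mathfrak{sl}(2)}$-modules satisfy the Rogers--Selberg recursions: for every $1\le i\le k$, $$\chi'_{W(i\Lambda_0+(k-i)\Lambda_1)}(x,q)-(xq)^i\,\chi'_{W((k-i)\Lambda_0+i\Lambda_1)}(xq,q)=\chi'_{W((i-1)\Lambda_0+(k-i+1)\Lambda_1)}(x,q),$$ and $$\chi'_{W(k\Lambda_1)}(x,q)=\chi'_{W(k\Lambda_0)}(xq,q),$$ as identities of formal power series in $\mathbb{C}[[x,q]]$.
   Context: $\mathfrak{g}=\mathfrak{sl}(2,\mathbb{C})$ has basis $h,x_\alpha,x_{-\alpha}$ with $[h,x_{\pm\alpha}]=\pm2x_{\pm\alpha}$, $[x_\alpha,x_{-\alpha}]=h$, and form $\langle x,y\rangle=\mathrm{tr}(xy)$; $\mathfrak{h}=\mathbb{C}h$ is identified with $\mathfrak{h}^*$ by this form, so the positive root is $\alpha=h$, with $\langle\alpha,\alpha\rangle=2$. $\widehat{\mathfrak{sl}(2)}=\mathfrak{g}\otimes\mathbb{C}[t,t^{-1}]\oplus\mathbb{C}c$ with $c$ central and $[x\otimes t^m,y\otimes t^n]=[x,y]\otimes t^{m+n}+\langle x,y\rangle m\delta_{m+n,0}c$. Write $x(n)$ for the action of $x\otimes t^n$ on a module. $\Lambda_0,\Lambda_1\in(\mathfrak{h}\oplus\mathbb{C}c)^*$ are defined by $\langle\Lambda_j,c\rangle=1$, $\langle\Lambda_j,h\rangle=\delta_{j,1}$.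 For nonnegative integers $k_0,k_1$ with $k_0+k_1=k$ and $\Lambda=k_0\Lambda_0+k_1\Lambda_1$, $L(\Lambda)$ is the standard (irreducible integrable highest weight) $\widehat{\mathfrak{sl}(2)}$-module with highest weight vector $v_\Lambda$: $v_\Lambda$ is annihilated by $x_\alpha(0)$ and by $\mathfrak{g}\otimes t\mathbb{C}[t]$, $h(0)v_\Lambda=k_1v_\Lambda$, and $c$ acts as $k$. The principal subspace is $W(\Lambda)=U(\widehat{\mathfrak{n}_+})\cdot v_\Lambda\subset L(\Lambda)$, where $\widehat{\mathfrak{n}_+}=\mathbb{C}x_\alpha\otimes\mathbb{C}[t,t^{-1}]$. $L(\Lambda)$ and $W(\Lambda)$ are doubly graded: by charge, the eigenvalue of $\alpha(0)/2=h(0)/2$, and by weight, the eigenvalue of the (Sugawara) Virasoro operator $L(0)$, which is determined by $L(0)v_\Lambda=h_\Lambda v_\Lambda$ and $[L(0),x(n)]=-n\,x(n)$ for $x\in\mathfrak{g}$, $n\in\mathbb{Z}$, where $h_\Lambda=\frac{\langle\Lambda,\Lambda+\alpha\rangle}{2(k+2)}=\frac{k_1(k_1+2)}{4(k+2)}$. The graded dimension is $\chi_{W(\Lambda)}(x,q)=\mathrm{tr}|_{W(\Lambda)}x^{\alpha/2}q^{L(0)}$, i.e. the generating function $\sum_{a,b}\dim(W(\Lambda)_{a,b})x^aq^b$ where $W(\Lambda)_{a,b}$ is the subspace of charge $a$ and weight $b$; $x,q$ are formal variables. The modified graded dimension is $\chi'_{W(\Lambda)}(x,q)=x^{-\langle\alpha/2,\Lambda\rangle}q^{-h_\Lambda}\chi_{W(\Lambda)}(x,q)\in\mathbb{C}[[x,q]]$,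 where $\langle\alpha/2,\Lambda\rangle=k_1/2$. *)

theory Defs
  imports
    "HOL-Analysis.Determinants"
    "HOL-Library.Poly_Mapping"
    "HOL-Computational_Algebra.Formal_Power_Series"
begin

section \<open>The affine Lie algebra of sl(2)\<close>

type_synonym mat2 = "complex ^ 2 ^ 2"

definition sl2 :: "mat2 set" where
  "sl2 = {A. trace A = 0}"

definition sl2_h :: mat2 where
  "sl2_h = vector [vector [1, 0], vector [0, -1]]"

definition sl2_pos :: mat2 where
  "sl2_pos = vector [vector [0, 1], vector [0, 0]]"

definition sl2_neg :: mat2 where
  "sl2_neg = vector [vector [0, 0], vector [1, 0]]"

definition commutator :: "mat2 \<Rightarrow> mat2 \<Rightarrow> mat2" where
  "commutator A B = A ** B - B ** A"

definition tr_form :: "mat2 \<Rightarrow> mat2 \<Rightarrow> complex" where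
  "tr_form A B = trace (A ** B)"

definition mat_scale :: "complex \<Rightarrow> mat2 \<Rightarrow> mat2" where
  "mat_scale s A = (\<chi> i j. s * A $ i $ j)"

text \<open>A pair \<open>(f, z)\<close> stands for \<open>(\<Sum>n. f n \<otimes> t^n) + z c\<close>; addition is that of the product type.\<close>

type_synonym loop_ext = "(int \<Rightarrow>\<^sub>0 mat2) \<times> complex"

definition sl2_hat :: "loop_ext set" where
  "sl2_hat = {u. \<forall>n. Poly_Mapping.lookup (fst u) n \<in> sl2}"

definition tensor_t :: "mat2 \<Rightarrow> int \<Rightarrow> loop_ext" where
  "tensor_t A n = (Poly_Mapping.single n A, 0)"

definition central_c :: loop_ext where
  "central_c = (0, 1)"

definition hat_scale :: "complex \<Rightarrow> loop_ext \<Rightarrow> loop_ext" where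
  "hat_scale s u = (Poly_Mapping.map (mat_scale s) (fst u), s * snd u)"

definition hat_bracket :: "loop_ext \<Rightarrow> loop_ext \<Rightarrow> loop_ext" where
  "hat_bracket u v =
     (let f = fst u; g = fst v in
      (\<Sum>m\<in>Poly_Mapping.keys f. \<Sum>n\<in>Poly_Mapping.keys g.
         (Poly_Mapping.single (m + n)
            (commutator (Poly_Mapping.lookup f m) (Poly_Mapping.lookup g n)),
          if m + n = 0
          then of_int m * tr_form (Poly_Mapping.lookup f m) (Poly_Mapping.lookup g n)
          else 0)))"

lemma hat_bracket_tensor_t:
  "hat_bracket (tensor_t A m) (tensor_t B n) =
     tensor_t (commutator A B) (m + n)
     + hat_scale (if m + n = 0 then of_int m * tr_form A B else 0) central_c"
proof -
  have 0: "Poly_Mapping.map (mat_scale s) 0 = 0" for s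
    by (rule poly_mapping_eqI) (simp add: Poly_Mapping.map.rep_eq)
  show ?thesis
    by (cases "A = 0"; cases "B = 0")
      (simp_all add: hat_bracket_def tensor_t_def central_c_def hat_scale_def 0
        commutator_def tr_form_def trace_def matrix_matrix_mult_def zero_prod_def vec_eq_iff)
qed

section \<open>Standard modules\<close>

text \<open>The underlying vector space is the whole type; \<open>hwv\<close> is the chosen highest weight vector.\<close>

record 'v hat_module =
  scale :: "complex \<Rightarrow> 'v \<Rightarrow> 'v"
  act :: "loop_ext \<Rightarrow> 'v \<Rightarrow> 'v"
  hwv :: 'v

definition is_hat_module :: "('v::ab_group_add) hat_module \<Rightarrow> bool" where
  "is_hat_module M \<longleftrightarrow>
     vector_space (scale M) \<and>
     (\<forall>u\<in>sl2_hat. Vector_Spaces.linear (scale M) (scale M) (act M u)) \<and>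
     (\<forall>u\<in>sl2_hat. \<forall>v\<in>sl2_hat. \<forall>w. act M (u + v) w = act M u w + act M v w) \<and>
     (\<forall>s. \<forall>u\<in>sl2_hat. \<forall>w. act M (hat_scale s u) w = scale M s (act M u w)) \<and>
     (\<forall>u\<in>sl2_hat. \<forall>v\<in>sl2_hat. \<forall>w.
        act M (hat_bracket u v) w = act M u (act M v w) - act M v (act M u w))"

definition irreducible_module :: "('v::ab_group_add) hat_module \<Rightarrow> bool" where
  "irreducible_module M \<longleftrightarrow>
     (UNIV :: 'v set) \<noteq> {0} \<and>
     (\<forall>S. module.subspace (scale M) S \<and> (\<forall>u\<in>sl2_hat. \<forall>w\<in>S. act M u w \<in> S)
        \<longrightarrow> S = {0} \<or> S = UNIV)"

text \<open>The diagonalizability of the Cartan subalgebra that also belongs to integrability is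
  automatic for highest weight modules.\<close>

definition integrable_module :: "('v::ab_group_add) hat_module \<Rightarrow> bool" where
  "integrable_module M \<longleftrightarrow>
     (\<forall>x\<in>{sl2_pos, sl2_neg}. \<forall>n w. \<exists>N. (act M (tensor_t x n) ^^ N) w = 0)"

text \<open>\<open>standard_module k0 k1 M\<close>: \<open>M\<close> is (a realization of) \<open>L(k0 \<Lambda>\<^sub>0 + k1 \<Lambda>\<^sub>1)\<close>.\<close>

definition standard_module :: "nat \<Rightarrow> nat \<Rightarrow> ('v::ab_group_add) hat_module \<Rightarrow> bool" where
  "standard_module k0 k1 M \<longleftrightarrow>
     is_hat_module M \<and> irreducible_module M \<and> integrable_module M \<and>
     hwv M \<noteq> 0 \<and>
     act M (tensor_t sl2_pos 0) (hwv M) = 0 \<and>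
     (\<forall>x\<in>sl2. \<forall>n\<ge>1. act M (tensor_t x n) (hwv M) = 0) \<and>
     act M (tensor_t sl2_h 0) (hwv M) = scale M (of_nat k1) (hwv M) \<and>
     (\<forall>w. act M central_c w = scale M (of_nat (k0 + k1)) w)"

section \<open>Principal subspaces and their graded dimensions\<close>

definition n_plus_hat :: "loop_ext set" where
  "n_plus_hat =
     {u. (\<forall>n. \<exists>s. Poly_Mapping.lookup (fst u) n = mat_scale s sl2_pos) \<and> snd u = 0}"

text \<open>\<open>U(\<a>) \<cdot> v\<close> is spanned by the vectors \<open>a\<^sub>1 \<dots> a\<^sub>r v\<close> with all \<open>a\<^sub>j\<close> in \<open>\<a>\<close>.\<close>

definition principal_subspace :: "('v::ab_group_add) hat_module \<Rightarrow> 'v set" where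
  "principal_subspace M =
     module.span (scale M) {foldr (act M) us (hwv M) | us. set us \<subseteq> n_plus_hat}"

definition lowest_weight :: "nat \<Rightarrow> nat \<Rightarrow> complex" where
  "lowest_weight k0 k1 = of_nat (k1 * (k1 + 2)) / of_nat (4 * (k0 + k1 + 2))"

definition virasoro_L0 :: "nat \<Rightarrow> nat \<Rightarrow> ('v::ab_group_add) hat_module \<Rightarrow> 'v \<Rightarrow> 'v" where
  "virasoro_L0 k0 k1 M =
     (THE D. Vector_Spaces.linear (scale M) (scale M) D \<and>
        D (hwv M) = scale M (lowest_weight k0 k1) (hwv M) \<and>
        (\<forall>x\<in>sl2. \<forall>n w.
           D (act M (tensor_t x n) w) - act M (tensor_t x n) (D w)
             = scale M (- of_int n) (act M (tensor_t x n) w)))"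

definition graded_piece ::
    "nat \<Rightarrow> nat \<Rightarrow> ('v::ab_group_add) hat_module \<Rightarrow> complex \<Rightarrow> complex \<Rightarrow> 'v set" where
  "graded_piece k0 k1 M a b =
     {w \<in> principal_subspace M.
        scale M (1 / 2) (act M (tensor_t sl2_h 0) w) = scale M a w \<and>
        virasoro_L0 k0 k1 M w = scale M b w}"

text \<open>\<open>\<complex>[[x,q]]\<close> is represented as \<open>\<complex>[[q]][[x]]\<close>.\<close>

abbreviation x_var :: "complex fps fps" where
  "x_var \<equiv> fps_X"

abbreviation q_var :: "complex fps fps" where
  "q_var \<equiv> fps_const fps_X"

text \<open>The coefficient of \<open>x^m q^n\<close> in \<open>x^(-k1/2) q^(-h) \<chi>\<close>, where \<open>h = lowest_weight k0 k1\<close>, is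
  the coefficient of \<open>x^(k1/2 + m) q^(h + n)\<close> in \<open>\<chi>\<close>.\<close>

definition modified_gdim :: "nat \<Rightarrow> nat \<Rightarrow> ('v::ab_group_add) hat_module \<Rightarrow> complex fps fps" where
  "modified_gdim k0 k1 M =
     Abs_fps (\<lambda>m. Abs_fps (\<lambda>n. of_nat
       (vector_space.dim (scale M)
          (graded_piece k0 k1 M (of_nat k1 / 2 + of_nat m) (lowest_weight k0 k1 + of_nat n)))))"

text \<open>\<open>f(x,q) \<mapsto> f(xq,q)\<close>\<close>

definition subst_xq :: "complex fps fps \<Rightarrow> complex fps fps" where
  "subst_xq f = fps_compose f (x_var * q_var)"

end

theory Submission
  imports Defs "HOL-Library.Multiset" "HOL-Library.Groups_Big_Fun" "HOL-Library.Countable"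
begin

text \<open>
  The principal subspace of \<open>L(i\<Lambda>\<^sub>0 + (k-i)\<Lambda>\<^sub>1)\<close> is the quotient of the polynomial ring
  \<open>P = \<complex>[x\<^sub>\<alpha>(-1), x\<^sub>\<alpha>(-2), \<dots>]\<close> by the annihilator \<open>I\<^sub>i\<close> of the highest weight vector, and everything
  follows from three properties of these ideals: \<open>I\<^sub>i \<subseteq> I\<^bsub>i-1\<^esub>\<close>; for the shift
  \<open>\<sigma> : x\<^sub>\<alpha>(-m) \<mapsto> x\<^sub>\<alpha>(-m-1)\<close>, \<open>x\<^sub>\<alpha>(-1)\<^sup>i \<sigma>(p) \<in> I\<^sub>i\<close> iff \<open>p \<in> I\<^bsub>k-i\<^esub>\<close>; and
  \<open>I\<^bsub>i-1\<^esub> = I\<^sub>i + (x\<^sub>\<alpha>(-1)\<^sup>i)\<close>. They say that multiplication by \<open>x\<^sub>\<alpha>(-1)\<^sup>i\<close> gives an exact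
  sequence \<open>0 \<rightarrow> P/I\<^bsub>k-i\<^esub> \<rightarrow> P/I\<^sub>i \<rightarrow> P/I\<^bsub>i-1\<^esub> \<rightarrow> 0\<close>, whose dimension count is the recursion.

  The ideals are computed in one concrete module. On the Fock space of \<open>2k\<close> fermions the affine
  algebra acts unitarily at level \<open>k\<close>, with a highest weight vector for each \<open>i\<close>. A highest weight
  vector \<open>v\<close> of weight \<open>\<Lambda>\<close>, in a unitary or an irreducible module, has a contravariant functional
  \<open>\<phi>\<close> that separates the points of \<open>U v\<close>; the scalars \<open>\<phi>(u v)\<close> depend only on \<open>\<Lambda>\<close>, hence so does
  the annihilator of \<open>v\<close>. For an irreducible module \<open>\<phi>\<close> comes from the grading by the Sugawara operator.
  In Fock space a single fermion commuting with all \<open>x\<^sub>\<alpha>(n)\<close> takes one vacuum to the next, which is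
  the first property; the second holds because \<open>x\<^sub>\<alpha>(-1)\<^sup>i v\<close> is a highest weight vector for the
  action twisted by a translation. For the third, let \<open>J\<^sub>i \<subseteq> I\<^sub>i\<close> be generated by
  \<open>x\<^sub>\<alpha>(-1)\<^bsup>i+1\<^esup>\<close> and the coefficients of \<open>x\<^sub>\<alpha>(z)\<^bsup>k+1\<^esup>\<close>. Visibly \<open>J\<^bsub>i-1\<^esub> = J\<^sub>i + (x\<^sub>\<alpha>(-1)\<^sup>i)\<close>
  and \<open>x\<^sub>\<alpha>(-1)\<^sup>i \<sigma>(J\<^bsub>k-i\<^esub>) \<subseteq> J\<^sub>i\<close>, and these together with the first two properties give
  \<open>I\<^sub>i = J\<^sub>i\<close> by induction on the weight.
\<close>

section \<open>The ring of additive endomorphisms\<close>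

text \<open>Operators form a ring, so that commutation relations become ring identities. Only
  additivity is built in; complex scalars enter as further operators \<open>sc c\<close>, and one
  type serves Fock space and arbitrary modules alike.\<close>

typedef (overloaded) 'a aend = "{f :: 'a::ab_group_add \<Rightarrow> 'a. \<forall>x y. f (x + y) = f x + f y}"
  morphisms app Aend
  by (rule exI[of _ id]) simp

setup_lifting type_definition_aend

lemma app_add [simp]: "app A (x + y) = app A x + app A y"
  using app[of A] by simp

lemma app_zero [simp]: "app A 0 = 0"
  using app_add[of A 0 0] by simp

lemma app_minus [simp]: "app A (- x) = - app A x"
  using app_add[of A x "- x"] by (simp add: eq_neg_iff_add_eq_0 add.commute)

lemma app_diff [simp]: "app A (x - y) = app A x - app A y"
  using app_add[of A x "- y"] by simp

lemma app_sum: "app A (sum f S) = (\<Sum>x\<in>S. app A (f x))"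
  by (induction S rule: infinite_finite_induct) auto

instantiation aend :: (ab_group_add) ring
begin
lift_definition zero_aend :: "'a aend" is "\<lambda>_. 0" by simp
lift_definition plus_aend :: "'a aend \<Rightarrow> 'a aend \<Rightarrow> 'a aend" is "\<lambda>f g x. f x + g x"
  by (simp add: algebra_simps)
lift_definition minus_aend :: "'a aend \<Rightarrow> 'a aend \<Rightarrow> 'a aend" is "\<lambda>f g x. f x - g x"
  by (simp add: algebra_simps)
lift_definition uminus_aend :: "'a aend \<Rightarrow> 'a aend" is "\<lambda>f x. - f x"
  by (simp add: algebra_simps)
lift_definition times_aend :: "'a aend \<Rightarrow> 'a aend \<Rightarrow> 'a aend" is "\<lambda>f g x. f (g x)"
  by simp
instance
  by standard (transfer; simp add: fun_eq_iff algebra_simps)+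
end

instantiation aend :: (ab_group_add) monoid_mult
begin
lift_definition one_aend :: "'a aend" is "\<lambda>x. x" by simp
instance
  by standard (transfer; simp)+
end

text \<open>On the zero group \<open>0 = 1\<close> would hold among endomorphisms. A non-zero vector
  makes them a \<open>ring_1\<close>, which provides \<open>of_int\<close> and the ring of power
  series with operator coefficients.\<close>

class nontrivial_ab_group_add = ab_group_add +
  assumes ex_nonzero: "\<exists>x. x \<noteq> 0"

instance aend :: (nontrivial_ab_group_add) ring_1
proof
  show "(0 :: 'a aend) \<noteq> 1"
    using ex_nonzero[where 'a='a] by transfer (metis)
qed

lemma app_simps [simp]:
  "app 0 x = 0" "app 1 x = x" "app (A + B) x = app A x + app B x"
  "app (A - B) x = app A x - app B x" "app (- A) x = - app A x" "app (A * B) x = app A (app B x)"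
  by (transfer; simp)+

lemma app_Aend: "(\<And>x y. f (x + y) = f x + f y) \<Longrightarrow> app (Aend f) = f"
  by (rule Aend_inverse) simp

lemma aend_eqI: "(\<And>x. app A x = app B x) \<Longrightarrow> A = B"
  by (metis app_inject ext)

lemma app_sum_left: "app (sum f S) x = (\<Sum>i\<in>S. app (f i) x)"
  by (induction S rule: infinite_finite_induct) auto

section \<open>Polynomials and their evaluation at commuting ring elements\<close>

text \<open>\<open>var m\<close> stands for \<open>x\<^sub>\<alpha>(-m-1)\<close>, so that the monomial of a multiset \<open>\<mu>\<close> raises the weight by
  \<open>size \<mu> + sum_mset \<mu>\<close>.\<close>

type_synonym mpoly = "nat multiset \<Rightarrow>\<^sub>0 complex"

definition cst :: "complex \<Rightarrow> mpoly" where
  "cst c = Poly_Mapping.single {#} c"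

definition var :: "nat \<Rightarrow> mpoly" where
  "var n = Poly_Mapping.single {#n#} 1"

definition pmon :: "nat multiset \<Rightarrow> mpoly" where
  "pmon \<mu> = Poly_Mapping.single \<mu> 1"

definition mmon :: "(nat \<Rightarrow> 'r::monoid_mult) \<Rightarrow> nat multiset \<Rightarrow> 'r" where
  "mmon X \<mu> = fold_mset (\<lambda>n r. X n * r) 1 \<mu>"

text \<open>The target ring may be noncommutative, and scalars are represented inside it by
  \<open>sc\<close>. Under the assumptions of \<open>poly_eval\<close> this is a ring
  homomorphism.\<close>

definition peval :: "(complex \<Rightarrow> 'r::{ring,monoid_mult}) \<Rightarrow> (nat \<Rightarrow> 'r) \<Rightarrow> mpoly \<Rightarrow> 'r" where
  "peval sc X p = (\<Sum>\<mu>\<in>Poly_Mapping.keys p. sc (Poly_Mapping.lookup p \<mu>) * mmon X \<mu>)"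

lemma sum_single_lookup:
  fixes p :: "'a \<Rightarrow>\<^sub>0 'b::comm_monoid_add"
  shows "(\<Sum>\<mu>\<in>Poly_Mapping.keys p. Poly_Mapping.single \<mu> (Poly_Mapping.lookup p \<mu>)) = p"
  by (rule poly_mapping_eqI) (simp add: lookup_sum lookup_single when_def in_keys_iff)

lemma poly_mapping_single_induct [case_names zero add]:
  fixes p :: "'a \<Rightarrow>\<^sub>0 'b::comm_monoid_add"
  assumes "P 0"
    and "\<And>p \<mu> c. P p \<Longrightarrow> P (p + Poly_Mapping.single \<mu> c)"
  shows "P p"
proof -
  have "P (\<Sum>\<mu>\<in>A. Poly_Mapping.single \<mu> (Poly_Mapping.lookup p \<mu>))" if "finite A" for A
    using that
  proof (induction A)
    case (insert a A)
    then show ?case using assms(2)[OF insert.IH] by (simp add: add.commute)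
  qed (simp add: assms(1))
  from this[of "Poly_Mapping.keys p"] show ?thesis
    by (simp add: sum_single_lookup)
qed

lemma single_eq_cst_pmon: "Poly_Mapping.single \<mu> c = cst c * pmon \<mu>"
  by (simp add: cst_def pmon_def mult_single)

lemma cst_simps [simp]: "cst 0 = 0" "cst 1 = 1" "cst (a + b) = cst a + cst b" "cst (a * b) = cst a * cst b"
  by (simp_all add: cst_def single_add mult_single single_one)

locale poly_eval =
  fixes sc :: "complex \<Rightarrow> 'r::{ring,monoid_mult}" and X :: "nat \<Rightarrow> 'r"
  assumes sc_add: "sc (a + b) = sc a + sc b"
    and sc_mult: "sc (a * b) = sc a * sc b"
    and sc_one: "sc 1 = 1"
    and sc_comm: "sc a * X n = X n * sc a"
    and X_comm: "X m * X n = X n * X m"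
begin

lemma sc_zero: "sc 0 = 0"
  using sc_add[of 0 0] by simp

sublocale cf: comp_fun_commute "\<lambda>n r. X n * r"
  by standard (auto simp: fun_eq_iff mult.assoc[symmetric] X_comm)

lemma mmon_empty [simp]: "mmon X {#} = 1"
  by (simp add: mmon_def)

lemma mmon_add_mset: "mmon X (add_mset n \<mu>) = X n * mmon X \<mu>"
  by (simp add: mmon_def cf.fold_mset_add_mset)

lemma mmon_union: "mmon X (\<mu> + \<nu>) = mmon X \<mu> * mmon X \<nu>"
  by (induction \<mu>) (simp_all add: mmon_add_mset mult.assoc)

lemma sc_mmon: "sc a * mmon X \<mu> = mmon X \<mu> * sc a"
  by (induction \<mu>) (simp_all add: mmon_add_mset mult.assoc[symmetric] sc_comm,
      simp add: mult.assoc)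

lemma peval_superset:
  "finite A \<Longrightarrow> Poly_Mapping.keys p \<subseteq> A \<Longrightarrow>
    peval sc X p = (\<Sum>\<mu>\<in>A. sc (Poly_Mapping.lookup p \<mu>) * mmon X \<mu>)"
  unfolding peval_def by (rule sum.mono_neutral_left) (auto simp: in_keys_iff sc_zero)

lemma peval_zero [simp]: "peval sc X 0 = 0"
  by (simp add: peval_def)

lemma peval_add: "peval sc X (p + q) = peval sc X p + peval sc X q"
proof -
  let ?A = "Poly_Mapping.keys p \<union> Poly_Mapping.keys q"
  have "Poly_Mapping.keys (p + q) \<subseteq> ?A" by (rule keys_add)
  then show ?thesis
    by (simp add: peval_superset[of ?A] lookup_add sc_add distrib_right sum.distrib)
qed

lemma peval_single: "peval sc X (Poly_Mapping.single \<mu> c) = sc c * mmon X \<mu>"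
  by (cases "c = 0") (simp_all add: peval_def sc_zero)

lemma peval_minus: "peval sc X (- p) = - peval sc X p"
  using peval_add[of p "- p"] by (simp add: eq_neg_iff_add_eq_0 add.commute)

lemma peval_diff: "peval sc X (p - q) = peval sc X p - peval sc X q"
  using peval_add[of p "- q"] by (simp add: peval_minus)

lemma peval_mult: "peval sc X (p * q) = peval sc X p * peval sc X q"
proof (induction p rule: poly_mapping_single_induct)
  case zero
  then show ?case by simp
next
  case (add p \<mu> c)
  have "peval sc X (Poly_Mapping.single \<mu> c * q) = sc c * mmon X \<mu> * peval sc X q"
  proof (induction q rule: poly_mapping_single_induct)
    case (add q \<nu> d)
    have "sc c * sc d * (mmon X \<mu> * mmon X \<nu>) = sc c * mmon X \<mu> * (sc d * mmon X \<nu>)"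
      by (metis mult.assoc sc_mmon)
    then show ?case
      using add by (simp add: distrib_left peval_add peval_single mult_single mmon_union sc_mult)
  qed simp
  then show ?case using add by (simp add: distrib_right peval_add peval_single)
qed

lemma peval_cst [simp]: "peval sc X (cst c) = sc c"
  by (simp add: cst_def peval_single)

lemma peval_one [simp]: "peval sc X 1 = 1"
  using peval_cst[of 1] by (simp add: sc_one del: peval_cst)

lemma peval_var [simp]: "peval sc X (var n) = X n"
  by (simp add: var_def peval_single sc_one mmon_add_mset)

lemma peval_power: "peval sc X (p ^ n) = peval sc X p ^ n"
  by (induction n) (simp_all add: peval_mult)

lemma peval_comm_right:
  assumes "\<And>c. sc c * y = y * sc c" "\<And>n. X n * y = y * X n"
  shows "peval sc X p * y = y * peval sc X p"
proof -
  have "mmon X \<mu> * y = y * mmon X \<mu>" for \<mu>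
    by (induction \<mu>) (simp_all add: mmon_add_mset assms(2) mult.assoc, metis assms(2) mult.assoc)
  then have "sc c * mmon X \<mu> * y = y * (sc c * mmon X \<mu>)" for c \<mu>
    by (metis assms(1) mult.assoc)
  then show ?thesis
    by (induction p rule: poly_mapping_single_induct)
      (simp_all add: peval_add peval_single distrib_left distrib_right)
qed

end

section \<open>Highest weight vectors and contravariant functionals\<close>

datatype gen = GE | GF | GH

fun gop :: "(int \<Rightarrow> 'r) \<Rightarrow> (int \<Rightarrow> 'r) \<Rightarrow> (int \<Rightarrow> 'r) \<Rightarrow> gen \<times> int \<Rightarrow> 'r" where
  "gop E F H (GE, n) = E n"
| "gop E F H (GF, n) = F n"
| "gop E F H (GH, n) = H n"

text \<open>The bracket of two basis elements is a multiple of a single basis element plus a central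
  term; \<open>br_coeff\<close>, \<open>br_gen\<close> and \<open>br_central\<close> are these data.
  Where the multiple is 0, \<open>br_gen\<close> still has the sum of the two degrees, so degree
  arguments need no case distinction.\<close>

fun br_coeff :: "gen \<times> int \<Rightarrow> gen \<times> int \<Rightarrow> complex" where
  "br_coeff (GE, m) (GF, n) = 1"
| "br_coeff (GF, m) (GE, n) = -1"
| "br_coeff (GH, m) (GE, n) = 2"
| "br_coeff (GE, m) (GH, n) = -2"
| "br_coeff (GH, m) (GF, n) = -2"
| "br_coeff (GF, m) (GH, n) = 2"
| "br_coeff _ _ = 0"

fun br_gen :: "gen \<times> int \<Rightarrow> gen \<times> int \<Rightarrow> gen \<times> int" where
  "br_gen (GH, m) (g, n) = (g, m + n)"
| "br_gen (g, m) (GH, n) = (g, m + n)"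
| "br_gen (_, m) (_, n) = (GH, m + n)"

fun br_central :: "nat \<Rightarrow> gen \<times> int \<Rightarrow> gen \<times> int \<Rightarrow> complex" where
  "br_central k (GE, m) (GF, n) = (if m + n = 0 then of_int m * of_nat k else 0)"
| "br_central k (GF, m) (GE, n) = (if m + n = 0 then of_int m * of_nat k else 0)"
| "br_central k (GH, m) (GH, n) = (if m + n = 0 then 2 * of_int m * of_nat k else 0)"
| "br_central k _ _ = 0"

text \<open>Triangular decomposition of the affine algebra: \<open>lowering\<close> and
  \<open>raising\<close> pick bases of its negative and positive parts, and \<open>(GH, 0)\<close>
  spans what remains of the loop part.\<close>

fun lowering :: "gen \<times> int \<Rightarrow> bool" where
  "lowering (g, n) \<longleftrightarrow> n < 0 \<or> (n = 0 \<and> g = GF)"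

fun raising :: "gen \<times> int \<Rightarrow> bool" where
  "raising (g, n) \<longleftrightarrow> n > 0 \<or> (n = 0 \<and> g = GE)"

lemma gen_trichotomy: "lowering g \<or> raising g \<or> g = (GH, 0)"
  by (cases g; cases "fst g") auto

locale sl2_rep =
  fixes sc :: "complex \<Rightarrow> 'v::ab_group_add aend"
    and E F H :: "int \<Rightarrow> 'v aend" and k :: nat
  assumes sc_add: "sc (a + b) = sc a + sc b"
    and sc_mult: "sc (a * b) = sc a * sc b"
    and sc_one: "sc 1 = 1"
    and sc_E: "sc a * E n = E n * sc a"
    and sc_F: "sc a * F n = F n * sc a"
    and sc_H: "sc a * H n = H n * sc a"
    and EE: "E m * E n = E n * E m"
    and FF: "F m * F n = F n * F m"
    and HE: "H m * E n = E n * H m + sc 2 * E (m + n)"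
    and HF: "H m * F n = F n * H m - sc 2 * F (m + n)"
    and EF: "E m * F n = F n * E m + H (m + n) + (if m + n = 0 then sc (of_int m * of_nat k) else 0)"
    and HH: "H m * H n = H n * H m + (if m + n = 0 then sc (2 * of_int m * of_nat k) else 0)"
begin

lemma sc_zero: "sc 0 = 0"
  using sc_add[of 0 0] by simp

lemma sc_minus: "sc (- a) = - sc a"
  using sc_add[of a "- a"] by (simp add: sc_zero eq_neg_iff_add_eq_0 add.commute)

lemma sc_diff: "sc (a - b) = sc a - sc b"
  using sc_add[of a "- b"] by (simp add: sc_minus)

abbreviation "gp \<equiv> gop E F H"

lemma sc_gop: "sc a * gp g = gp g * sc a"
  by (cases g; cases "fst g") (auto simp: sc_E sc_F sc_H)

lemma gop_bracket:
  "gp g * gp t =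
     gp t * gp g + sc (br_coeff g t) * gp (br_gen g t) + sc (br_central k g t)"
proof -
  obtain a m b n where g: "g = (a, m)" and t: "t = (b, n)" by (metis prod.exhaust)
  have FE: "F m * E n = E n * F m - H (m + n) + (if m + n = 0 then sc (of_int m * of_nat k) else 0)" for m n
    using EF[of n m] by (auto simp: add.commute algebra_simps sc_minus add_eq_0_iff)
  show ?thesis unfolding g t
    using EE[of m n] FF[of m n] HE[of m n] HF[of m n] EF[of m n] FE[of m n] HH[of m n]
      HE[of n m] HF[of n m]
    by (cases a; cases b) (auto simp: sc_zero sc_one sc_minus add.commute)
qed

lemma poly_eval_E: "poly_eval sc (\<lambda>m. E (- int m - 1))"
  by standard (simp_all add: sc_add sc_mult sc_one sc_E EE)

sublocale pe: poly_eval sc "\<lambda>m. E (- int m - 1)"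
  by (rule poly_eval_E)

abbreviation ev :: "mpoly \<Rightarrow> 'v aend" where
  "ev \<equiv> peval sc (\<lambda>m. E (- int m - 1))"

inductive_set cyc :: "'v \<Rightarrow> 'v set" for v where
  cyc_base: "v \<in> cyc v"
| cyc_add: "a \<in> cyc v \<Longrightarrow> b \<in> cyc v \<Longrightarrow> a + b \<in> cyc v"
| cyc_sc: "a \<in> cyc v \<Longrightarrow> app (sc c) a \<in> cyc v"
| cyc_gop: "a \<in> cyc v \<Longrightarrow> app (gp g) a \<in> cyc v"

lemma ev_in_cyc: "app (ev p) v \<in> cyc v"
proof (induction p rule: poly_mapping_single_induct)
  case zero
  have "app (sc 0) v \<in> cyc v" by (intro cyc.intros)
  then show ?case by (simp add: sc_zero)
next
  case (add p \<mu> c)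
  have "app (mmon (\<lambda>m. E (- int m - 1)) \<mu>) v \<in> cyc v"
  proof (induction \<mu>)
    case (add n \<mu>)
    then show ?case using cyc_gop[of _ v "(GE, - int n - 1)"] by (simp add: pe.mmon_add_mset)
  qed (simp add: cyc_base)
  then show ?case using add
    by (simp add: pe.peval_add pe.peval_single cyc.intros)
qed

text \<open>The action composed with the translation automorphism \<open>x\<^sub>\<plusminus>\<^sub>\<alpha>(n) \<mapsto> x\<^sub>\<plusminus>\<^sub>\<alpha>(n \<mp> 1)\<close>.\<close>

abbreviation "twE \<equiv> \<lambda>n. E (n - 1)"
abbreviation "twF \<equiv> \<lambda>n. F (n + 1)"
abbreviation "twH \<equiv> \<lambda>n. H n - (if n = 0 then sc (of_nat k) else 0)"

text \<open>The bracket of \<open>E (m - 1)\<close> with \<open>F (n + 1)\<close> has central term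
  \<open>(m - 1) k\<close> where \<open>m k\<close> is wanted; subtracting \<open>k\<close> from
  \<open>H 0\<close> makes up the difference.\<close>

lemma twisted_rep:
  "sl2_rep sc twE twF twH k"
proof -
  have scsc: "sc a * sc b = sc b * sc a" for a b
    by (metis mult.commute sc_mult)
  show ?thesis
  proof (standard, goal_cases)
    case (9 m n)
    then show ?case using HE[of m "n - 1"] by (auto simp: algebra_simps sc_E)
  next
    case (10 m n)
    then show ?case using HF[of m "n + 1"] by (auto simp: algebra_simps sc_F)
  next
    case (11 m n)
    then show ?case using EF[of "m - 1" "n + 1"]
      by (auto simp: algebra_simps sc_diff)
  next
    case (12 m n)
    then show ?case using HH[of m n] by (auto simp: algebra_simps sc_H scsc)
  qed (auto simp: sc_add sc_mult sc_one sc_E sc_F sc_H EE FF algebra_simps scsc)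
qed

end

section \<open>Highest weight vectors and the powers of x_\<alpha>(-1) applied to them\<close>

locale hw_rep = sl2_rep sc E F H k
  for sc :: "complex \<Rightarrow> 'v::ab_group_add aend" and E F H and k +
  fixes v :: 'v and lam :: complex
  assumes raising_v: "raising g \<Longrightarrow> app (gp g) v = 0"
    and H0_v: "app (H 0) v = app (sc lam) v"
begin

lemma E_v: "n \<ge> 0 \<Longrightarrow> app (E n) v = 0"
  using raising_v[of "(GE, n)"] by (cases "n = 0") auto

lemma F_v: "n \<ge> 1 \<Longrightarrow> app (F n) v = 0"
  using raising_v[of "(GF, n)"] by auto

lemma H_v: "n \<ge> 1 \<Longrightarrow> app (H n) v = 0"
  using raising_v[of "(GH, n)"] by auto

lemma E_pow_comm: "E n * E m ^ s = E m ^ s * E n"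
  by (induction s) (simp, metis EE mult.assoc power_Suc)

lemma H0_E_pow: "app (H 0) (app (E (-1) ^ s) v) = app (sc (lam + 2 * of_nat s)) (app (E (-1) ^ s) v)"
proof (induction s)
  case 0
  then show ?case by (simp add: H0_v)
next
  case (Suc s)
  have "app (H 0) (app (E (-1) ^ Suc s) v) = app (H 0 * E (-1)) (app (E (-1) ^ s) v)" by simp
  also have "\<dots> = app (E (-1)) (app (H 0) (app (E (-1) ^ s) v)) + app (sc 2) (app (E (-1) ^ Suc s) v)"
    by (subst HE) simp
  also have "\<dots> = app (E (-1) * sc (lam + 2 * of_nat s)) (app (E (-1) ^ s) v) + app (sc 2) (app (E (-1) ^ Suc s) v)"
    by (simp add: Suc.IH)
  also have "\<dots> = app (sc (lam + 2 * of_nat s)) (app (E (-1) ^ Suc s) v) + app (sc 2) (app (E (-1) ^ Suc s) v)"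
    by (subst sc_E[symmetric]) simp
  also have "\<dots> = app (sc (lam + 2 * of_nat (Suc s))) (app (E (-1) ^ Suc s) v)"
    using sc_add[of "lam + 2 * of_nat s" 2] by (simp add: algebra_simps flip: app_simps(3))
  finally show ?case .
qed

text \<open>\<open>F 1\<close> and \<open>E (-1)\<close> belong to the sl(2)-triple of the affine
  simple root, whose Cartan element is \<open>k - H 0\<close>. For this triple \<open>v\<close> is a
  highest weight vector of weight \<open>k - lam\<close>, and the coefficient is the usual one along
  the string through \<open>v\<close>.\<close>

lemma F1_E_pow:
  "app (F 1) (app (E (-1) ^ Suc s) v) =
     app (sc (of_nat (Suc s) * (of_nat k - lam - of_nat s))) (app (E (-1) ^ s) v)"
proof (induction s)
  case 0
  have "app (F 1) (app (E (-1) ^ Suc 0) v) = app (F 1 * E (-1)) v" by simp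
  also have "F 1 * E (-1) = E (-1) * F 1 - H 0 + sc (of_nat k)"
    using EF[of "-1" 1] by (simp add: sc_minus algebra_simps)
  finally show ?case by (simp add: F_v H0_v sc_diff algebra_simps)
next
  case (Suc s)
  let ?w = "app (E (-1) ^ Suc s) v"
  have "app (F 1) (app (E (-1) ^ Suc (Suc s)) v) = app (F 1 * E (-1)) ?w" by simp
  also have "F 1 * E (-1) = E (-1) * F 1 - H 0 + sc (of_nat k)"
    using EF[of "-1" 1] by (simp add: sc_minus algebra_simps)
  also have "app \<dots> ?w = app (E (-1)) (app (F 1) ?w) - app (H 0) ?w + app (sc (of_nat k)) ?w"
    by simp
  also have "app (E (-1)) (app (F 1) ?w) =
      app (E (-1) * sc (of_nat (Suc s) * (of_nat k - lam - of_nat s))) (app (E (-1) ^ s) v)"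
    by (simp only: Suc.IH app_simps)
  also have "\<dots> = app (sc (of_nat (Suc s) * (of_nat k - lam - of_nat s))) ?w"
    by (subst sc_E[symmetric]) simp
  also have "app (H 0) ?w = app (sc (lam + 2 * of_nat (Suc s))) ?w"
    by (rule H0_E_pow)
  also have "app (sc (of_nat (Suc s) * (of_nat k - lam - of_nat s))) ?w
       - app (sc (lam + 2 * of_nat (Suc s))) ?w + app (sc (of_nat k)) ?w
     = app (sc (of_nat (Suc s) * (of_nat k - lam - of_nat s) - (lam + 2 * of_nat (Suc s)) + of_nat k)) ?w"
    unfolding sc_add sc_diff by simp
  also have "of_nat (Suc s) * (of_nat k - lam - of_nat s) - (lam + 2 * of_nat (Suc s)) + of_nat k
     = of_nat (Suc (Suc s)) * (of_nat k - lam - of_nat (Suc s))"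
    by (simp add: algebra_simps)
  finally show ?case .
qed

text \<open>Moving \<open>H n\<close> or \<open>F (n + 1)\<close> past \<open>E (-1)\<close>
  produces only \<open>E (n - 1)\<close> or \<open>H n\<close>, which kill the remaining vector; no
  central term occurs because \<open>n\<close> is positive.\<close>

lemma E_pow_raising:
  assumes "n \<ge> 1"
  shows "app (H n) (app (E (-1) ^ s) v) = 0" "app (F (n + 1)) (app (E (-1) ^ s) v) = 0"
proof -
  have 0: "app (E m) (app (E (-1) ^ s) v) = 0" if "m \<ge> 0" for m s
    using that E_pow_comm[of m "-1" s] E_v[OF that] by (metis app_simps(6) app_zero)
  have H: "app (H n) (app (E (-1) ^ s) v) = 0" if "n \<ge> 1" for n s
  proof (induction s)
    case (Suc s)
    have "app (H n) (app (E (-1) ^ Suc s) v) = app (H n * E (-1)) (app (E (-1) ^ s) v)" by simp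
    also have "\<dots> = 0" using Suc 0[of "n - 1" s] that by (subst HE) simp
    finally show ?case .
  qed (simp add: H_v that)
  show "app (H n) (app (E (-1) ^ s) v) = 0" by (rule H[OF assms])
  show "app (F (n + 1)) (app (E (-1) ^ s) v) = 0"
  proof (induction s)
    case 0
    then show ?case using F_v[of "n + 1"] assms by simp
  next
    case (Suc s)
    have "F (n + 1) * E (-1) = E (-1) * F (n + 1) - H n"
      using EF[of "-1" "n + 1"] assms by (simp add: algebra_simps)
    then have "app (F (n + 1) * E (-1)) (app (E (-1) ^ s) v) = 0"
      using Suc H[OF assms, of s] by simp
    then show ?case by simp
  qed
qed

text \<open>Since \<open>twE 0 = E (-1)\<close>, the vanishing of the next power is what makes this
  vector highest for the twisted action. Its weight is \<open>lam + 2 i - k = i\<close>, so the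
  translation exchanges \<open>i\<close> and \<open>k - i\<close>.\<close>

lemma twisted_hw_rep:
  assumes lam: "lam = of_nat k - of_nat i" and kill: "app (E (-1) ^ Suc i) v = 0"
  shows "hw_rep sc twE twF twH k
           (app (E (-1) ^ i) v) (of_nat i)"
proof -
  interpret t: sl2_rep sc twE twF twH k
    by (rule twisted_rep)
  let ?w = "app (E (-1) ^ i) v"
  have e: "app (E m) ?w = 0" if "m \<ge> -1" for m
  proof (cases "m = -1")
    case True
    then show ?thesis using kill by simp
  next
    case False
    then show ?thesis using that E_pow_comm[of m "-1" i] E_v[of m]
      by (metis app_simps(6) app_zero diff_0 linorder_not_le order_le_less zle_diff1_eq)
  qed
  show ?thesis
  proof
    fix g :: "gen \<times> int" assume "raising g"
    then show "app (gop twE twF twH g) ?w = 0"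
      using E_pow_raising[of "snd g" i] e[of "snd g - 1"]
      by (cases g; cases "fst g") auto
  next
    have "app (H 0) ?w - app (sc (of_nat k)) ?w = app (sc (lam + 2 * of_nat i - of_nat k)) ?w"
      by (simp add: H0_E_pow sc_diff)
    also have "lam + 2 * of_nat i - of_nat k = of_nat i" by (simp add: lam)
    finally show "app (H 0 - (if (0::int) = 0 then sc (of_nat k) else 0)) ?w = app (sc (of_nat i)) ?w"
      by simp
  qed
qed

end

text \<open>The functional \<open>\<phi>\<close> reads off the coefficient of \<open>v\<close> and
  vanishes on everything of the form "lowering operator applied to a vector". The assumption
  \<open>faithful\<close> says that \<open>U v\<close> has no non-zero vector all of whose
  descendants are invisible to \<open>\<phi>\<close>.\<close>

locale faithful_hw = hw_rep sc E F H k v lam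
  for sc :: "complex \<Rightarrow> 'v::ab_group_add aend" and E F H k v lam +
  fixes \<phi> :: "'v \<Rightarrow> complex"
  assumes phi_add: "\<phi> (a + b) = \<phi> a + \<phi> b"
    and phi_sc: "\<phi> (app (sc c) a) = c * \<phi> a"
    and phi_v: "\<phi> v = 1"
    and phi_lowering: "lowering g \<Longrightarrow> \<phi> (app (gp g) a) = 0"
    and faithful: "a \<in> cyc v \<Longrightarrow> (\<And>gs. \<phi> (app (prod_list (map gp gs)) a) = 0) \<Longrightarrow> a = 0"
begin

lemma phi_zero: "\<phi> 0 = 0"
  using phi_add[of 0 0] by simp

end

section \<open>Comparison of two highest weight modules of the same weight\<close>

locale two_hw =
  A: hw_rep sc1 E1 F1 H1 k v1 lam + B: hw_rep sc2 E2 F2 H2 k v2 lam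
  for sc1 :: "complex \<Rightarrow> 'v1::ab_group_add aend" and E1 F1 H1 v1
    and sc2 :: "complex \<Rightarrow> 'v2::ab_group_add aend" and E2 F2 H2 v2 and k lam
begin

text \<open>The submodule of the direct sum generated by the pair of highest weight vectors, written
  as a relation. It compares the two modules without a common cover such as a Verma module.\<close>

inductive graph :: "'v1 \<Rightarrow> 'v2 \<Rightarrow> bool" where
  base: "graph v1 v2"
| add: "graph a1 a2 \<Longrightarrow> graph b1 b2 \<Longrightarrow> graph (a1 + b1) (a2 + b2)"
| sc: "graph a1 a2 \<Longrightarrow> graph (app (sc1 c) a1) (app (sc2 c) a2)"
| lower: "graph a1 a2 \<Longrightarrow> lowering t \<Longrightarrow>
    graph (app (A.gp t) a1) (app (B.gp t) a2)"

text \<open>Moving a generator to the right through the lowering operators produces only shorter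
  words, so closure under lowering operators implies closure under all generators.\<close>

lemma graph_gop: "graph a1 a2 \<Longrightarrow> graph (app (A.gp g) a1) (app (B.gp g) a2)"
proof (induction arbitrary: g rule: graph.induct)
  case base
  consider "lowering g" | "raising g" | "g = (GH, 0)" using gen_trichotomy by blast
  then show ?case
  proof cases
    case 1
    then show ?thesis by (intro graph.intros)
  next
    case 2
    have "graph (app (sc1 0) v1) (app (sc2 0) v2)" by (intro graph.intros)
    then show ?thesis using 2 by (simp add: A.sc_zero B.sc_zero A.raising_v B.raising_v)
  next
    case 3
    then show ?thesis using graph.sc[OF graph.base, of lam] by (simp add: A.H0_v B.H0_v)
  qed
next
  case (add a1 a2 b1 b2)
  then show ?case by (simp add: graph.add)
next
  case (sc a1 a2 c)
  have "app (A.gp g) (app (sc1 c) a1) = app (sc1 c) (app (A.gp g) a1)"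
    using A.sc_gop[of c g] by (metis app_simps(6))
  moreover have "app (B.gp g) (app (sc2 c) a2) = app (sc2 c) (app (B.gp g) a2)"
    using B.sc_gop[of c g] by (metis app_simps(6))
  ultimately show ?case using sc.IH by (simp add: graph.sc)
next
  case (lower a1 a2 t)
  have "app (A.gp g) (app (A.gp t) a1) =
      app (A.gp t) (app (A.gp g) a1)
      + app (sc1 (br_coeff g t)) (app (A.gp (br_gen g t)) a1) + app (sc1 (br_central k g t)) a1"
    using arg_cong[OF A.gop_bracket[of g t], of "\<lambda>x. app x a1"] by simp
  moreover have "app (B.gp g) (app (B.gp t) a2) =
      app (B.gp t) (app (B.gp g) a2)
      + app (sc2 (br_coeff g t)) (app (B.gp (br_gen g t)) a2) + app (sc2 (br_central k g t)) a2"
    using arg_cong[OF B.gop_bracket[of g t], of "\<lambda>x. app x a2"] by simp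
  ultimately show ?case using lower by (simp add: graph.intros)
qed

end

locale two_faithful_hw =
  A: faithful_hw sc1 E1 F1 H1 k v1 lam \<phi>1 + B: faithful_hw sc2 E2 F2 H2 k v2 lam \<phi>2
  for sc1 :: "complex \<Rightarrow> 'v1::ab_group_add aend" and E1 F1 H1 v1 \<phi>1
    and sc2 :: "complex \<Rightarrow> 'v2::ab_group_add aend" and E2 F2 H2 v2 \<phi>2 and k lam
begin

sublocale two_hw sc1 E1 F1 H1 v1 sc2 E2 F2 H2 v2 k lam ..

text \<open>The rules of \<open>graph\<close> apply lowering operators only, and both functionals
  vanish on their images; hence the induction closes without computing any bracket.\<close>

lemma graph_phi: "graph a1 a2 \<Longrightarrow> \<phi>1 a1 = \<phi>2 a2"
  by (induction rule: graph.induct)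
    (simp_all add: A.phi_v B.phi_v A.phi_add B.phi_add A.phi_sc B.phi_sc A.phi_lowering B.phi_lowering)

lemma graph_word:
  "graph a1 a2 \<Longrightarrow>
    graph (app (prod_list (map (A.gp) gs)) a1) (app (prod_list (map (B.gp) gs)) a2)"
  by (induction gs) (simp_all add: graph_gop)

lemma graph_ev: "graph (app (A.ev p) v1) (app (B.ev p) v2)"
proof (induction p rule: poly_mapping_single_induct)
  case zero
  have "graph (app (sc1 0) v1) (app (sc2 0) v2)" by (intro graph.intros)
  then show ?case by (simp add: A.sc_zero B.sc_zero)
next
  case (add p \<mu> c)
  have "graph (app (mmon (\<lambda>m. E1 (- int m - 1)) \<mu>) v1) (app (mmon (\<lambda>m. E2 (- int m - 1)) \<mu>) v2)"
  proof (induction \<mu>)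
    case (add n \<mu>)
    then show ?case using graph_gop[of _ _ "(GE, - int n - 1)"]
      by (simp add: A.pe.mmon_add_mset B.pe.mmon_add_mset)
  qed (simp add: graph.base)
  then show ?case using add
    by (simp add: A.pe.peval_add A.pe.peval_single B.pe.peval_add B.pe.peval_single graph.intros)
qed

text \<open>A vector of the second module paired with 0 has, after any word in the generators, the
  same functional value as 0 in the first; so it is 0 by faithfulness.\<close>

theorem annihilator_transfer:
  assumes "app (A.ev p) v1 = 0"
  shows "app (B.ev p) v2 = 0"
proof (rule B.faithful[OF B.ev_in_cyc])
  fix gs
  have "graph (app (prod_list (map (A.gp) gs)) (app (A.ev p) v1))
      (app (prod_list (map (B.gp) gs)) (app (B.ev p) v2))"
    by (intro graph_word graph_ev)
  from graph_phi[OF this] show "\<phi>2 (app (prod_list (map (B.gp) gs)) (app (B.ev p) v2)) = 0"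
    by (simp add: assms A.phi_zero)
qed

end

section \<open>Unitary representations\<close>

locale unitary_rep = sl2_rep sc E F H k
  for sc :: "complex \<Rightarrow> 'v::ab_group_add aend" and E F H k +
  fixes ip :: "'v \<Rightarrow> 'v \<Rightarrow> complex"
  assumes ip_add_left: "ip (a + b) c = ip a c + ip b c"
    and ip_add_right: "ip a (b + c) = ip a b + ip a c"
    and ip_sc_left: "ip (app (sc z) a) b = cnj z * ip a b"
    and ip_sc_right: "ip a (app (sc z) b) = z * ip a b"
    and ip_E: "ip (app (E n) a) b = ip a (app (F (- n)) b)"
    and ip_F: "ip (app (F n) a) b = ip a (app (E (- n)) b)"
    and ip_H: "ip (app (H n) a) b = ip a (app (H (- n)) b)"
    and ip_pos: "ip a a = 0 \<Longrightarrow> a = 0"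
begin

lemma ip_zero_left: "ip 0 a = 0"
  using ip_add_left[of 0 0 a] by simp

lemma ip_zero_right: "ip a 0 = 0"
  using ip_add_right[of a 0 0] by simp

fun adj :: "gen \<times> int \<Rightarrow> gen \<times> int" where
  "adj (GE, n) = (GF, - n)"
| "adj (GF, n) = (GE, - n)"
| "adj (GH, n) = (GH, - n)"

lemma ip_gop: "ip (app (gp g) a) b = ip a (app (gp (adj g)) b)"
  by (cases g; cases "fst g") (auto simp: ip_E ip_F ip_H)

lemma ip_gop': "ip a (app (gp g) b) = ip (app (gp (adj g)) a) b"
  by (cases g; cases "fst g") (auto simp: ip_E ip_F ip_H)

lemma raising_adj: "lowering g \<Longrightarrow> raising (adj g)"
  by (cases g; cases "fst g") auto

lemma twisted_unitary:
  "unitary_rep sc twE twF twH k ip"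
proof -
  interpret t: sl2_rep sc twE twF twH k
    by (rule twisted_rep)
  have ip_diff: "ip (a - b) c = ip a c - ip b c" "ip c (a - b) = ip c a - ip c b" for a b c
    using ip_add_left[of "a - b" b c] ip_add_right[of c "a - b" b] by (simp_all add: algebra_simps)
  show ?thesis
    by unfold_locales
      (auto simp: ip_add_left ip_add_right ip_diff ip_sc_left ip_sc_right ip_E ip_F ip_H ip_pos
        ip_zero_left ip_zero_right algebra_simps)
qed

text \<open>The functional is the normalised inner product with \<open>v\<close>. It kills images of
  lowering operators because their adjoints are raising and kill \<open>v\<close>; a vector of
  \<open>U v\<close> that it cannot see is orthogonal to \<open>U v\<close>, hence to
  itself.\<close>

lemma faithful_hw:
  assumes "hw_rep sc E F H k v lam" "v \<noteq> 0"
  shows "faithful_hw sc E F H k v lam (\<lambda>a. ip v a / ip v v)"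
proof -
  interpret hw_rep sc E F H k v lam by fact
  have vv: "ip v v \<noteq> 0" using assms(2) ip_pos by blast
  show ?thesis
  proof
    fix g a assume "lowering g"
    then have "raising (adj g)" by (rule raising_adj)
    then show "ip v (app (gp g) a) / ip v v = 0"
      by (simp add: ip_gop' raising_v ip_zero_left)
  next
    fix a assume a: "a \<in> cyc v"
      and *: "\<And>gs. ip v (app (prod_list (map gp gs)) a) / ip v v = 0"
    \<comment> \<open>Generalised over \<open>a\<close>: passing a generator across the form
      replaces \<open>a\<close> by the adjoint generator applied to \<open>a\<close>.\<close>
    have "ip b a = 0" if "b \<in> cyc v" "\<And>gs. ip v (app (prod_list (map gp gs)) a) = 0" for a b
      using that
    proof (induction arbitrary: a rule: cyc.induct)
      case cyc_base
      then show ?case using cyc_base[of "[]"] by simp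
    next
      case (cyc_gop b g)
      have "ip v (app (prod_list (map gp gs)) (app (gp (adj g)) a)) = 0" for gs
        using cyc_gop.prems[of "gs @ [adj g]"] by simp
      then show ?case by (simp add: ip_gop cyc_gop.IH)
    qed (simp_all add: ip_add_left ip_sc_left)
    then have "ip a a = 0" using a * vv by simp
    then show "a = 0" by (rule ip_pos)
  qed (simp_all add: vv ip_add_right ip_sc_right add_divide_distrib)
qed

text \<open>At \<open>lam = k - i\<close> the coefficient in \<open>F1_E_pow\<close> vanishes for
  \<open>s = i\<close>. As \<open>F 1\<close> is the adjoint of \<open>E (-1)\<close>, the vector
  has norm zero.\<close>

lemma E_pow_kill:
  assumes "hw_rep sc E F H k v (of_nat k - of_nat i)"
  shows "app (E (-1) ^ Suc i) v = 0"
proof -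
  interpret hw_rep sc E F H k v "of_nat k - of_nat i" by fact
  have 0: "app (F 1) (app (E (-1) ^ Suc i) v) = 0"
    by (simp only: F1_E_pow) (simp add: sc_zero)
  have "ip (app (E (-1) ^ Suc i) v) (app (E (-1) ^ Suc i) v)
      = ip (app (E (-1)) (app (E (-1) ^ i) v)) (app (E (-1) ^ Suc i) v)" by simp
  also have "\<dots> = ip (app (E (-1) ^ i) v) (app (F 1) (app (E (-1) ^ Suc i) v))"
    by (subst ip_E) simp
  also have "\<dots> = 0" by (simp only: 0 ip_zero_right)
  finally show ?thesis by (rule ip_pos)
qed

end

context hw_rep
begin

text \<open>For \<open>s < i\<close> the coefficient \<open>(s + 1) (i - s)\<close> in
  \<open>F1_E_pow\<close> is non-zero, so \<open>F 1\<close> recovers each power from the next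
  one.\<close>

lemma E_pow_nonzero:
  assumes "v \<noteq> 0" "lam = of_nat k - of_nat i" "s \<le> i"
  shows "app (E (-1) ^ s) v \<noteq> 0"
  using assms(3)
proof (induction s)
  case (Suc s)
  show ?case
  proof
    assume "app (E (-1) ^ Suc s) v = 0"
    then have "app (sc (of_nat (Suc s) * (of_nat i - of_nat s))) (app (E (-1) ^ s) v) = 0"
      using F1_E_pow[of s] by (simp add: assms(2))
    then have "app (sc (1 / (of_nat (Suc s) * (of_nat i - of_nat s))) * sc (of_nat (Suc s) * (of_nat i - of_nat s)))
       (app (E (-1) ^ s) v) = 0"
      by simp
    moreover have "(of_nat (Suc s) * (of_nat i - of_nat s) :: complex) \<noteq> 0"
      using Suc.prems by (simp del: of_nat_Suc)
    ultimately have "app (E (-1) ^ s) v = 0"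
      by (simp add: sc_mult[symmetric] sc_one)
    then show False using Suc by simp
  qed
qed (use assms in simp)

end

section \<open>Locally finite sums of endomorphisms\<close>

text \<open>The infinite sums of operators below make sense because only finitely many summands act
  non-trivially on any given vector.\<close>

definition loc_fin :: "('i \<Rightarrow> 'v::ab_group_add aend) \<Rightarrow> bool" where
  "loc_fin A \<longleftrightarrow> (\<forall>f. finite {x. app (A x) f \<noteq> 0})"

definition lsum :: "('i \<Rightarrow> 'v::ab_group_add aend) \<Rightarrow> 'v aend" where
  "lsum A = Aend (\<lambda>f. Sum_any (\<lambda>x. app (A x) f))"

lemma app_lsum: "loc_fin A \<Longrightarrow> app (lsum A) f = Sum_any (\<lambda>x. app (A x) f)"
  unfolding lsum_def by (subst app_Aend) (auto simp: loc_fin_def Sum_any.distrib)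

lemma app_lsum_superset:
  assumes "loc_fin A" "finite X" "{x. app (A x) f \<noteq> 0} \<subseteq> X"
  shows "app (lsum A) f = (\<Sum>x\<in>X. app (A x) f)"
  using assms by (simp add: app_lsum Sum_any.expand_superset)

lemma loc_fin_add: "loc_fin A \<Longrightarrow> loc_fin B \<Longrightarrow> loc_fin (\<lambda>x. A x + B x)"
  unfolding loc_fin_def
proof
  fix f assume "\<forall>f. finite {x. app (A x) f \<noteq> 0}" "\<forall>f. finite {x. app (B x) f \<noteq> 0}"
  then have "finite ({x. app (A x) f \<noteq> 0} \<union> {x. app (B x) f \<noteq> 0})" by blast
  then show "finite {x. app (A x + B x) f \<noteq> 0}" by (rule finite_subset[rotated]) auto
qed

lemma loc_fin_minus: "loc_fin A \<Longrightarrow> loc_fin (\<lambda>x. - A x)"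
  by (simp add: loc_fin_def)

lemma loc_fin_diff: "loc_fin A \<Longrightarrow> loc_fin B \<Longrightarrow> loc_fin (\<lambda>x. A x - B x)"
  using loc_fin_add[OF _ loc_fin_minus, of A B] by simp

lemma loc_fin_mult_right: "loc_fin A \<Longrightarrow> loc_fin (\<lambda>x. A x * C)"
  by (simp add: loc_fin_def)

lemma loc_fin_mult_left: "loc_fin A \<Longrightarrow> loc_fin (\<lambda>x. C * A x)"
  unfolding loc_fin_def
proof
  fix f assume "\<forall>f. finite {x. app (A x) f \<noteq> 0}"
  then have "finite {x. app (A x) f \<noteq> 0}" by blast
  then show "finite {x. app (C * A x) f \<noteq> 0}" by (rule finite_subset[rotated]) auto
qed

lemma loc_fin_finite: "finite {x. A x \<noteq> 0} \<Longrightarrow> loc_fin A"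
  unfolding loc_fin_def by (auto elim!: finite_subset[rotated])

lemma lsum_add: "loc_fin A \<Longrightarrow> loc_fin B \<Longrightarrow> lsum (\<lambda>x. A x + B x) = lsum A + lsum B"
  by (rule aend_eqI) (simp add: app_lsum loc_fin_add, simp add: loc_fin_def Sum_any.distrib)

lemma lsum_mult_right: "loc_fin A \<Longrightarrow> lsum (\<lambda>x. A x * C) = lsum A * C"
  by (rule aend_eqI) (simp add: app_lsum loc_fin_mult_right)

lemma lsum_mult_left:
  assumes "loc_fin A" shows "lsum (\<lambda>x. C * A x) = C * lsum A"
proof (rule aend_eqI)
  fix f
  let ?X = "{x. app (A x) f \<noteq> 0}"
  have "finite ?X" using assms by (simp add: loc_fin_def)
  then show "app (lsum (\<lambda>x. C * A x)) f = app (C * lsum A) f"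
    using assms loc_fin_mult_left[OF assms, of C]
    by (subst app_lsum_superset[of _ ?X]) (auto simp: app_lsum_superset[of A ?X] app_sum)
qed

lemma lsum_minus: "loc_fin A \<Longrightarrow> lsum (\<lambda>x. - A x) = - lsum A"
  using lsum_mult_left[of A "- 1"] by simp

lemma lsum_diff: "loc_fin A \<Longrightarrow> loc_fin B \<Longrightarrow> lsum (\<lambda>x. A x - B x) = lsum A - lsum B"
  using lsum_add[OF _ loc_fin_minus, of A B] by (simp add: lsum_minus)

lemma lsum_finite:
  assumes "finite X" "\<And>x. x \<notin> X \<Longrightarrow> A x = 0"
  shows "lsum A = sum A X"
proof (rule aend_eqI)
  fix f
  have "{x. A x \<noteq> 0} \<subseteq> X" using assms(2) by auto
  then have "loc_fin A" using assms(1) by (intro loc_fin_finite) (rule finite_subset)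
  moreover have "{x. app (A x) f \<noteq> 0} \<subseteq> X" using assms(2) by force
  ultimately show "app (lsum A) f = app (sum A X) f"
    using assms(1) by (subst app_lsum_superset[of _ X]) (auto simp: app_sum_left)
qed

lemma lsum_reindex:
  assumes "bij h" shows "lsum (\<lambda>x. A (h x)) = lsum A" "loc_fin A \<Longrightarrow> loc_fin (\<lambda>x. A (h x))"
proof -
  have "Sum_any (\<lambda>x. app (A x) f) = Sum_any (\<lambda>x. app (A (h x)) f)" for f
    using assms by (intro Sum_any.reindex_cong[of h]) (auto simp: bij_def)
  then show "lsum (\<lambda>x. A (h x)) = lsum A" by (simp add: lsum_def)
  assume *: "loc_fin A"
  show "loc_fin (\<lambda>x. A (h x))" unfolding loc_fin_def
  proof
    fix f
    have "finite {x. app (A x) f \<noteq> 0}" using * by (simp add: loc_fin_def)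
    from finite_vimageI[OF this, of h] show "finite {x. app (A (h x)) f \<noteq> 0}"
      using assms by (simp add: bij_def vimage_def)
  qed
qed

section \<open>Fermionic Fock space\<close>

text \<open>A mode \<open>(a, j, m)\<close> is the component \<open>a\<close> (of \<open>\<complex>\<^sup>2\<close>) of the \<open>j\<close>-th copy, with \<open>t\<close>-exponent \<open>m\<close>.
  Semi-infinite monomials are encoded by their set of occupied modes; only finitely many occupied
  modes precede a given one in the enumeration \<open>to_nat\<close>, so that the signs make sense.\<close>

type_synonym fmode = "bool \<times> nat \<times> int"

definition dirac_sea :: "fmode set" where
  "dirac_sea = {(a, j, m). m < 0}"

definition admissible :: "fmode set \<Rightarrow> bool" where
  "admissible S \<longleftrightarrow> finite (S - dirac_sea) \<and> finite (dirac_sea - S)"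

lemma admissible_insert [simp]: "admissible (insert p S) \<longleftrightarrow> admissible S"
proof -
  have "finite (dirac_sea - insert p S) \<longleftrightarrow> finite (dirac_sea - S)"
    by (metis Diff_insert finite_Diff_insert)
  then show ?thesis
    by (simp add: admissible_def insert_Diff_if)
qed

lemma admissible_remove [simp]: "admissible (S - {p}) \<longleftrightarrow> admissible S"
  by (metis admissible_insert insert_Diff_single)

text \<open>The Jordan-Wigner sign: a fermion put into mode \<open>p\<close> has to pass the
  occupied modes enumerated before \<open>p\<close>.\<close>

definition sgn_at :: "fmode \<Rightarrow> fmode set \<Rightarrow> complex" where
  "sgn_at p S = (-1) ^ card {s \<in> S. to_nat s < to_nat p}"

lemma finite_before: "finite {s \<in> S. to_nat (s :: fmode) < n}"
proof -
  have "finite (to_nat -` {..<n} :: fmode set)" by (rule finite_vimageI) auto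
  then show ?thesis by (rule finite_subset[rotated]) auto
qed

lemma sgn_at_insert_self [simp]: "sgn_at p (insert p S) = sgn_at p S"
  unfolding sgn_at_def by (rule arg_cong[of _ _ "\<lambda>A. (-1) ^ card A"]) auto

lemma sgn_at_remove_self [simp]: "sgn_at p (S - {p}) = sgn_at p S"
  unfolding sgn_at_def by (rule arg_cong[of _ _ "\<lambda>A. (-1) ^ card A"]) auto

lemma sgn_at_insert:
  assumes "q \<notin> S"
  shows "sgn_at p (insert q S) = (if to_nat q < to_nat p then - sgn_at p S else sgn_at p S)"
proof (cases "to_nat q < to_nat p")
  case True
  then have "{s \<in> insert q S. to_nat s < to_nat p} = insert q {s \<in> S. to_nat s < to_nat p}" by auto
  then show ?thesis using True assms finite_before[of S "to_nat p"]
    by (simp add: sgn_at_def)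
next
  case False
  then have "{s \<in> insert q S. to_nat s < to_nat p} = {s \<in> S. to_nat s < to_nat p}" by auto
  then show ?thesis using False by (simp add: sgn_at_def)
qed

lemma sgn_at_remove:
  assumes "q \<in> S"
  shows "sgn_at p (S - {q}) = (if to_nat q < to_nat p then - sgn_at p S else sgn_at p S)"
  using sgn_at_insert[of q "S - {q}" p] assms by (simp add: insert_absorb split: if_splits)

lemma sgn_at_square [simp]: "sgn_at p S * sgn_at p S = 1" "sgn_at p S * (sgn_at p S * x) = x"
  by (simp_all add: sgn_at_def)

lemma cnj_sgn_at [simp]: "cnj (sgn_at p S) = sgn_at p S"
  by (simp add: sgn_at_def)

lemma mode_less: "p \<noteq> q \<Longrightarrow> \<not> to_nat p < to_nat q \<longleftrightarrow> to_nat q < to_nat (p :: fmode)"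
  by (metis inj_to_nat injD linorder_neqE_nat order_less_asym)

typedef fock = "{f :: fmode set \<Rightarrow> complex. finite {S. f S \<noteq> 0} \<and> (\<forall>S. f S \<noteq> 0 \<longrightarrow> admissible S)}"
  morphisms amp Fock
  by (rule exI[of _ "\<lambda>_. 0"]) simp

setup_lifting type_definition_fock

lemma finite_amp: "finite {S. amp f S \<noteq> 0}"
  using amp[of f] by simp

lemma admissible_amp: "amp f S \<noteq> 0 \<Longrightarrow> admissible S"
  using amp[of f] by simp

lemma fock_eqI: "(\<And>S. amp f S = amp g S) \<Longrightarrow> f = g"
  by (metis amp_inject ext)

lemma fock_closed:
  assumes "finite {S. f S \<noteq> 0} \<and> (\<forall>S. f S \<noteq> 0 \<longrightarrow> admissible S)"
    and "finite {S. g S \<noteq> 0} \<and> (\<forall>S. g S \<noteq> 0 \<longrightarrow> admissible S)"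
    and "\<And>S. h S \<noteq> 0 \<Longrightarrow> f S \<noteq> 0 \<or> g S \<noteq> 0"
  shows "finite {S. h S \<noteq> 0} \<and> (\<forall>S. h S \<noteq> 0 \<longrightarrow> admissible S)"
proof
  have "{S. h S \<noteq> 0} \<subseteq> {S. f S \<noteq> 0} \<union> {S. g S \<noteq> 0}" using assms(3) by blast
  then show "finite {S. h S \<noteq> 0}" using assms(1,2) by (meson finite_UnI finite_subset)
  show "\<forall>S. h S \<noteq> 0 \<longrightarrow> admissible S" using assms by blast
qed

instantiation fock :: ab_group_add
begin
lift_definition zero_fock :: fock is "\<lambda>_. 0" by simp
lift_definition plus_fock :: "fock \<Rightarrow> fock \<Rightarrow> fock" is "\<lambda>f g S. f S + g S"
proof -
  fix f g :: "fmode set \<Rightarrow> complex"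
  assume "finite {S. f S \<noteq> 0} \<and> (\<forall>S. f S \<noteq> 0 \<longrightarrow> admissible S)"
    "finite {S. g S \<noteq> 0} \<and> (\<forall>S. g S \<noteq> 0 \<longrightarrow> admissible S)"
  then show "finite {S. f S + g S \<noteq> 0} \<and> (\<forall>S. f S + g S \<noteq> 0 \<longrightarrow> admissible S)"
    by (elim fock_closed) auto
qed
lift_definition uminus_fock :: "fock \<Rightarrow> fock" is "\<lambda>f S. - f S" by simp
lift_definition minus_fock :: "fock \<Rightarrow> fock \<Rightarrow> fock" is "\<lambda>f g S. f S - g S"
proof -
  fix f g :: "fmode set \<Rightarrow> complex"
  assume "finite {S. f S \<noteq> 0} \<and> (\<forall>S. f S \<noteq> 0 \<longrightarrow> admissible S)"
    "finite {S. g S \<noteq> 0} \<and> (\<forall>S. g S \<noteq> 0 \<longrightarrow> admissible S)"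
  then show "finite {S. f S - g S \<noteq> 0} \<and> (\<forall>S. f S - g S \<noteq> 0 \<longrightarrow> admissible S)"
    by (elim fock_closed) auto
qed
instance
proof
  fix a b c :: fock
  show "a + b + c = a + (b + c)" "a + b = b + a" "0 + a = a" "- a + a = 0" "a - b = a + - b"
    by (rule fock_eqI; simp add: plus_fock.rep_eq zero_fock.rep_eq uminus_fock.rep_eq minus_fock.rep_eq)+
qed
end

lemma amp_simps [simp]:
  "amp 0 S = 0" "amp (f + g) S = amp f S + amp g S" "amp (- f) S = - amp f S"
  "amp (f - g) S = amp f S - amp g S"
  by (simp_all add: plus_fock.rep_eq zero_fock.rep_eq uminus_fock.rep_eq minus_fock.rep_eq)

lift_definition ket :: "fmode set \<Rightarrow> fock" is "\<lambda>S T. if T = S \<and> admissible S then 1 else 0"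
  by auto

lemma amp_ket: "amp (ket S) T = (if T = S \<and> admissible S then 1 else 0)"
  by transfer simp

lemma admissible_sea: "admissible dirac_sea"
  by (simp add: admissible_def)

instance fock :: nontrivial_ab_group_add
proof
  have "amp (ket dirac_sea) dirac_sea \<noteq> 0" by (simp add: amp_ket admissible_sea)
  then show "\<exists>x :: fock. x \<noteq> 0" by (metis amp_simps(1))
qed

lemma fock_closed_image:
  assumes "finite {S. f S \<noteq> 0} \<and> (\<forall>S. f S \<noteq> 0 \<longrightarrow> admissible S)"
    and "\<And>S. h S \<noteq> 0 \<Longrightarrow> S = T (U S) \<and> f (U S) \<noteq> 0 \<and> (admissible (U S) \<longrightarrow> admissible S)"
  shows "finite {S. h S \<noteq> 0} \<and> (\<forall>S. h S \<noteq> 0 \<longrightarrow> admissible S)"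
proof
  have "{S. h S \<noteq> 0} \<subseteq> T ` {S. f S \<noteq> 0}" using assms(2) by blast
  then show "finite {S. h S \<noteq> 0}" using assms(1) by (meson finite_imageI finite_subset)
  show "\<forall>S. h S \<noteq> 0 \<longrightarrow> admissible S" using assms by blast
qed

lift_definition fscale0 :: "complex \<Rightarrow> fock \<Rightarrow> fock" is "\<lambda>c f S. c * f S"
  by (auto elim: finite_subset[rotated])

lift_definition cre0 :: "fmode \<Rightarrow> fock \<Rightarrow> fock" is
  "\<lambda>p f S. if p \<in> S then sgn_at p S * f (S - {p}) else 0"
  by (erule fock_closed_image[where T = "insert _" and U = "\<lambda>S. S - {_}"]) (auto split: if_splits)

lift_definition ann0 :: "fmode \<Rightarrow> fock \<Rightarrow> fock" is
  "\<lambda>p f S. if p \<in> S then 0 else sgn_at p S * f (insert p S)"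
  by (erule fock_closed_image[where T = "\<lambda>S. S - {_}" and U = "insert _"]) (auto split: if_splits)

definition fsc :: "complex \<Rightarrow> fock aend" where "fsc c = Aend (fscale0 c)"
definition psi :: "fmode \<Rightarrow> fock aend" where "psi p = Aend (cre0 p)"
definition psd :: "fmode \<Rightarrow> fock aend" where "psd p = Aend (ann0 p)"

lemma amp_fsc [simp]: "amp (app (fsc c) f) S = c * amp f S"
proof -
  have "app (fsc c) = fscale0 c" unfolding fsc_def
    by (rule app_Aend) (transfer, simp add: fun_eq_iff algebra_simps)
  then show ?thesis by (simp add: fscale0.rep_eq)
qed

lemma amp_psi: "amp (app (psi p) f) S = (if p \<in> S then sgn_at p S * amp f (S - {p}) else 0)"
proof -
  have "app (psi p) = cre0 p" unfolding psi_def
    by (rule app_Aend) (transfer, auto simp add: fun_eq_iff algebra_simps)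
  then show ?thesis by (simp add: cre0.rep_eq)
qed

lemma amp_psd: "amp (app (psd p) f) S = (if p \<in> S then 0 else sgn_at p S * amp f (insert p S))"
proof -
  have "app (psd p) = ann0 p" unfolding psd_def
    by (rule app_Aend) (transfer, auto simp add: fun_eq_iff algebra_simps)
  then show ?thesis by (simp add: ann0.rep_eq)
qed

lemma fsc_simps: "fsc (a + b) = fsc a + fsc b" "fsc (a * b) = fsc a * fsc b" "fsc 1 = 1"
  by (auto intro!: aend_eqI fock_eqI simp: algebra_simps)

lemma fsc_psi: "fsc c * psi p = psi p * fsc c"
  by (auto intro!: aend_eqI fock_eqI simp: amp_psi)

lemma fsc_psd: "fsc c * psd p = psd p * fsc c"
  by (auto intro!: aend_eqI fock_eqI simp: amp_psd)

subsection \<open>Canonical anticommutation relations\<close>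

text \<open>Of two distinct modes exactly the later one counts the other in its sign, so exchanging
  the order changes the sign once. For equal modes both sides vanish.\<close>

lemma psi_psi: "psi p * psi q = - (psi q * psi p)"
proof (cases "p = q")
  case True
  then show ?thesis by (auto intro!: aend_eqI fock_eqI simp: amp_psi)
next
  case False
  show ?thesis
  proof (intro aend_eqI fock_eqI)
    fix f S
    have "S - {p} - {q} = S - {q} - {p}" by auto
    then show "amp (app (psi p * psi q) f) S = amp (app (- (psi q * psi p)) f) S"
      using False mode_less[OF False] by (cases "to_nat p < to_nat q") (auto simp: amp_psi sgn_at_remove)
  qed
qed

lemma psd_psd: "psd p * psd q = - (psd q * psd p)"
proof (cases "p = q")
  case True
  then show ?thesis by (auto intro!: aend_eqI fock_eqI simp: amp_psd)
next
  case False
  show ?thesis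
  proof (intro aend_eqI fock_eqI)
    fix f S
    show "amp (app (psd p * psd q) f) S = amp (app (- (psd q * psd p)) f) S"
      using False mode_less[OF False] by (cases "to_nat p < to_nat q") (auto simp: amp_psd sgn_at_insert insert_commute)
  qed
qed

lemma psi_psd: "psi p * psd q = (if p = q then 1 else 0) - psd q * psi p"
proof (cases "p = q")
  case True
  then show ?thesis by (auto intro!: aend_eqI fock_eqI simp: amp_psi amp_psd insert_absorb)
next
  case False
  show ?thesis
  proof (intro aend_eqI fock_eqI)
    fix f S
    have "insert q (S - {p}) = insert q S - {p}" using False by auto
    then show "amp (app (psi p * psd q) f) S = amp (app ((if p = q then 1 else 0) - psd q * psi p) f) S"
      using False mode_less[OF False] by (cases "to_nat p < to_nat q") (auto simp: amp_psi amp_psd sgn_at_insert sgn_at_remove)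
  qed
qed

lemma psd_ket_zero: "p \<notin> S \<Longrightarrow> app (psd p) (ket S) = 0"
  by (rule fock_eqI) (auto simp: amp_psd amp_ket)

lemma psi_ket_zero: "p \<in> S \<Longrightarrow> app (psi p) (ket S) = 0"
  by (rule fock_eqI) (auto simp: amp_psi amp_ket)

lemma psd_ket: "p \<in> S \<Longrightarrow> app (psd p) (ket S) = app (fsc (sgn_at p S)) (ket (S - {p}))"
  by (rule fock_eqI) (auto simp: amp_psd amp_ket)

lemma psi_psd_ket: "app (psi p * psd p) (ket S) = (if p \<in> S then ket S else 0)"
proof (cases "p \<in> S")
  case True
  have "psi p * psd p = 1 - psd p * psi p" using psi_psd[of p p] by simp
  then show ?thesis using True by (simp del: app_simps(6), simp add: psi_ket_zero)
qed (simp add: psd_ket_zero)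

lemma psi_psd_ket_zero:
  assumes "p \<noteq> q" "q \<notin> S \<or> p \<in> S" shows "app (psi p * psd q) (ket S) = 0"
proof (cases "q \<in> S")
  case True
  have "psi p * psd q = - (psd q * psi p)" using psi_psd[of p q] assms(1) by simp
  then show ?thesis using True assms by (simp del: app_simps(6), simp add: psi_ket_zero)
qed (simp add: psd_ket_zero)

subsection \<open>The action of the affine Lie algebra\<close>

text \<open>The summand with index \<open>x = (j, l)\<close> moves a fermion of the
  \<open>j\<close>-th copy from exponent \<open>l\<close> to \<open>l - n\<close>. Thus positive
  \<open>n\<close> pushes towards the filled negative exponents, where the exclusion principle stops
  it.\<close>

definition bil :: "nat \<Rightarrow> bool \<Rightarrow> bool \<Rightarrow> int \<Rightarrow> nat \<times> int \<Rightarrow> fock aend" where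
  "bil k a b n x = (if fst x < k
     then psi (a, fst x, snd x - n) * psd (b, x) - (if a = b \<and> n = 0 \<and> snd x < 0 then 1 else 0) else 0)"

text \<open>\<open>rho k a b n\<close> is the action of the matrix unit \<open>E\<^sub>a\<^sub>b \<otimes> t\<^sup>n\<close>; the constant in \<open>bil\<close> is the
  normal ordering.\<close>

definition rho :: "nat \<Rightarrow> bool \<Rightarrow> bool \<Rightarrow> int \<Rightarrow> fock aend" where
  "rho k a b n = lsum (bil k a b n)"

lemma amp_psi_psd_nonzero:
  assumes "p \<noteq> q" "amp (app (psi p * psd q) f) T \<noteq> 0"
  shows "\<exists>S. amp f S \<noteq> 0 \<and> q \<in> S \<and> p \<notin> S"
  using assms by (intro exI[of _ "insert q (T - {p})"]) (auto simp: amp_psi amp_psd split: if_splits)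

lemma amp_psi_psd_same: "amp (app (psi p * psd p) f) S = (if p \<in> S then amp f S else 0)"
  by (auto simp: amp_psi amp_psd insert_absorb)

text \<open>A summand acts on a monomial only if its source is occupied and its target empty. Up to
  finitely many exceptions this means source in the sea and target outside, which leaves finitely
  many \<open>x\<close> in each of the \<open>k\<close> copies. In the diagonal case the subtracted
  constant cancels the contribution of the sea.\<close>

lemma loc_fin_bil: "loc_fin (bil k a b n)"
  unfolding loc_fin_def
proof
  fix f
  define U where "U S = {x. (b, x) \<in> S - dirac_sea} \<union> {x. (a, fst x, snd x - n) \<in> dirac_sea - S}
     \<union> {..<k} \<times> {- \<bar>n\<bar>..\<bar>n\<bar>} \<union> {x. (b, x) \<in> dirac_sea - S}" for S
  have fin: "finite (U S)" if "admissible S" for S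
  proof -
    have "inj (\<lambda>x::nat \<times> int. (b, x))" "inj (\<lambda>x::nat \<times> int. (a, fst x, snd x - n))"
      by (auto simp: inj_def prod_eq_iff)
    then have "finite ((\<lambda>x::nat \<times> int. (b, x)) -` (S - dirac_sea))"
      "finite ((\<lambda>x::nat \<times> int. (a, fst x, snd x - n)) -` (dirac_sea - S))"
      "finite ((\<lambda>x::nat \<times> int. (b, x)) -` (dirac_sea - S))"
      using that by (auto simp: admissible_def intro: finite_vimageI)
    then show ?thesis by (auto simp: U_def vimage_def)
  qed
  have sub: "{x. app (bil k a b n x) f \<noteq> 0} \<subseteq> (\<Union>S\<in>{S. amp f S \<noteq> 0}. U S)"
  proof
    fix x assume "x \<in> {x. app (bil k a b n x) f \<noteq> 0}"
    then have nz: "app (bil k a b n x) f \<noteq> 0" by simp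
    then have k: "fst x < k" by (auto simp: bil_def split: if_splits)
    obtain T where T: "amp (app (bil k a b n x) f) T \<noteq> 0"
      using nz by (metis amp_simps(1) fock_eqI)
    show "x \<in> (\<Union>S\<in>{S. amp f S \<noteq> 0}. U S)"
    proof (cases "a = b \<and> n = 0")
      case True
      then have "amp (app (psi (b, x) * psd (b, x)) f) T - (if snd x < 0 then amp f T else 0) \<noteq> 0"
        using T k by (auto simp: bil_def split: if_splits)
      then have "amp f T \<noteq> 0" "(b, x) \<in> T \<longleftrightarrow> \<not> snd x < 0"
        by (auto simp: amp_psi_psd_same simp del: app_simps split: if_splits)
      then show ?thesis by (auto simp: U_def dirac_sea_def)
    next
      case False
      then have "(a, fst x, snd x - n) \<noteq> (b, x)" by (auto simp: prod_eq_iff)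
      moreover have "amp (app (psi (a, fst x, snd x - n) * psd (b, x)) f) T \<noteq> 0"
        using T k False by (auto simp: bil_def)
      ultimately obtain S where S: "amp f S \<noteq> 0" "(b, x) \<in> S" "(a, fst x, snd x - n) \<notin> S"
        using amp_psi_psd_nonzero by blast
      then have "x \<in> U S"
        using k by (cases x) (auto simp: U_def dirac_sea_def)
      then show ?thesis using S by blast
    qed
  qed
  have "finite (\<Union>S\<in>{S. amp f S \<noteq> 0}. U S)"
    using fin finite_amp admissible_amp by blast
  then show "finite {x. app (bil k a b n x) f \<noteq> 0}" using sub by (rule finite_subset[rotated])
qed

lemma quadratic_commutators:
  fixes A B D \<delta> :: "'r::ring"
  shows "A * D = - (D * A) \<Longrightarrow> B * D = \<delta> - D * B \<Longrightarrow> A * B * D - D * (A * B) = A * \<delta>"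
    and "A * D = \<delta> - D * A \<Longrightarrow> D * B = - (B * D) \<Longrightarrow> A * B * D - D * (A * B) = - \<delta> * B"
proof -
  assume 1: "A * D = - (D * A)" and 2: "B * D = \<delta> - D * B"
  have "A * B * D = A * \<delta> - A * D * B"
    by (simp add: mult.assoc 2 right_diff_distrib)
  then show "A * B * D - D * (A * B) = A * \<delta>" by (simp add: 1 mult.assoc)
next
  assume 1: "A * D = \<delta> - D * A" and 2: "D * B = - (B * D)"
  have "A * B * D = - (A * D * B)" by (simp add: mult.assoc 2)
  then show "A * B * D - D * (A * B) = - \<delta> * B" by (simp add: 1 mult.assoc left_diff_distrib)
qed

lemma bil_commutator:
  "bil k a b n x * D - D * bil k a b n x = (if fst x < k
     then psi (a, fst x, snd x - n) * psd (b, x) * D - D * (psi (a, fst x, snd x - n) * psd (b, x)) else 0)"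
  by (cases "a = b \<and> n = 0 \<and> snd x < 0") (simp_all add: bil_def left_diff_distrib right_diff_distrib)

lemma bil_psi: "bil k a b n x * psi p - psi p * bil k a b n x =
    (if fst x < k \<and> p = (b, x) then psi (a, fst x, snd x - n) else 0)"
proof -
  have *: "psd (b, x) * psi p = (if p = (b, x) then 1 else 0) - psi p * psd (b, x)"
    using psi_psd[of p "(b, x)"] by (metis add.commute diff_add_cancel diff_diff_eq2)
  show ?thesis unfolding bil_commutator quadratic_commutators(1)[OF psi_psi *] by simp
qed

lemma bil_psd: "bil k a b n x * psd p - psd p * bil k a b n x =
    - (if fst x < k \<and> p = (a, fst x, snd x - n) then psd (b, x) else 0)"
  unfolding bil_commutator quadratic_commutators(2)[OF psi_psd psd_psd] by auto

text \<open>Creation operators transform like the natural module \<complex>^2 tensored with Laurent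
  polynomials, annihilation operators (\<open>rho_psd\<close>) like its dual. Only one summand of
  the infinite sum can fail to commute with a given fermion.\<close>

lemma rho_psi: "rho k a b n * psi (c, y) =
    psi (c, y) * rho k a b n + (if b = c \<and> fst y < k then psi (a, fst y, snd y - n) else 0)"
proof -
  have "rho k a b n * psi (c, y) - psi (c, y) * rho k a b n =
      lsum (\<lambda>x. bil k a b n x * psi (c, y) - psi (c, y) * bil k a b n x)"
    by (simp add: rho_def lsum_diff lsum_mult_left lsum_mult_right loc_fin_mult_left loc_fin_mult_right loc_fin_bil)
  also have "\<dots> = (\<Sum>x\<in>{y}. bil k a b n x * psi (c, y) - psi (c, y) * bil k a b n x)"
    by (rule lsum_finite) (auto simp only: bil_psi finite.intros split: if_splits)
  also have "\<dots> = (if b = c \<and> fst y < k then psi (a, fst y, snd y - n) else 0)"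
    by (simp only: bil_psi) auto
  finally show ?thesis by (simp add: algebra_simps)
qed

lemma rho_psd: "rho k a b n * psd (c, y) =
    psd (c, y) * rho k a b n - (if a = c \<and> fst y < k then psd (b, fst y, snd y + n) else 0)"
proof -
  have "rho k a b n * psd (c, y) - psd (c, y) * rho k a b n =
      lsum (\<lambda>x. bil k a b n x * psd (c, y) - psd (c, y) * bil k a b n x)"
    by (simp add: rho_def lsum_diff lsum_mult_left lsum_mult_right loc_fin_mult_left loc_fin_mult_right loc_fin_bil)
  also have "\<dots> = (\<Sum>x\<in>{(fst y, snd y + n)}. bil k a b n x * psd (c, y) - psd (c, y) * bil k a b n x)"
    by (rule lsum_finite) (auto simp only: bil_psd finite.intros split: if_splits, auto)
  also have "\<dots> = - (if a = c \<and> fst y < k then psd (b, fst y, snd y + n) else 0)"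
    by (simp only: bil_psd sum.insert finite.intros sum.empty) (cases y, auto)
  finally show ?thesis by (simp add: algebra_simps)
qed

lemma bij_shift: "bij (\<lambda>x::nat \<times> int. (fst x, snd x + m))"
  by (rule bij_betw_byWitness[where f' = "\<lambda>x. (fst x, snd x - m)"]) auto

text \<open>The normal-ordering constant at \<open>x\<close> minus the one at \<open>x\<close>
  translated by \<open>m\<close>. It is the sign of \<open>m\<close> at \<bar>m\<bar> indices of
  each copy and 0 elsewhere; summed over all copies it yields the central term
  \<open>m k\<close>.\<close>

definition sea_shift :: "nat \<Rightarrow> int \<Rightarrow> nat \<times> int \<Rightarrow> fock aend" where
  "sea_shift k m x = (if fst x < k then (if snd x < 0 then 1 else 0) - (if snd x + m < 0 then 1 else 0) else 0)"

lemma sea_shift_zero: "x \<notin> {..<k} \<times> (if m \<ge> 0 then {-m..<0} else {0..<-m}) \<Longrightarrow> sea_shift k m x = 0"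
  by (cases x) (auto simp: sea_shift_def)

lemma loc_fin_sea_shift: "loc_fin (sea_shift k m)"
proof (rule loc_fin_finite)
  have "{x. sea_shift k m x \<noteq> 0} \<subseteq> {..<k} \<times> (if m \<ge> 0 then {-m..<0} else {0..<-m})"
    using sea_shift_zero by blast
  then show "finite {x. sea_shift k m x \<noteq> 0}" by (rule finite_subset) simp
qed

lemma lsum_sea_shift: "lsum (sea_shift k m) = of_int m * of_nat k"
proof -
  let ?X = "{..<k} \<times> (if m \<ge> 0 then {-m..<0} else {0..<-m})"
  have "lsum (sea_shift k m) = sum (sea_shift k m) ?X"
    by (rule lsum_finite) (simp_all add: sea_shift_zero)
  also have "\<dots> = (\<Sum>x\<in>?X. if m \<ge> 0 then 1 else -1)"
    by (rule sum.cong) (auto simp: sea_shift_def split: if_splits)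
  also have "\<dots> = of_int m * of_nat k"
    by (cases "m \<ge> 0") (simp_all add: card_cartesian_product of_nat_nat mult_of_nat_commute[of k "of_int m"])
  finally show ?thesis .
qed

lemma if_mult_diff:
  fixes u v w z :: "'r::ring"
  shows "(if P then u else 0) * v + w * - (if Q then z else 0) = (if P then u * v else 0) - (if Q then w * z else 0)"
  by simp

text \<open>By the derivation rule \<open>rho\<close> changes one of the two fermions at a time.
  Rewriting both results in normal-ordered form leaves the difference of two constants,
  \<open>sea_shift\<close>.\<close>

lemma rho_bil:
  "rho k a b m * bil k c d n x - bil k c d n x * rho k a b m =
      (if b = c then bil k a d (m + n) x else 0) - (if a = d then bil k c b (m + n) (fst x, snd x + m) else 0)
      + (if b = c \<and> a = d \<and> m + n = 0 then sea_shift k m x else 0)"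
proof (cases "fst x < k")
  case True
  let ?\<rho> = "rho k a b m" and ?p = "(c, fst x, snd x - n)" and ?y = "(fst x, snd x + m)"
  define A where "A = psi (a, fst x, snd x - (m + n)) * psd (d, x)"
  define B where "B = psi ?p * psd (b, ?y)"
  have nA: "bil k a d (m + n) x = A - (if a = d \<and> m + n = 0 \<and> snd x < 0 then 1 else 0)"
    using True by (simp add: bil_def A_def)
  have nB: "bil k c b (m + n) ?y = B - (if c = b \<and> m + n = 0 \<and> snd x + m < 0 then 1 else 0)"
    using True by (simp add: bil_def B_def)
  have "?\<rho> * bil k c d n x - bil k c d n x * ?\<rho> = - (bil k c d n x * ?\<rho> - ?\<rho> * bil k c d n x)"
    by (rule minus_diff_eq[symmetric])
  also have "\<dots> = ?\<rho> * (psi ?p * psd (d, x)) - psi ?p * psd (d, x) * ?\<rho>"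
    unfolding bil_commutator if_P[OF True] by (rule minus_diff_eq)
  also have "\<dots> = (?\<rho> * psi ?p - psi ?p * ?\<rho>) * psd (d, x) + psi ?p * (?\<rho> * psd (d, x) - psd (d, x) * ?\<rho>)"
    by (simp add: left_diff_distrib right_diff_distrib mult.assoc)
  also have "?\<rho> * psi ?p - psi ?p * ?\<rho> = (if b = c then psi (a, fst x, snd x - (m + n)) else 0)"
    unfolding rho_psi using True by (simp add: diff_diff_eq add.commute)
  also have "?\<rho> * psd (d, x) - psd (d, x) * ?\<rho> = - (if a = d then psd (b, ?y) else 0)"
    unfolding rho_psd using True by simp
  finally have "?\<rho> * bil k c d n x - bil k c d n x * ?\<rho> = (if b = c then A else 0) - (if a = d then B else 0)"
    unfolding if_mult_diff A_def B_def .
  moreover have "(if P then A else 0) - (if Q then B else 0) =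
      (if P then A - (if Q \<and> R \<and> U then 1 else 0) else 0)
      - (if Q then B - (if P \<and> R \<and> V then 1 else 0) else 0)
      + (if P \<and> Q \<and> R then (if U then 1 else 0) - (if V then 1 else 0) else 0)" for P Q R U V
    by auto
  ultimately show ?thesis unfolding nA nB sea_shift_def if_P[OF True] eq_commute[of c b] by (simp only:)
qed (simp add: bil_def sea_shift_def)

lemma loc_fin_if: "loc_fin A \<Longrightarrow> loc_fin (\<lambda>x. if P then A x else 0)"
  by (cases P) (simp_all add: loc_fin_def)

lemma lsum_if: "lsum (\<lambda>x. if P then A x else 0) = (if P then lsum A else 0)"
  by (cases P) (simp_all add: lsum_finite[of "{}"])

text \<open>These are the relations of affine gl(2) at level \<open>k\<close>. The three families in
  \<open>rho_bil\<close> are locally finite separately, so they may be summed one by one; the second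
  becomes \<open>rho\<close> after a translation of the summation index.\<close>

lemma rho_bracket:
  "rho k a b m * rho k c d n - rho k c d n * rho k a b m =
     (if b = c then rho k a d (m + n) else 0) - (if a = d then rho k c b (m + n) else 0)
     + (if b = c \<and> a = d \<and> m + n = 0 then of_int m * of_nat k else 0)"
proof -
  let ?s = "\<lambda>x::nat \<times> int. (fst x, snd x + m)"
  have shift: "lsum (\<lambda>x. bil k c b (m + n) (?s x)) = rho k c b (m + n)"
     "loc_fin (\<lambda>x. bil k c b (m + n) (?s x))"
    unfolding rho_def
    by (rule lsum_reindex(1)[OF bij_shift], rule lsum_reindex(2)[OF bij_shift loc_fin_bil])
  have "rho k a b m * rho k c d n - rho k c d n * rho k a b m =
      lsum (\<lambda>x. rho k a b m * bil k c d n x - bil k c d n x * rho k a b m)"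
    unfolding rho_def[of k c d n]
    by (simp only: lsum_diff[OF loc_fin_mult_left loc_fin_mult_right] loc_fin_bil lsum_mult_left lsum_mult_right)
  also have "\<dots> = (if b = c then rho k a d (m + n) else 0) - (if a = d then rho k c b (m + n) else 0)
     + (if b = c \<and> a = d \<and> m + n = 0 then lsum (sea_shift k m) else 0)"
    unfolding rho_bil
      lsum_add[OF loc_fin_diff[OF loc_fin_if[OF loc_fin_bil] loc_fin_if[OF shift(2)]] loc_fin_if[OF loc_fin_sea_shift]]
      lsum_diff[OF loc_fin_if[OF loc_fin_bil] loc_fin_if[OF shift(2)]] lsum_if shift(1) rho_def[of k a d "m + n"] ..
  finally show ?thesis by (simp only: lsum_sea_shift)
qed

lemma fsc_bil: "fsc z * bil k a b n x = bil k a b n x * fsc z"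
proof -
  have *: "psi p * psd q * fsc z = fsc z * (psi p * psd q)" for p q
    by (metis mult.assoc fsc_psi fsc_psd)
  have "bil k a b n x * fsc z - fsc z * bil k a b n x = 0"
    unfolding bil_commutator * by simp
  then show ?thesis by (metis eq_iff_diff_eq_0)
qed

lemma fsc_rho: "fsc z * rho k a b n = rho k a b n * fsc z"
  by (simp add: rho_def loc_fin_bil fsc_bil flip: lsum_mult_left lsum_mult_right)

lemma fsc_of_nat: "fsc (of_nat n) = of_nat n"
proof (induction n)
  case 0
  show ?case using fsc_simps(1)[of 0 0] by simp
qed (simp add: fsc_simps)

lemma fsc_diff: "fsc (a - b) = fsc a - fsc b"
  by (auto intro!: aend_eqI fock_eqI simp: algebra_simps)

lemma fsc_of_int: "fsc (of_int n) = of_int n"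
  by (cases n rule: int_diff_cases) (simp add: fsc_diff fsc_of_nat)

abbreviation "fE k \<equiv> rho k True False"
abbreviation "fF k \<equiv> rho k False True"
abbreviation "fH k \<equiv> (\<lambda>n. rho k True True n - rho k False False n)"

lemma fock_rep: "sl2_rep fsc (fE k) (fF k) (fH k) k"
proof -
  have two: "fsc 2 * A = A + A" "A * fsc 2 = A + A" for A
    using fsc_of_nat[of 2] by (simp_all add: mult_2 mult_2_right)
  have br: "rho k a b m * rho k c d n = rho k c d n * rho k a b m + (if b = c then rho k a d (m + n) else 0)
     - (if a = d then rho k c b (m + n) else 0)
     + (if b = c \<and> a = d \<and> m + n = 0 then of_int m * of_nat k else 0)" for a b c d m n
    using rho_bracket[of k a b m c d n] by (simp add: algebra_simps)
  show ?thesis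
  proof (standard, goal_cases)
    case (7 m n)
    show ?case using br[of True False m True False n] by simp
  next
    case (8 m n)
    show ?case using br[of False True m False True n] by simp
  next
    case (9 m n)
    show ?case using br[of True True m True False n] br[of False False m True False n]
      by (simp add: two algebra_simps)
  next
    case (10 m n)
    show ?case using br[of True True m False True n] br[of False False m False True n]
      by (simp add: two algebra_simps)
  next
    case (11 m n)
    show ?case using br[of True False m False True n]
      by (simp add: fsc_simps fsc_of_int fsc_of_nat algebra_simps)
  next
    case (12 m n)
    show ?case using br[of True True m True True n] br[of False False m False False n]
        br[of True True m False False n] br[of False False m True True n]
      by (simp add: fsc_simps fsc_of_int fsc_of_nat two algebra_simps)
  qed (simp_all add: fsc_simps fsc_rho algebra_simps)
qed

subsection \<open>The contravariant Hermitian form\<close>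

definition fip :: "fock \<Rightarrow> fock \<Rightarrow> complex" where
  "fip f g = (\<Sum>S | amp f S \<noteq> 0. cnj (amp f S) * amp g S)"

lemma fip_superset: "finite X \<Longrightarrow> {S. amp f S \<noteq> 0} \<subseteq> X \<Longrightarrow> fip f g = (\<Sum>S\<in>X. cnj (amp f S) * amp g S)"
  unfolding fip_def by (rule sum.mono_neutral_left) auto

lemma fip_add_right: "fip f (g + h) = fip f g + fip f h"
  by (simp add: fip_def distrib_left sum.distrib)

lemma fip_sc_right: "fip f (app (fsc z) g) = z * fip f g"
  by (simp add: fip_def sum_distrib_left mult_ac)

lemma fip_minus_right: "fip f (- g) = - fip f g"
  by (simp add: fip_def sum_negf)

lemma fip_cnj: "fip f g = cnj (fip g f)"
proof -
  let ?X = "{S. amp f S \<noteq> 0} \<union> {S. amp g S \<noteq> 0}"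
  have "finite ?X" by (simp add: finite_amp)
  then show ?thesis by (simp add: fip_superset[of ?X] mult.commute)
qed

lemma fip_add_left: "fip (f + g) h = fip f h + fip g h"
  by (metis fip_cnj fip_add_right complex_cnj_add)

lemma fip_sc_left: "fip (app (fsc z) f) g = cnj z * fip f g"
  by (metis fip_cnj fip_sc_right complex_cnj_mult)

lemma fip_minus_left: "fip (- f) g = - fip f g"
  by (metis fip_cnj fip_minus_right complex_cnj_minus)

lemma fip_zero [simp]: "fip f 0 = 0" "fip 0 g = 0"
  by (simp_all add: fip_def)

lemma fip_pos: "fip f f = 0 \<Longrightarrow> f = 0"
proof -
  assume "fip f f = 0"
  have "fip f f = of_real (\<Sum>S | amp f S \<noteq> 0. (cmod (amp f S))\<^sup>2)"
    by (simp add: fip_def mult.commute[of "cnj _"] flip: complex_norm_square)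
  then have "(\<Sum>S | amp f S \<noteq> 0. (cmod (amp f S))\<^sup>2) = 0"
    using \<open>fip f f = 0\<close> by (metis of_real_eq_0_iff)
  then have "amp f S = 0" for S
    using finite_amp[of f] by (subst (asm) sum_nonneg_eq_0_iff) auto
  then show "f = 0" by (intro fock_eqI) simp
qed

lemma fip_psi: "fip (app (psi p) f) g = fip f (app (psd p) g)"
proof -
  let ?A = "{S. amp f S \<noteq> 0 \<and> p \<notin> S}"
  have fin: "finite ?A" using finite_amp[of f] by (rule finite_subset[rotated]) auto
  have "{S. amp (app (psi p) f) S \<noteq> 0} \<subseteq> insert p ` ?A"
  proof
    fix S assume "S \<in> {S. amp (app (psi p) f) S \<noteq> 0}"
    then have "S = insert p (S - {p})" "S - {p} \<in> ?A" by (auto simp: amp_psi split: if_splits)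
    then show "S \<in> insert p ` ?A" by blast
  qed
  then have "fip (app (psi p) f) g = (\<Sum>S\<in>insert p ` ?A. cnj (amp (app (psi p) f) S) * amp g S)"
    using fin by (intro fip_superset) auto
  also have "\<dots> = (\<Sum>S\<in>?A. cnj (amp (app (psi p) f) (insert p S)) * amp g (insert p S))"
    by (rule sum.reindex_cong[of "insert p"]) (auto simp: inj_on_def)
  also have "\<dots> = (\<Sum>S\<in>?A. cnj (amp f S) * amp (app (psd p) g) S)"
    by (rule sum.cong) (auto simp: amp_psi amp_psd)
  also have "\<dots> = fip f (app (psd p) g)"
    unfolding fip_def by (rule sum.mono_neutral_left) (auto simp: finite_amp amp_psd)
  finally show ?thesis .
qed

lemma fip_psd: "fip (app (psd p) f) g = fip f (app (psi p) g)"
  by (metis fip_cnj fip_psi)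

lemma fip_sum_left: "fip (sum f X) g = (\<Sum>x\<in>X. fip (f x) g)"
  by (induction X rule: infinite_finite_induct) (auto simp: fip_add_left)

lemma fip_sum_right: "fip g (sum f X) = (\<Sum>x\<in>X. fip g (f x))"
  by (induction X rule: infinite_finite_induct) (auto simp: fip_add_right)

lemma fip_bil: "fip (app (bil k a b n x) f) g = fip f (app (bil k b a (- n) (fst x, snd x + (- n))) g)"
proof -
  have "fip (f - h) g = fip f g - fip h g" "fip g (f - h) = fip g f - fip g h" for f g h
    using fip_add_left[of f "- h" g] fip_add_right[of g f "- h"] by (simp_all add: fip_minus_left fip_minus_right)
  then show ?thesis by (cases x) (auto simp: bil_def fip_psi fip_psd)
qed

lemma fip_rho: "fip (app (rho k a b n) f) g = fip f (app (rho k b a (- n)) g)"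
proof -
  let ?B = "\<lambda>x. bil k b a (- n) (fst x, snd x + (- n))"
  have B: "rho k b a (- n) = lsum ?B" "loc_fin ?B"
    using lsum_reindex[OF bij_shift[of "- n"], of "bil k b a (- n)"] loc_fin_bil by (auto simp: rho_def)
  let ?X = "{x. app (bil k a b n x) f \<noteq> 0} \<union> {x. app (?B x) g \<noteq> 0}"
  have X: "finite ?X" using loc_fin_bil[of k a b n] B(2) by (simp add: loc_fin_def)
  have "fip (app (rho k a b n) f) g = fip (\<Sum>x\<in>?X. app (bil k a b n x) f) g"
    using X by (subst app_lsum_superset[of "bil k a b n" ?X, folded rho_def]) (auto simp: loc_fin_bil)
  also have "\<dots> = fip f (\<Sum>x\<in>?X. app (?B x) g)"
    by (simp add: fip_sum_left fip_sum_right fip_bil)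
  also have "(\<Sum>x\<in>?X. app (?B x) g) = app (rho k b a (- n)) g"
    unfolding B(1) by (rule app_lsum_superset[OF B(2) X, symmetric]) auto
  finally show ?thesis .
qed

lemma fock_unitary: "unitary_rep fsc (fE k) (fF k) (fH k) k fip"
proof -
  interpret sl2_rep fsc "fE k" "fF k" "fH k" k by (rule fock_rep)
  have "fip (f - h) g = fip f g - fip h g" "fip g (f - h) = fip g f - fip g h" for f g h
    using fip_add_left[of f "- h" g] fip_add_right[of g f "- h"] by (simp_all add: fip_minus_left fip_minus_right)
  then show ?thesis
    by unfold_locales
      (simp_all add: fip_add_left fip_add_right fip_sc_left fip_sc_right fip_rho fip_pos)
qed

subsection \<open>Vacua\<close>

text \<open>A product of level one vacua: the copies below \<open>i\<close> carry the vacuum of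
  \<Lambda>_0, the other \<open>k - i\<close> that of \<Lambda>_1, in which the topmost mode of the
  component \<open>False\<close> is empty. Each such hole contributes 1 to the eigenvalue of
  \<open>H 0\<close>.\<close>

definition vac_set :: "nat \<Rightarrow> nat \<Rightarrow> fmode set" where
  "vac_set k i = dirac_sea - (\<lambda>j. (False, j, -1)) ` {i..<k}"

definition fvac :: "nat \<Rightarrow> nat \<Rightarrow> fock" where
  "fvac k i = ket (vac_set k i)"

lemma vac_set_iff: "(a, j, l) \<in> vac_set k i \<longleftrightarrow> l < 0 \<and> \<not> (\<not> a \<and> l = -1 \<and> i \<le> j \<and> j < k)"
  by (auto simp: vac_set_def dirac_sea_def)

lemma fvac_nonzero: "fvac k i \<noteq> 0"
proof -
  have "vac_set k i - dirac_sea = {}" "dirac_sea - vac_set k i \<subseteq> (\<lambda>j. (False, j, -1)) ` {i..<k}"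
    by (auto simp: vac_set_def)
  then have "admissible (vac_set k i)"
    unfolding admissible_def by (metis finite.emptyI finite_imageI finite_atLeastLessThan finite_subset)
  then have "amp (fvac k i) (vac_set k i) = 1" by (simp add: fvac_def amp_ket)
  then show ?thesis by (metis amp_simps(1) zero_neq_one)
qed

lemma amp_sum: "amp (sum f X) S = (\<Sum>x\<in>X. amp (f x) S)"
  by (induction X rule: infinite_finite_induct) auto

text \<open>Exclusion principle: every summand has an empty source or an occupied target.\<close>

lemma rho_ket_zero:
  assumes "\<And>j l. j < k \<Longrightarrow> (b, j, l) \<in> S \<Longrightarrow> (a, j, l - n) \<in> S" "\<not> (a = b \<and> n = 0)"
  shows "app (rho k a b n) (ket S) = 0"
proof -
  have "app (bil k a b n x) (ket S) = 0" for x
  proof (cases "fst x < k")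
    case True
    obtain j l where x: "x = (j, l)" by (cases x)
    have "app (psi (a, j, l - n) * psd (b, j, l)) (ket S) = 0"
      using assms True x by (intro psi_psd_ket_zero) auto
    moreover have "bil k a b n x = psi (a, j, l - n) * psd (b, j, l)"
      using assms(2) True x by (auto simp: bil_def)
    ultimately show ?thesis by simp
  qed (simp add: bil_def)
  then show ?thesis by (simp add: rho_def app_lsum loc_fin_bil)
qed

lemma bil_diag_ket:
  "app (bil k a a 0 (j, l)) (ket S) =
    (if j < k then (if (a, j, l) \<in> S then ket S else 0) - (if l < 0 then ket S else 0) else 0)"
  using psi_psd_ket[of "(a, j, l)" S] by (simp add: bil_def)

lemma fH0_fvac:
  assumes "i \<le> k" shows "app (fH k 0) (fvac k i) = app (fsc (of_nat k - of_nat i)) (fvac k i)"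
proof -
  have 1: "app (rho k True True 0) (fvac k i) = 0"
  proof -
    have "app (bil k True True 0 x) (fvac k i) = 0" for x
      by (cases x) (simp add: fvac_def bil_diag_ket vac_set_iff)
    then show ?thesis by (simp add: rho_def app_lsum loc_fin_bil)
  qed
  let ?X = "{i..<k} \<times> {- 1 :: int}"
  have b: "app (bil k False False 0 (j, l)) (fvac k i) = (if (j, l) \<in> ?X then - fvac k i else 0)" for j l
    by (auto simp: fvac_def bil_diag_ket vac_set_iff)
  have "app (rho k False False 0) (fvac k i) = (\<Sum>x\<in>?X. app (bil k False False 0 x) (fvac k i))"
    unfolding rho_def
    by (rule app_lsum_superset[OF loc_fin_bil]) (auto simp: b split: if_splits)
  also have "\<dots> = (\<Sum>x\<in>?X. - fvac k i)"
    by (rule sum.cong) (auto simp: b)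
  also have "\<dots> = - app (fsc (of_nat k - of_nat i)) (fvac k i)"
    using assms by (intro fock_eqI) (simp add: amp_sum card_cartesian_product of_nat_diff)
  finally show ?thesis using 1 by simp
qed

lemma fock_hw:
  assumes "i \<le> k" shows "hw_rep fsc (fE k) (fF k) (fH k) k (fvac k i) (of_nat k - of_nat i)"
proof -
  interpret sl2_rep fsc "fE k" "fF k" "fH k" k by (rule fock_rep)
  have z: "app (rho k a b n) (fvac k i) = 0"
    if "n \<ge> 1 \<or> n = 0 \<and> a \<and> \<not> b" for a b n
    unfolding fvac_def using that by (intro rho_ket_zero) (auto simp: vac_set_iff)
  show ?thesis
  proof
    fix g assume "raising g"
    then show "app (gop (fE k) (fF k) (fH k) g) (fvac k i) = 0"
      using z[of "snd g"] by (cases g; cases "fst g") auto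
  next
    show "app (fH k 0) (fvac k i) = app (fsc (of_nat k - of_nat i)) (fvac k i)"
      by (rule fH0_fvac[OF assms])
  qed
qed

section \<open>The annihilators of highest weight vectors\<close>

definition shift_vars :: "mpoly \<Rightarrow> mpoly" where
  "shift_vars = peval cst (\<lambda>m. var (Suc m))"

lemma poly_eval_cst: "poly_eval cst X"
  by standard (simp_all add: mult.commute)

lemma (in poly_eval) peval_shift_vars:
  "peval sc X (shift_vars p) = peval sc (\<lambda>m. X (Suc m)) p"
proof -
  interpret S: poly_eval sc "\<lambda>m. X (Suc m)"
    by standard (simp_all add: sc_add sc_mult sc_one sc_comm X_comm)
  interpret C: poly_eval cst "\<lambda>m. var (Suc m)" by (rule poly_eval_cst)
  have "peval sc X (mmon (\<lambda>m. var (Suc m)) \<mu>) = mmon (\<lambda>m. X (Suc m)) \<mu>" for \<mu>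
    by (induction \<mu>) (simp_all add: C.mmon_add_mset S.mmon_add_mset peval_mult)
  then show ?thesis unfolding shift_vars_def
    by (induction p rule: poly_mapping_single_induct)
      (simp_all add: C.peval_add S.peval_add peval_add C.peval_single S.peval_single peval_mult)
qed

definition ann :: "nat \<Rightarrow> nat \<Rightarrow> mpoly set" where
  "ann k i = {p. app (peval fsc (\<lambda>m. fE k (- int m - 1)) p) (fvac k i) = 0}"

text \<open>The Fock vacuum and \<open>v\<close> are both faithful highest weight vectors of the
  same weight, so \<open>annihilator_transfer\<close> applies in both directions. This makes the
  Fock space a model for every such module.\<close>

lemma ann_iff:
  assumes "faithful_hw sc E F H k v (of_nat k - of_nat i) \<phi>" "i \<le> k"
  shows "app (peval sc (\<lambda>m. E (- int m - 1)) p) v = 0 \<longleftrightarrow> p \<in> ann k i"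
proof -
  let ?\<phi> = "\<lambda>a. fip (fvac k i) a / fip (fvac k i) (fvac k i)"
  interpret A: faithful_hw sc E F H k v "of_nat k - of_nat i" \<phi> by fact
  interpret U: unitary_rep fsc "fE k" "fF k" "fH k" k fip by (rule fock_unitary)
  interpret B: faithful_hw fsc "fE k" "fF k" "fH k" k "fvac k i" "of_nat k - of_nat i"
      ?\<phi>
    by (rule U.faithful_hw[OF fock_hw[OF assms(2)] fvac_nonzero])
  interpret AB: two_faithful_hw sc E F H v \<phi> fsc "fE k" "fF k" "fH k" "fvac k i"
      ?\<phi> k "of_nat k - of_nat i" ..
  interpret BA: two_faithful_hw fsc "fE k" "fF k" "fH k" "fvac k i"
      ?\<phi> sc E F H v \<phi> k "of_nat k - of_nat i" ..
  show ?thesis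
    using AB.annihilator_transfer BA.annihilator_transfer by (auto simp: ann_def)
qed

locale fock_level =
  fixes k :: nat
begin

sublocale unitary_rep fsc "fE k" "fF k" "fH k" k fip
  by (rule fock_unitary)

lemma ann_add: "p \<in> ann k i \<Longrightarrow> q \<in> ann k i \<Longrightarrow> p + q \<in> ann k i"
  by (simp add: ann_def pe.peval_add)

lemma ann_diff: "p \<in> ann k i \<Longrightarrow> q \<in> ann k i \<Longrightarrow> p - q \<in> ann k i"
  by (simp add: ann_def pe.peval_diff)

lemma ann_mult: "q \<in> ann k i \<Longrightarrow> p * q \<in> ann k i"
  by (simp add: ann_def pe.peval_mult)

lemma ann_zero: "0 \<in> ann k i"
  by (simp add: ann_def)

text \<open>The removed fermion commutes with \<open>x\<^sub>\<alpha>(n)\<close>; it plays the role of an intertwining operator.\<close>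

lemma ann_antimono:
  assumes "1 \<le> i" "i \<le> k" "p \<in> ann k i" shows "p \<in> ann k (i - 1)"
proof -
  \<comment> \<open>The single mode in which the vacua for \<open>i\<close> and \<open>i - 1\<close>
    differ.\<close>
  define q where "q = (False, i - 1, -1 :: int)"
  define s where "s = fsc (sgn_at q (vac_set k i))"
  have q: "q \<in> vac_set k i" using assms by (auto simp: q_def vac_set_iff)
  have vac_eq: "vac_set k (i - 1) = vac_set k i - {q}"
    using assms(1,2) by (auto simp: q_def vac_set_def dirac_sea_def image_iff)
  have vac: "app (psd q) (fvac k i) = app s (fvac k (i - 1))"
    unfolding fvac_def psd_ket[OF q] vac_eq s_def ..
  have ss: "s * s = 1" by (simp only: s_def sc_mult[symmetric] sgn_at_square sc_one)
  have evs: "ev p * s = s * ev p" unfolding s_def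
    by (rule pe.peval_comm_right) (simp_all only: sc_E sc_mult[symmetric] mult.commute)
  \<comment> \<open>The bracket with \<open>rho k True False\<close> is non-zero only on
    annihilators of the component \<open>True\<close>, while \<open>q\<close> lies in the component
    \<open>False\<close>.\<close>
  have comm: "ev p * psd q = psd q * ev p"
    unfolding q_def by (rule pe.peval_comm_right) (simp_all add: fsc_psd rho_psd)
  have "app (ev p) (fvac k (i - 1)) = app (s * s * ev p) (fvac k (i - 1))"
    by (simp add: ss)
  also have "\<dots> = app s (app (ev p * s) (fvac k (i - 1)))"
    by (simp only: evs mult.assoc app_simps)
  also have "\<dots> = app s (app (ev p * psd q) (fvac k i))"
    by (simp only: vac app_simps)
  also have "\<dots> = 0"
    using assms(3) by (simp add: comm ann_def)
  finally show ?thesis by (simp add: ann_def)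
qed

text \<open>The vector \<open>E (-1) ^ i\<close> applied to the vacuum is a highest weight vector of
  weight \<open>i = k - (k - i)\<close> for the twisted action, and shifting the variables amounts
  to evaluating at the twisted operators. Hence its annihilator is the one for
  \<open>k - i\<close>.\<close>

lemma shift_in_ann_iff:
  assumes "i \<le> k" shows "var 0 ^ i * shift_vars p \<in> ann k i \<longleftrightarrow> p \<in> ann k (k - i)"
proof -
  interpret V: hw_rep fsc "fE k" "fF k" "fH k" k "fvac k i" "of_nat k - of_nat i"
    by (rule fock_hw[OF assms])
  let ?w = "app (fE k (-1) ^ i) (fvac k i)"
  interpret T: unitary_rep fsc twE twF twH k fip by (rule twisted_unitary)
  have hw: "hw_rep fsc twE twF twH k ?w (of_nat i)"
    by (rule V.twisted_hw_rep[OF refl E_pow_kill[OF fock_hw[OF assms]]])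
  have nz: "?w \<noteq> 0"
    by (rule V.E_pow_nonzero[OF fvac_nonzero refl order_refl])
  have "(of_nat i :: complex) = of_nat k - of_nat (k - i)" using assms by (simp add: of_nat_diff)
  then have fw: "faithful_hw fsc twE twF twH k ?w (of_nat k - of_nat (k - i)) (\<lambda>a. fip ?w a / fip ?w ?w)"
    using T.faithful_hw[OF hw nz] by simp
  have "ev (var 0 ^ i * shift_vars p) = ev (shift_vars p * var 0 ^ i)" by (simp add: mult.commute)
  also have "\<dots> = peval fsc (\<lambda>m. fE k (- int (Suc m) - 1)) p * fE k (-1) ^ i"
    by (simp add: pe.peval_mult pe.peval_power pe.peval_shift_vars)
  also have "(\<lambda>m. fE k (- int (Suc m) - 1)) = (\<lambda>m. twE (- int m - 1))"
    by (rule ext) (rule arg_cong[of _ _ "fE k"], simp)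
  finally have "app (ev (var 0 ^ i * shift_vars p)) (fvac k i) = app (peval fsc (\<lambda>m. twE (- int m - 1)) p) ?w"
    by simp
  then show ?thesis using ann_iff[OF fw, of p] by (simp add: ann_def)
qed

lemma var_pow_in_ann:
  assumes "i \<le> k" shows "var 0 ^ Suc i \<in> ann k i"
proof -
  have "ev (var 0 ^ Suc i) = fE k (-1) ^ Suc i"
    unfolding pe.peval_power by simp
  then show ?thesis
    unfolding ann_def using E_pow_kill[OF fock_hw[OF assms]] by (simp only: mem_Collect_eq)
qed

end

subsection \<open>The relation \<open>x\<^sub>\<alpha>(z)\<^sup>k\<^sup>+\<^sup>1 = 0\<close>\<close>

text \<open>Pigeonhole: a monomial of degree \<open>k + 1\<close> in \<open>k\<close> commuting
  elements repeats a factor. The induction splits off one summand at a time.\<close>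

lemma power_sum_commuting_nilpotents:
  fixes x :: "nat \<Rightarrow> 'r::ring_1"
  assumes "\<And>j. x j * x j = 0" "\<And>i j. x i * x j = x j * x i"
  shows "(\<Sum>j<k. x j) ^ Suc k = 0"
proof (induction k)
  case (Suc k)
  define A B where "A = (\<Sum>j<k. x j)" and "B = x k"
  have AB: "B * A = A * B"
    unfolding A_def B_def sum_distrib_left sum_distrib_right by (rule sum.cong[OF refl]) (rule assms(2))
  have ABn: "B * A ^ m = A ^ m * B" for m
  proof (induction m)
    case (Suc m)
    have "B * A ^ Suc m = B * A * A ^ m" by (simp only: power_Suc mult.assoc)
    also have "\<dots> = A * (B * A ^ m)" by (simp only: AB mult.assoc)
    also have "\<dots> = A ^ Suc m * B" by (simp only: Suc.IH power_Suc mult.assoc)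
    finally show ?case .
  qed simp
  \<comment> \<open>The binomial expansion stops after the linear term in \<open>B\<close>, as
    \<open>B\<close> has square zero. The witness is \<open>(m + 1)\<close> times \<open>B\<close>;
    only its annihilation by \<open>B\<close> is recorded.\<close>
  have "\<exists>D. (A + B) ^ Suc m = A ^ Suc m + A ^ m * D \<and> B * D = 0" for m
  proof (induction m)
    case 0
    have "B * B = 0" by (simp add: B_def assms(1))
    then show ?case by (intro exI[of _ B]) simp
  next
    case (Suc m)
    then obtain D where D: "(A + B) ^ Suc m = A ^ Suc m + A ^ m * D" "B * D = 0" by blast
    have "(A + B) ^ Suc (Suc m) = (A + B) * (A ^ Suc m + A ^ m * D)"
      by (simp only: power_Suc[of _ "Suc m"] D(1))
    also have "\<dots> = A ^ Suc (Suc m) + A ^ Suc m * D + (B * A ^ Suc m + B * A ^ m * D)"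
      by (simp only: distrib_left distrib_right power_Suc mult.assoc add_ac)
    also have "B * A ^ m * D = 0"
      by (simp only: ABn mult.assoc D(2) mult_zero_right)
    also have "A ^ Suc (Suc m) + A ^ Suc m * D + (B * A ^ Suc m + 0) = A ^ Suc (Suc m) + A ^ Suc m * (D + B)"
      by (simp only: ABn distrib_left add_0_right add.assoc)
    finally have "(A + B) ^ Suc (Suc m) = A ^ Suc (Suc m) + A ^ Suc m * (D + B)" .
    moreover have "B * B = 0" by (simp add: B_def assms(1))
    then have "B * (D + B) = 0" by (simp add: distrib_left D(2))
    ultimately show ?case by blast
  qed
  from this[of "Suc k"] obtain D where "(A + B) ^ Suc (Suc k) = A ^ Suc (Suc k) + A ^ Suc k * D" by blast
  moreover have "A ^ Suc k = 0" unfolding A_def by (rule Suc.IH)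
  ultimately have "(A + B) ^ Suc (Suc k) = 0"
    by (simp only: power_Suc[of A "Suc k"] mult_zero_left mult_zero_right add_0_right)
  then show ?case by (simp only: sum.lessThan_Suc A_def B_def)
qed simp

lemma anticommuting_pairs:
  fixes e f e' f' :: "'r::ring"
  assumes fe: "f * e' = - (e' * f)" and ee: "e * e' = - (e' * e)"
    and ff: "f * f' = - (f' * f)" and ef: "e * f' = - (f' * e)"
  shows "e * f * (e' * f') = e' * f' * (e * f)"
proof -
  have "e * f * (e' * f') = e * (f * e') * f'" by (simp only: mult.assoc)
  also have "\<dots> = - (e * e' * (f * f'))" by (simp only: fe) (simp add: mult.assoc)
  also have "\<dots> = - (e' * (e * f') * f)" by (simp only: ee ff) (simp add: mult.assoc)
  also have "\<dots> = e' * f' * (e * f)" by (simp only: ef) (simp add: mult.assoc)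
  finally show ?thesis .
qed

lemma anticommute_twice:
  fixes P A D :: "'r::ring"
  assumes PA: "P * A = - (A * P)" and PD: "P * D = - (D * P)"
  shows "P * (A * D) = A * D * P"
proof -
  have "P * (A * D) = P * A * D" by (simp only: mult.assoc)
  also have "\<dots> = - (A * (P * D))" by (simp only: PA) (simp add: mult.assoc)
  also have "\<dots> = A * D * P" by (simp only: PD) (simp add: mult.assoc)
  finally show ?thesis .
qed

lemma fps_anticommute:
  fixes A B :: "'r::ring_1 fps"
  assumes "\<And>m n. fps_nth A m * fps_nth B n = - (fps_nth B n * fps_nth A m)"
  shows "A * B = - (B * A)"
proof (rule fps_ext)
  fix n
  have "fps_nth (A * B) n = (\<Sum>i=0..n. fps_nth A i * fps_nth B (n - i))"
    by (rule fps_mult_nth)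
  also have "\<dots> = - (\<Sum>i=0..n. fps_nth B (n - i) * fps_nth A i)"
    by (simp add: assms sum_negf)
  also have "(\<Sum>i=0..n. fps_nth B (n - i) * fps_nth A i) = (\<Sum>i=0..n. fps_nth B i * fps_nth A (n - i))"
    by (rule sum.reindex_bij_witness[of _ "\<lambda>i. n - i" "\<lambda>i. n - i"]) auto
  finally show "fps_nth (A * B) n = fps_nth (- (B * A)) n"
    by (simp add: fps_mult_nth)
qed

text \<open>The modes that create out of the sea: \<open>efps\<close> puts particles at exponents
  \<open>a \<ge> 0\<close>, \<open>ffps\<close> makes holes at exponents \<open>- 1 - b\<close>. The
  current mode x_\<alpha>(-m-1) moves a fermion by \<open>m + 1\<close>, that is, it has
  \<open>a + b = m\<close>, so the products of the two series collect the creation part of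
  x_\<alpha>(z).\<close>

definition efps :: "nat \<Rightarrow> fock aend fps" where
  "efps j = Abs_fps (\<lambda>a. psi (True, j, int a))"

definition ffps :: "nat \<Rightarrow> fock aend fps" where
  "ffps j = Abs_fps (\<lambda>b. psd (False, j, - 1 - int b))"

lemma aend_fps_eq_minus_self: "(A :: fock aend fps) = - A \<Longrightarrow> A = 0"
proof (intro fps_ext aend_eqI fock_eqI)
  fix n f S assume *: "A = - A"
  have "amp (app (fps_nth A n) f) S = amp (app (fps_nth (- A) n) f) S"
    by (simp only: *[symmetric])
  then show "amp (app (fps_nth A n) f) S = amp (app (fps_nth 0 n) f) S" by simp
qed

lemma efps_ffps_anticommute:
  "efps i * efps j = - (efps j * efps i)" "ffps i * ffps j = - (ffps j * ffps i)"
  "efps i * ffps j = - (ffps j * efps i)"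
proof -
  show "efps i * efps j = - (efps j * efps i)"
    by (rule fps_anticommute) (simp add: efps_def, rule psi_psi)
  show "ffps i * ffps j = - (ffps j * ffps i)"
    by (rule fps_anticommute) (simp add: ffps_def, rule psd_psd)
  show "efps i * ffps j = - (ffps j * efps i)"
    by (rule fps_anticommute) (simp add: efps_def ffps_def psi_psd)
qed

text \<open>All the series anticommute, so each \<open>efps j\<close> has square zero, hence so has
  each product; and products of two anticommuting factors commute with each other. This is the
  nilpotency lemma with one summand per copy.\<close>

lemma current_fps_nilpotent: "(\<Sum>j<k. efps j * ffps j) ^ Suc k = 0"
proof (rule power_sum_commuting_nilpotents)
  fix i j
  note ac = efps_ffps_anticommute
  have fe: "ffps i * efps j = - (efps j * ffps i)" for i j using ac(3)[of j i] by simp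
  have 0: "efps j * efps j = 0" by (rule aend_fps_eq_minus_self) (rule ac(1))
  have "efps j * ffps j * (efps j * ffps j) = efps j * (ffps j * efps j) * ffps j"
    by (simp only: mult.assoc)
  also have "\<dots> = - (efps j * efps j * (ffps j * ffps j))"
    by (simp only: fe) (simp add: mult.assoc)
  finally show "efps j * ffps j * (efps j * ffps j) = 0" by (simp only: 0) simp
  show "efps i * ffps i * (efps j * ffps j) = efps j * ffps j * (efps i * ffps i)"
    by (rule anticommuting_pairs[OF fe ac])
qed

definition gen_fps :: "mpoly fps" where
  "gen_fps = Abs_fps var"

lemma (in poly_eval) peval_sum: "peval sc X (sum f A) = (\<Sum>a\<in>A. peval sc X (f a))"
  by (induction A rule: infinite_finite_induct) (simp_all add: peval_add)

text \<open>On the vectors annihilated by the operators below only the part of \<open>x\<^sub>\<alpha>(-m-1)\<close> that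
  creates fermions survives.\<close>

definition creation_domain :: "fock set" where
  "creation_domain = {y. \<forall>j l. (l < 0 \<longrightarrow> app (psi (True, j, l)) y = 0) \<and> (l \<ge> 0 \<longrightarrow> app (psd (False, j, l)) y = 0)}"

context fock_level
begin

abbreviation "cur \<equiv> (\<Sum>j<k. efps j * ffps j)"

lemma fvac_creation_domain: "fvac k i \<in> creation_domain"
  by (auto simp: creation_domain_def fvac_def vac_set_iff intro: psi_ket_zero psd_ket_zero)

lemma cur_nth: "fps_nth cur m = (\<Sum>j<k. \<Sum>a=0..m. psi (True, j, int a) * psd (False, j, - 1 - int (m - a)))"
  by (simp add: fps_sum_nth fps_mult_nth efps_def ffps_def)

text \<open>The two fermions of a summand belong to different components and anticommute, so a
  summand vanishes as soon as either of them kills \<open>y\<close>. What survives starts in the sea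
  and ends outside it. These pairs commute with the operators defining the domain, which is
  therefore preserved.\<close>

lemma current_on_creation_domain:
  assumes "y \<in> creation_domain"
  shows "app (fE k (- int m - 1)) y = app (fps_nth cur m) y" "app (fps_nth cur m) y \<in> creation_domain"
proof -
  have y: "app (psi (True, j, l)) y = 0" if "l < 0" for j l using assms that by (auto simp: creation_domain_def)
  have y': "app (psd (False, j, l)) y = 0" if "l \<ge> 0" for j l using assms that by (auto simp: creation_domain_def)
  have anti: "psi (True, p) * psd (False, q) = - (psd (False, q) * psi (True, p))" for p q
    by (simp add: psi_psd)
  let ?B = "\<lambda>j l. psi (True, j, l + int m + 1) * psd (False, j, l)"
  have bil: "bil k True False (- int m - 1) (j, l) = (if j < k then ?B j l else 0)" for j l
    by (simp add: bil_def algebra_simps)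
  have "app (fE k (- int m - 1)) y = (\<Sum>x\<in>{..<k} \<times> {- int m - 1..<0}. app (bil k True False (- int m - 1) x) y)"
    unfolding rho_def
  proof (rule app_lsum_superset[OF loc_fin_bil])
    show "{x. app (bil k True False (- int m - 1) x) y \<noteq> 0} \<subseteq> {..<k} \<times> {- int m - 1..<0}"
    proof (rule subsetI, rule ccontr)
      fix x assume x: "x \<in> {x. app (bil k True False (- int m - 1) x) y \<noteq> 0}"
        and nx: "x \<notin> {..<k} \<times> {- int m - 1..<0}"
      obtain j l where jl: "x = (j, l)" by (cases x)
      have j: "j < k" using x by (auto simp: jl bil split: if_splits)
      consider "l \<ge> 0" | "l + int m + 1 < 0" using nx j by (auto simp: jl)
      then have "app (?B j l) y = 0"
      proof cases
        case 2
        show ?thesis unfolding anti using y[OF 2] by simp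
      qed (simp add: y')
      then show False using x j by (simp add: jl bil)
    qed
  qed simp
  also have "\<dots> = (\<Sum>j<k. \<Sum>l\<in>{- int m - 1..<0}. app (?B j l) y)"
    unfolding sum.cartesian_product by (rule sum.cong) (auto simp: bil)
  also have "\<dots> = (\<Sum>j<k. \<Sum>a=0..m. app (psi (True, j, int a) * psd (False, j, - 1 - int (m - a))) y)"
    by (intro sum.cong refl, rule sum.reindex_bij_witness[of _ "\<lambda>a. int a - int m - 1" "\<lambda>l. nat (l + int m + 1)"])
      (auto simp: of_nat_diff algebra_simps)
  also have "\<dots> = app (fps_nth cur m) y"
    by (simp only: cur_nth app_sum_left)
  finally show "app (fE k (- int m - 1)) y = app (fps_nth cur m) y" .
  have 1: "app (psi (True, p)) (app (psi (True, j, a) * psd (False, q)) y) = 0" if "snd p < 0" for p j a q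
  proof -
    have "psi (True, p) * (psi (True, j, a) * psd (False, q)) = psi (True, j, a) * psd (False, q) * psi (True, p)"
      by (rule anticommute_twice[OF psi_psi anti])
    then have "app (psi (True, p)) (app (psi (True, j, a) * psd (False, q)) y) =
        app (psi (True, j, a) * psd (False, q)) (app (psi (True, p)) y)"
      by (simp only: app_simps(6)[symmetric])
    then show ?thesis using y[of "snd p" "fst p"] that by simp
  qed
  have 2: "app (psd (False, p)) (app (psi (True, j, a) * psd (False, q)) y) = 0" if "snd p \<ge> 0" for p j a q
  proof -
    have anti': "psd (False, p) * psi (True, j, a) = - (psi (True, j, a) * psd (False, p))"
      by (simp add: anti)
    have "psd (False, p) * (psi (True, j, a) * psd (False, q)) = psi (True, j, a) * psd (False, q) * psd (False, p)"
      by (rule anticommute_twice[OF anti' psd_psd])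
    then have "app (psd (False, p)) (app (psi (True, j, a) * psd (False, q)) y) =
        app (psi (True, j, a) * psd (False, q)) (app (psd (False, p)) y)"
      by (simp only: app_simps(6)[symmetric])
    then show ?thesis using y'[of "snd p" "fst p"] that by simp
  qed
  show "app (fps_nth cur m) y \<in> creation_domain"
    using 1 2
    by (simp only: creation_domain_def mem_Collect_eq cur_nth app_sum_left app_sum)
      (auto intro!: sum.neutral simp del: app_simps)
qed

lemma current_power:
  "y \<in> creation_domain \<Longrightarrow>
    app (ev (fps_nth (gen_fps ^ N) n)) y = app (fps_nth (cur ^ N) n) y
    \<and> app (fps_nth (cur ^ N) n) y \<in> creation_domain"
proof (induction N arbitrary: n)
  case 0
  have "0 \<in> creation_domain" by (simp add: creation_domain_def)
  then show ?case using 0 by (cases n) simp_all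
next
  case (Suc N)
  have sum_cd: "(\<Sum>i\<in>A. f i) \<in> creation_domain" if "\<And>i. f i \<in> creation_domain" for A and f :: "nat \<Rightarrow> fock"
    using that by (auto simp: creation_domain_def app_sum)
  have "app (ev (fps_nth (gen_fps ^ Suc N) n)) y =
      (\<Sum>i=0..n. app (fE k (- int i - 1)) (app (ev (fps_nth (gen_fps ^ N) (n - i))) y))"
    by (simp add: fps_mult_nth pe.peval_sum pe.peval_mult app_sum_left gen_fps_def)
  also have "\<dots> = (\<Sum>i=0..n. app (fps_nth cur i) (app (fps_nth (cur ^ N) (n - i)) y))"
    using Suc.IH[OF Suc.prems] by (intro sum.cong refl) (simp add: current_on_creation_domain(1))
  also have "\<dots> = app (fps_nth (cur ^ Suc N) n) y"
    by (simp add: fps_mult_nth app_sum_left)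
  finally have "app (ev (fps_nth (gen_fps ^ Suc N) n)) y = app (fps_nth (cur ^ Suc N) n) y" .
  moreover have "app (fps_nth (cur ^ Suc N) n) y \<in> creation_domain"
    using Suc.IH[OF Suc.prems]
    by (simp add: fps_mult_nth app_sum_left sum_cd current_on_creation_domain(2))
  ultimately show ?case ..
qed

lemma gen_fps_power_in_ann: "fps_nth (gen_fps ^ Suc k) n \<in> ann k i"
  using current_power[OF fvac_creation_domain, of "Suc k" n i] current_fps_nilpotent[of k]
  by (simp add: ann_def del: power_Suc)

end

section \<open>Presentation of the annihilators\<close>

subsection \<open>Bihomogeneous polynomials\<close>

text \<open>Charge \<open>m\<close> and weight \<open>m + s\<close>: as \<open>var n\<close> stands
  for x_\<alpha>(-n-1), the second index is the excess of weight over charge.\<close>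

definition hom :: "nat \<Rightarrow> nat \<Rightarrow> mpoly set" where
  "hom m s = {p. \<forall>\<mu>\<in>Poly_Mapping.keys p. size \<mu> = m \<and> sum_mset \<mu> = s}"

lemma hom_zero [simp]: "0 \<in> hom m s"
  by (simp add: hom_def)

lemma hom_add: "p \<in> hom m s \<Longrightarrow> q \<in> hom m s \<Longrightarrow> p + q \<in> hom m s"
  using keys_add[of p q] by (auto simp: hom_def)

lemma hom_sum: "(\<And>a. a \<in> A \<Longrightarrow> f a \<in> hom m s) \<Longrightarrow> sum f A \<in> hom m s"
  by (induction A rule: infinite_finite_induct) (auto intro: hom_add)

lemma hom_single: "size \<mu> = m \<Longrightarrow> sum_mset \<mu> = s \<Longrightarrow> Poly_Mapping.single \<mu> c \<in> hom m s"
  by (auto simp: hom_def)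

lemma hom_var: "var n \<in> hom 1 n"
  unfolding var_def by (rule hom_single) auto

lemma hom_one: "1 \<in> hom 0 0"
  using hom_single[of "{#}" 0 0 1] by (simp add: single_one)

lemma hom_mult: "p \<in> hom m s \<Longrightarrow> q \<in> hom m' s' \<Longrightarrow> p * q \<in> hom (m + m') (s + s')"
  using keys_mult[of p q] by (fastforce simp: hom_def)

lemma hom_power: "p \<in> hom m s \<Longrightarrow> p ^ n \<in> hom (n * m) (n * s)"
  by (induction n) (auto intro: hom_one hom_mult)

lemma hom_induct [consumes 1, case_names zero add]:
  assumes "p \<in> hom m s" and "P 0"
    and "\<And>p \<mu> c. P p \<Longrightarrow> size \<mu> = m \<Longrightarrow> sum_mset \<mu> = s \<Longrightarrow> P (p + Poly_Mapping.single \<mu> c)"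
  shows "P p"
proof -
  have "P (\<Sum>\<mu>\<in>A. Poly_Mapping.single \<mu> (Poly_Mapping.lookup p \<mu>))"
    if "finite A" "A \<subseteq> Poly_Mapping.keys p" for A
    using that
  proof (induction A)
    case (insert a A)
    then have "size a = m" "sum_mset a = s" using assms(1) by (auto simp: hom_def)
    then have "P ((\<Sum>\<mu>\<in>A. Poly_Mapping.single \<mu> (Poly_Mapping.lookup p \<mu>)) +
        Poly_Mapping.single a (Poly_Mapping.lookup p a))"
      using insert by (intro assms(3)) auto
    then show ?case using insert.hyps by (simp only: sum.insert add.commute not_False_eq_True)
  qed (simp add: assms(2))
  from this[of "Poly_Mapping.keys p"] show ?thesis by (simp add: sum_single_lookup)
qed

lemma hom_gen_fps_power: "fps_nth (gen_fps ^ N) n \<in> hom N n"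
proof (induction N arbitrary: n)
  case 0
  then show ?case by (cases n) (auto intro: hom_one)
next
  case (Suc N)
  have "var i * fps_nth (gen_fps ^ N) (n - i) \<in> hom (Suc N) n" if "i \<le> n" for i
    using hom_mult[OF hom_var Suc.IH, of i "n - i"] that by simp
  then show ?case by (auto simp: fps_mult_nth gen_fps_def intro!: hom_sum)
qed

section \<open>Homogeneous components and the shift of the variables\<close>

definition proj :: "nat \<Rightarrow> nat \<Rightarrow> mpoly \<Rightarrow> mpoly" where
  "proj m s p = (\<Sum>\<mu>\<in>{\<mu>\<in>Poly_Mapping.keys p. size \<mu> = m \<and> sum_mset \<mu> = s}.
     Poly_Mapping.single \<mu> (Poly_Mapping.lookup p \<mu>))"

lemma lookup_proj:
  "Poly_Mapping.lookup (proj m s p) \<mu> = (if size \<mu> = m \<and> sum_mset \<mu> = s then Poly_Mapping.lookup p \<mu> else 0)"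
  by (auto simp: proj_def lookup_sum lookup_single when_def in_keys_iff)

lemma proj_add: "proj m s (p + q) = proj m s p + proj m s q"
  by (rule poly_mapping_eqI) (simp add: lookup_proj lookup_add)

lemma proj_zero [simp]: "proj m s 0 = 0"
  by (rule poly_mapping_eqI) (simp add: lookup_proj)

lemma proj_hom:
  assumes "p \<in> hom a b" shows "proj m s p = (if a = m \<and> b = s then p else 0)"
proof (rule poly_mapping_eqI)
  fix \<mu>
  show "Poly_Mapping.lookup (proj m s p) \<mu> = Poly_Mapping.lookup (if a = m \<and> b = s then p else 0) \<mu>"
    using assms by (cases "\<mu> \<in> Poly_Mapping.keys p") (auto simp: lookup_proj hom_def in_keys_iff)
qed

text \<open>Only the component of \<open>c\<close> in the complementary bidegree contributes. The
  last clause makes the truncated subtractions \<open>m - a\<close> and \<open>s - b\<close> genuine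
  whenever the cofactor is non-zero.\<close>

lemma proj_mult_hom:
  assumes "g \<in> hom a b"
  shows "\<exists>d. proj m s (c * g) = d * g \<and> d \<in> hom (m - a) (s - b) \<and> (d = 0 \<or> (a \<le> m \<and> b \<le> s))"
proof (induction c rule: poly_mapping_single_induct)
  case zero
  then show ?case by (intro exI[of _ 0]) simp
next
  case (add c \<mu> x)
  then obtain d where d: "proj m s (c * g) = d * g" "d \<in> hom (m - a) (s - b)" "d = 0 \<or> (a \<le> m \<and> b \<le> s)"
    by blast
  have "Poly_Mapping.single \<mu> x * g \<in> hom (size \<mu> + a) (sum_mset \<mu> + b)"
    by (intro hom_mult hom_single assms refl)
  then have *: "proj m s (Poly_Mapping.single \<mu> x * g) =
      (if size \<mu> + a = m \<and> sum_mset \<mu> + b = s then Poly_Mapping.single \<mu> x * g else 0)"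
    by (rule proj_hom)
  show ?case
  proof (cases "size \<mu> + a = m \<and> sum_mset \<mu> + b = s")
    case True
    then have "Poly_Mapping.single \<mu> x \<in> hom (m - a) (s - b)" by (intro hom_single) auto
    then show ?thesis using True d *
      by (intro exI[of _ "d + Poly_Mapping.single \<mu> x"]) (auto simp: proj_add distrib_right hom_add)
  next
    case False
    then show ?thesis using d * by (intro exI[of _ d]) (auto simp: proj_add distrib_right)
  qed
qed

interpretation shift: poly_eval cst "\<lambda>m. var (Suc m)"
  by (rule poly_eval_cst)

lemma shift_vars_simps:
  "shift_vars (p + q) = shift_vars p + shift_vars q" "shift_vars (p * q) = shift_vars p * shift_vars q"
  "shift_vars 0 = 0" "shift_vars (var n) = var (Suc n)" "shift_vars (p ^ n) = shift_vars p ^ n"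
  "shift_vars 1 = 1" "shift_vars (cst c) = cst c"
  by (simp_all add: shift_vars_def shift.peval_add shift.peval_mult shift.peval_power)

lemma mmon_shift: "mmon (\<lambda>m. var (Suc m)) \<mu> = pmon (image_mset Suc \<mu>)"
proof (induction \<mu>)
  case (add n \<mu>)
  then show ?case by (simp only: shift.mmon_add_mset) (simp add: pmon_def var_def mult_single)
qed (simp add: pmon_def single_one)

lemma shift_vars_single: "shift_vars (Poly_Mapping.single \<mu> c) = Poly_Mapping.single (image_mset Suc \<mu>) c"
  by (simp add: shift_vars_def shift.peval_single mmon_shift flip: single_eq_cst_pmon)

lemma sum_mset_image_Suc: "sum_mset (image_mset Suc \<mu>) = sum_mset \<mu> + size \<mu>"
  by (induction \<mu>) auto

lemma hom_shift_vars: "p \<in> hom m s \<Longrightarrow> shift_vars p \<in> hom m (s + m)"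
  by (induction rule: hom_induct)
    (auto simp: shift_vars_simps shift_vars_single sum_mset_image_Suc intro!: hom_add hom_single)

text \<open>A monomial without \<open>var 0\<close> is the shift of a monomial whose
  \<open>m\<close> indices are each smaller by one, which accounts for \<open>s - m\<close>; all
  other monomials are divisible by \<open>var 0\<close>.\<close>

lemma split_off_var_0:
  assumes "p \<in> hom m s"
  shows "\<exists>q p'. p = var 0 * q + shift_vars p' \<and> p' \<in> hom m (s - m) \<and> (p' = 0 \<or> m \<le> s)"
  using assms
proof (induction rule: hom_induct)
  case zero
  then show ?case by (intro exI[of _ 0]) (simp add: shift_vars_simps)
next
  case (add p \<mu> c)
  then obtain q p' where p: "p = var 0 * q + shift_vars p'" "p' \<in> hom m (s - m)" "p' = 0 \<or> m \<le> s" by blast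
  show ?case
  proof (cases "0 \<in># \<mu>")
    case True
    then obtain \<nu> where "\<mu> = add_mset 0 \<nu>" by (metis multi_member_split)
    then have "Poly_Mapping.single \<mu> c = var 0 * Poly_Mapping.single \<nu> c" by (simp add: var_def mult_single)
    then have "p + Poly_Mapping.single \<mu> c = var 0 * (q + Poly_Mapping.single \<nu> c) + shift_vars p'"
      using p(1) by (simp add: algebra_simps)
    then show ?thesis using p by blast
  next
    case False
    define \<nu> where "\<nu> = image_mset (\<lambda>n. n - 1) \<mu>"
    have \<mu>: "\<mu> = image_mset Suc \<nu>"
      unfolding \<nu>_def multiset.map_comp
      by (rule multiset.map_ident_strong[symmetric]) (use False in \<open>metis comp_apply One_nat_def Suc_pred gr0I\<close>)
    then have s: "s = sum_mset \<nu> + m" "size \<nu> = m" using add.hyps by (auto simp: sum_mset_image_Suc)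
    have "p + Poly_Mapping.single \<mu> c = var 0 * q + shift_vars (p' + Poly_Mapping.single \<nu> c)"
      using p(1) \<mu> by (simp add: shift_vars_simps shift_vars_single)
    moreover have "p' + Poly_Mapping.single \<nu> c \<in> hom m (s - m)"
      using p(2) s by (intro hom_add hom_single) auto
    ultimately show ?thesis using s by (metis le_add2)
  qed
qed

subsection \<open>The ideal of relations\<close>

text \<open>The ideal J_i, built by adding one multiple of a generator at a time, so that inductions
  treat each kind of generator once.\<close>

inductive_set rel_ideal :: "nat \<Rightarrow> nat \<Rightarrow> mpoly set" for k i where
  rel_zero: "0 \<in> rel_ideal k i"
| rel_current: "q \<in> rel_ideal k i \<Longrightarrow> c * fps_nth (gen_fps ^ Suc k) n + q \<in> rel_ideal k i"
| rel_var: "q \<in> rel_ideal k i \<Longrightarrow> c * var 0 ^ Suc i + q \<in> rel_ideal k i"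

lemma rel_ideal_add: "p \<in> rel_ideal k i \<Longrightarrow> q \<in> rel_ideal k i \<Longrightarrow> p + q \<in> rel_ideal k i"
  by (induction rule: rel_ideal.induct) (simp_all only: add.assoc add_0 rel_ideal.intros)

lemma rel_ideal_mult: "p \<in> rel_ideal k i \<Longrightarrow> c * p \<in> rel_ideal k i"
  by (induction rule: rel_ideal.induct)
    (simp_all only: distrib_left mult.assoc[symmetric] mult_zero_right rel_ideal.intros)

lemma rel_ideal_minus: "p \<in> rel_ideal k i \<Longrightarrow> - p \<in> rel_ideal k i"
  using rel_ideal_mult[of p k i "- 1"] by simp

lemma rel_ideal_diff: "p \<in> rel_ideal k i \<Longrightarrow> q \<in> rel_ideal k i \<Longrightarrow> p - q \<in> rel_ideal k i"
  using rel_ideal_add[OF _ rel_ideal_minus, of p k i q] by simp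

lemma rel_ideal_sum: "(\<And>a. a \<in> A \<Longrightarrow> f a \<in> rel_ideal k i) \<Longrightarrow> sum f A \<in> rel_ideal k i"
  by (induction A rule: infinite_finite_induct) (auto intro: rel_ideal_add rel_zero)

lemma current_in_rel_ideal: "c * fps_nth (gen_fps ^ Suc k) n \<in> rel_ideal k i"
  using rel_current[OF rel_zero] by (simp only: add_0_right)

lemma var_in_rel_ideal: "c * var 0 ^ Suc i \<in> rel_ideal k i"
  using rel_var[OF rel_zero] by (simp only: add_0_right)

text \<open>The generators are bihomogeneous, so the ideal is graded.\<close>

lemma rel_ideal_proj: "p \<in> rel_ideal k i \<Longrightarrow> proj m s p \<in> rel_ideal k i"
proof (induction rule: rel_ideal.induct)
  case (rel_current q c n)
  show ?case using proj_mult_hom[OF hom_gen_fps_power, of m s c "Suc k" n] rel_current.IH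
    by (auto simp only: proj_add intro: rel_ideal.intros)
next
  case (rel_var q c)
  have "var 0 ^ Suc i \<in> hom (Suc i * 1) (Suc i * 0)" by (intro hom_power hom_var)
  then show ?case using proj_mult_hom[of "var 0 ^ Suc i" _ _ m s c] rel_var.IH
    by (metis proj_add rel_ideal.rel_var)
qed (simp add: rel_zero)

text \<open>The two ideals share the current relations, and the remaining generator of the larger
  one is \<open>var 0 ^ i\<close> itself.\<close>

lemma rel_ideal_pred:
  assumes "1 \<le> i" "p \<in> rel_ideal k (i - 1)" shows "\<exists>q. p - q * var 0 ^ i \<in> rel_ideal k i"
  using assms(2)
proof (induction rule: rel_ideal.induct)
  case rel_zero
  then show ?case by (intro exI[of _ 0]) (simp add: rel_ideal.rel_zero)
next
  case (rel_current q c n)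
  then obtain r where "q - r * var 0 ^ i \<in> rel_ideal k i" by blast
  from rel_ideal.rel_current[OF this, of c n] show ?case
    by (intro exI[of _ r]) (simp only: add_diff_eq)
next
  case (rel_var q c)
  then obtain r where r: "q - r * var 0 ^ i \<in> rel_ideal k i" by blast
  have "c * var 0 ^ Suc (i - 1) + q - (c + r) * var 0 ^ i = q - r * var 0 ^ i"
    using assms(1) by (simp add: distrib_right del: power_Suc)
  then show ?case using r by metis
qed

text \<open>Modulo J_i the element is \<open>q * var 0 ^ i\<close> with \<open>q\<close>
  homogeneous. Writing \<open>q\<close> as a multiple of \<open>var 0\<close> plus a shifted
  polynomial, the former contributes \<open>var 0 ^ Suc i\<close>, a relation, and only the latter
  remains.\<close>

lemma rel_ideal_decomposition:
  assumes p: "p \<in> hom m s" and i: "i = 0 \<or> p \<in> rel_ideal k (i - 1)"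
  shows "\<exists>p'. p' \<in> hom (m - i) (s - (m - i)) \<and> (p' = 0 \<or> (i \<le> m \<and> m - i \<le> s)) \<and>
    p - var 0 ^ i * shift_vars p' \<in> rel_ideal k i"
proof -
  obtain q where q: "p - q * var 0 ^ i \<in> rel_ideal k i" "q \<in> hom (m - i) s" "q = 0 \<or> i \<le> m"
  proof (cases "i = 0")
    case True
    then show ?thesis using that[of p] p by (simp add: rel_zero)
  next
    case False
    then obtain q where "p - q * var 0 ^ i \<in> rel_ideal k i"
      using rel_ideal_pred[of i p k] i by auto
    \<comment> \<open>Passing to the component of bidegree \<open>(m, s)\<close> replaces
      \<open>q\<close> by a homogeneous cofactor.\<close>
    then have j: "proj m s (p - q * var 0 ^ i) \<in> rel_ideal k i" by (rule rel_ideal_proj)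
    have "var 0 ^ i \<in> hom (i * 1) (i * 0)" by (intro hom_power hom_var)
    then have "var 0 ^ i \<in> hom i 0" by simp
    from proj_mult_hom[OF this, of m s q] obtain d where
      d: "proj m s (q * var 0 ^ i) = d * var 0 ^ i" "d \<in> hom (m - i) s" "d = 0 \<or> i \<le> m" by auto
    have "proj m s (p - q * var 0 ^ i) + proj m s (q * var 0 ^ i) = p"
      using proj_hom[OF p, of m s] proj_add[of m s "p - q * var 0 ^ i" "q * var 0 ^ i"] by simp
    then have "p - d * var 0 ^ i = proj m s (p - q * var 0 ^ i)" using d(1) by (simp add: algebra_simps)
    then show ?thesis using that[of d] d j by simp
  qed
  obtain r p' where r: "q = var 0 * r + shift_vars p'" "p' \<in> hom (m - i) (s - (m - i))" "p' = 0 \<or> m - i \<le> s"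
    using split_off_var_0[OF q(2)] by blast
  show ?thesis
  proof (cases "q = 0")
    case True
    then show ?thesis using q(1) by (intro exI[of _ 0]) (simp add: shift_vars_simps)
  next
    case False
    have "p - var 0 ^ i * shift_vars p' = (p - q * var 0 ^ i) + r * var 0 ^ Suc i"
      using r(1) by (simp add: algebra_simps)
    then have "p - var 0 ^ i * shift_vars p' \<in> rel_ideal k i"
      using rel_ideal_add[OF q(1) var_in_rel_ideal[of r i k]] by (simp only:)
    then show ?thesis using r q(3) False by blast
  qed
qed

section \<open>Multiplication by a power of x_\<alpha>(-1) and shifting, on the ideals of
  relations\<close>

definition shifted_fps :: "mpoly fps" where
  "shifted_fps = Abs_fps (\<lambda>m. var (Suc m))"

lemma shift_vars_sum: "shift_vars (sum f A) = (\<Sum>a\<in>A. shift_vars (f a))"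
  by (induction A rule: infinite_finite_induct) (simp_all add: shift_vars_simps)

lemma shift_vars_gen_fps_power: "shift_vars (fps_nth (gen_fps ^ N) n) = fps_nth (shifted_fps ^ N) n"
proof (induction N arbitrary: n)
  case 0
  then show ?case by (cases n) (simp_all add: shift_vars_simps)
next
  case (Suc N)
  then show ?case
    by (simp add: fps_mult_nth shift_vars_sum shift_vars_simps)
      (simp add: gen_fps_def shifted_fps_def shift_vars_simps)
qed

lemma gen_fps_eq: "gen_fps = fps_const (var 0) + fps_X * shifted_fps"
proof (rule fps_ext)
  fix n show "fps_nth gen_fps n = fps_nth (fps_const (var 0) + fps_X * shifted_fps) n"
    by (cases n) (simp_all add: gen_fps_def shifted_fps_def)
qed

lemma rel_ideal_fps_mult:
  assumes "\<And>n. fps_nth f n \<in> rel_ideal k i" shows "fps_nth (g * f) n \<in> rel_ideal k i"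
  by (auto simp: fps_mult_nth intro!: rel_ideal_sum rel_ideal_mult assms)

text \<open>The power \<open>(gen_fps - var 0) ^ Suc k\<close> agrees with the current relation up
  to a multiple of \<open>var 0\<close>, so \<open>var 0 ^ i\<close> times it has coefficients in
  the ideal. It is also \<open>fps_X ^ Suc k\<close> times the shifted power, and comparing
  coefficients removes that factor.\<close>

lemma shifted_current_in_rel_ideal: "var 0 ^ i * fps_nth (shifted_fps ^ Suc k) n \<in> rel_ideal k i"
proof -
  let ?c = "fps_const (var 0)"
  have "\<exists>Q. (gen_fps - ?c) ^ N = gen_fps ^ N + ?c * Q" for N
  proof (induction N)
    case (Suc N)
    then obtain Q where "(gen_fps - ?c) ^ N = gen_fps ^ N + ?c * Q" by blast
    then have "(gen_fps - ?c) ^ Suc N = gen_fps ^ Suc N + ?c * (gen_fps * Q - gen_fps ^ N - ?c * Q)"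
      by (simp add: algebra_simps)
    then show ?case by blast
  qed (intro exI[of _ 0], simp)
  then obtain Q where Q: "(gen_fps - ?c) ^ Suc k = gen_fps ^ Suc k + ?c * Q" by blast
  have "gen_fps - ?c = fps_X * shifted_fps" by (simp add: gen_fps_eq)
  then have "fps_X ^ Suc k * (?c ^ i * shifted_fps ^ Suc k) = ?c ^ i * (gen_fps - ?c) ^ Suc k"
    by (simp only: power_mult_distrib mult_ac)
  also have "\<dots> = ?c ^ i * gen_fps ^ Suc k + Q * ?c ^ Suc i"
    unfolding Q by (simp add: algebra_simps)
  finally have eq: "fps_X ^ Suc k * (?c ^ i * shifted_fps ^ Suc k) = ?c ^ i * gen_fps ^ Suc k + Q * ?c ^ Suc i" .
  have 1: "fps_nth (?c ^ i * gen_fps ^ Suc k) n \<in> rel_ideal k i" for n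
    by (rule rel_ideal_fps_mult) (use current_in_rel_ideal[of 1] in \<open>simp only: mult_1\<close>)
  have 2: "fps_nth (Q * ?c ^ Suc i) n \<in> rel_ideal k i" for n
  proof (rule rel_ideal_fps_mult)
    fix n show "fps_nth (?c ^ Suc i) n \<in> rel_ideal k i"
      using var_in_rel_ideal[of 1 i k] by (simp add: fps_const_power rel_zero del: power_Suc)
  qed
  have "fps_nth (?c ^ i * shifted_fps ^ Suc k) n = fps_nth (fps_X ^ Suc k * (?c ^ i * shifted_fps ^ Suc k)) (n + Suc k)"
    by (simp add: fps_X_power_mult_nth del: power_Suc)
  also have "\<dots> \<in> rel_ideal k i"
    unfolding eq fps_add_nth by (rule rel_ideal_add[OF 1 2])
  finally show ?thesis by (simp add: fps_const_power del: power_Suc)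
qed

lemma cst_of_nat: "cst (of_nat n) = of_nat n"
  by (induction n) simp_all

text \<open>Take the coefficient of degree \<open>k + 1 - i\<close> in the current relation and
  expand in powers of \<open>var 0\<close>. Terms with exponent below \<open>i\<close> vanish for
  reasons of order, those above \<open>i\<close> are relations, and the one at \<open>i\<close> is a
  non-zero multiple of the claimed product.\<close>

lemma var_0_var_1_in_rel_ideal:
  assumes "i \<le> k" shows "var 0 ^ i * var 1 ^ Suc (k - i) \<in> rel_ideal k i"
proof -
  let ?c = "fps_const (var 0)" and ?Z = "fps_X * shifted_fps"
  define u where "u = Suc (k - i)"
  have Z: "fps_nth (?Z ^ t) u = (if t \<le> u then fps_nth (shifted_fps ^ t) (u - t) else 0)" for t
    by (simp add: power_mult_distrib fps_X_power_mult_nth not_less)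
  have "fps_nth (gen_fps ^ Suc k) u = (\<Sum>t\<le>Suc k. fps_nth (of_nat (Suc k choose t) * ?c ^ t * ?Z ^ (Suc k - t)) u)"
    unfolding gen_fps_eq binomial_ring fps_sum_nth ..
  also have "\<dots> = (\<Sum>t\<le>Suc k. of_nat (Suc k choose t) * var 0 ^ t * fps_nth (?Z ^ (Suc k - t)) u)"
    by (rule sum.cong) (simp_all add: fps_const_power fps_of_nat[symmetric] mult.assoc)
  also have "\<dots> = (\<Sum>t\<in>{..Suc k} - {i}. of_nat (Suc k choose t) * var 0 ^ t * fps_nth (?Z ^ (Suc k - t)) u)
     + of_nat (Suc k choose i) * var 0 ^ i * fps_nth (?Z ^ (Suc k - i)) u"
    using assms by (subst sum.remove[of _ i]) (auto simp: add.commute)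
  finally have eq: "of_nat (Suc k choose i) * var 0 ^ i * fps_nth (?Z ^ (Suc k - i)) u =
      fps_nth (gen_fps ^ Suc k) u -
      (\<Sum>t\<in>{..Suc k} - {i}. of_nat (Suc k choose t) * var 0 ^ t * fps_nth (?Z ^ (Suc k - t)) u)"
    by (simp add: algebra_simps)
  have "of_nat (Suc k choose t) * var 0 ^ t * fps_nth (?Z ^ (Suc k - t)) u \<in> rel_ideal k i" if "t \<noteq> i" for t
  proof (cases "t < i")
    case True
    then have "\<not> Suc k - t \<le> u" using assms by (auto simp: u_def)
    then show ?thesis by (simp add: Z rel_zero)
  next
    case False
    then have t: "t = Suc i + (t - Suc i)" using that by auto
    have "of_nat (Suc k choose t) * var 0 ^ t * fps_nth (?Z ^ (Suc k - t)) u =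
      (of_nat (Suc k choose t) * var 0 ^ (t - Suc i) * fps_nth (?Z ^ (Suc k - t)) u) * var 0 ^ Suc i"
      by (subst t) (simp only: power_add mult_ac)
    then show ?thesis using var_in_rel_ideal by metis
  qed
  then have "of_nat (Suc k choose i) * var 0 ^ i * fps_nth (?Z ^ (Suc k - i)) u \<in> rel_ideal k i"
    unfolding eq using current_in_rel_ideal[of 1 k u i]
    by (intro rel_ideal_diff rel_ideal_sum) (auto simp only: mult_1)
  moreover have "fps_nth (?Z ^ (Suc k - i)) u = var 1 ^ u"
  proof -
    have "Suc k - i = u" using assms by (simp add: u_def)
    then show ?thesis
      by (simp only: Z le_refl if_True diff_self_eq_0 fps_nth_power_0) (simp add: shifted_fps_def)
  qed
  ultimately have "of_nat (Suc k choose i) * var 0 ^ i * var 1 ^ u \<in> rel_ideal k i"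
    by (simp only:)
  then have "cst (1 / of_nat (Suc k choose i)) * (of_nat (Suc k choose i) * var 0 ^ i * var 1 ^ u) \<in> rel_ideal k i"
    by (rule rel_ideal_mult)
  also have "cst (1 / of_nat (Suc k choose i)) * (of_nat (Suc k choose i) * var 0 ^ i * var 1 ^ u) = var 0 ^ i * var 1 ^ u"
  proof -
    have "(of_nat (Suc k choose i) :: complex) \<noteq> 0" using assms by simp
    then have "cst (1 / of_nat (Suc k choose i)) * of_nat (Suc k choose i) = 1"
      by (simp only: cst_of_nat[symmetric] cst_simps(4)[symmetric]) simp
    then show ?thesis by (metis mult.assoc mult_1)
  qed
  finally show ?thesis unfolding u_def .
qed

text \<open>Enough to check generators: the current relations become
  \<open>shifted_current_in_rel_ideal\<close>, and \<open>var 0 ^ Suc (k - i)\<close> is shifted to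
  a power of \<open>var 1\<close>, covered by \<open>var_0_var_1_in_rel_ideal\<close>.\<close>

lemma shift_rel_ideal:
  assumes "i \<le> k" "p \<in> rel_ideal k (k - i)" shows "var 0 ^ i * shift_vars p \<in> rel_ideal k i"
  using assms(2)
proof (induction rule: rel_ideal.induct)
  case rel_zero
  then show ?case by (simp add: shift_vars_simps rel_ideal.rel_zero)
next
  case (rel_current q c n)
  have "var 0 ^ i * shift_vars (c * fps_nth (gen_fps ^ Suc k) n + q) =
     shift_vars c * (var 0 ^ i * fps_nth (shifted_fps ^ Suc k) n) + var 0 ^ i * shift_vars q"
    by (simp only: shift_vars_simps shift_vars_gen_fps_power distrib_left mult_ac)
  then show ?case
    using rel_ideal_add[OF rel_ideal_mult[OF shifted_current_in_rel_ideal] rel_current.IH] by simp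
next
  case (rel_var q c)
  have "var 0 ^ i * shift_vars (c * var 0 ^ Suc (k - i) + q) =
     shift_vars c * (var 0 ^ i * var 1 ^ Suc (k - i)) + var 0 ^ i * shift_vars q"
    by (simp only: shift_vars_simps distrib_left mult_ac One_nat_def)
  then show ?case
    using rel_ideal_add[OF rel_ideal_mult[OF var_0_var_1_in_rel_ideal[OF assms(1)]] rel_var.IH] by simp
qed

subsection \<open>Exactness\<close>

context fock_level
begin

lemma rel_ideal_subset_ann: "i \<le> k \<Longrightarrow> p \<in> rel_ideal k i \<Longrightarrow> p \<in> ann k i"
  by (erule rel_ideal.induct)
    (auto intro!: ann_zero ann_add ann_mult gen_fps_power_in_ann var_pow_in_ann simp del: power_Suc)

lemma ann_cst: "cst c \<in> ann k i \<Longrightarrow> c = 0"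
proof -
  assume "cst c \<in> ann k i"
  then have "app (fsc c) (fvac k i) = 0" by (simp add: ann_def)
  then have "c * amp (fvac k i) S = 0" for S by (metis amp_fsc amp_simps(1))
  then show ?thesis using fvac_nonzero[of k i] by (metis amp_simps(1) fock_eqI mult_eq_0_iff)
qed

text \<open>Outer induction on the weight, inner induction on \<open>j \<le> i\<close>. An element
  of I_j lies in I_(j-1), hence in J_(j-1) by the inner hypothesis, so modulo J_j it is
  \<open>var 0 ^ j * shift_vars p'\<close>. Then \<open>p'\<close> lies in I_(k-j) and has smaller
  weight, so it lies in J_(k-j), and \<open>shift_rel_ideal\<close> returns to J_j.\<close>

lemma ann_subset_rel_ideal:
  "i \<le> k \<Longrightarrow> p \<in> hom m s \<Longrightarrow> p \<in> ann k i \<Longrightarrow> p \<in> rel_ideal k i"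
proof (induction "m + s" arbitrary: m s i p rule: less_induct)
  case less
  show ?case
  proof (cases "m = 0")
    case True
    have "Poly_Mapping.keys p \<subseteq> {{#}}" using less.prems(2) True by (auto simp: hom_def)
    then have "p = cst (Poly_Mapping.lookup p {#})"
      by (intro poly_mapping_eqI) (auto simp: cst_def lookup_single when_def in_keys_iff)
    then show ?thesis using ann_cst less.prems(3) by (metis cst_simps(1) rel_zero)
  next
    case m: False
    have "p \<in> rel_ideal k j" if "j \<le> i" "p \<in> ann k j" for j
      using that
    proof (induction j)
      case 0
      obtain p' where p': "p' \<in> hom (m - 0) (s - (m - 0))" "p' = 0 \<or> (0 \<le> m \<and> m - 0 \<le> s)"
        "p - var 0 ^ 0 * shift_vars p' \<in> rel_ideal k 0"
        using rel_ideal_decomposition[OF less.prems(2), of 0 k] by blast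
      have "var 0 ^ 0 * shift_vars p' \<in> ann k 0"
        using ann_diff[OF 0(2) rel_ideal_subset_ann[OF le0 p'(3)]] by simp
      then have "p' \<in> ann k k" using shift_in_ann_iff[of 0 p'] by simp
      \<comment> \<open>Unless \<open>p' = 0\<close>, its weight is \<open>m + (s - m) = s\<close>,
        which is less than \<open>m + s\<close> because \<open>m\<close> is positive.\<close>
      then have "p' \<in> rel_ideal k k"
        using less.hyps[of m "s - m" k p'] p' m by (auto intro: rel_zero)
      then have "var 0 ^ 0 * shift_vars p' \<in> rel_ideal k 0"
        using shift_rel_ideal[of 0 k p'] by simp
      from rel_ideal_add[OF p'(3) this] show ?case by simp
    next
      case (Suc j)
      let ?i = "Suc j"
      have i: "?i \<le> k" using Suc.prems less.prems(1) by simp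
      have "p \<in> ann k j" using ann_antimono[of ?i p] Suc.prems i by simp
      then have "p \<in> rel_ideal k j" using Suc by simp
      then obtain p' where p': "p' \<in> hom (m - ?i) (s - (m - ?i))" "p' = 0 \<or> (?i \<le> m \<and> m - ?i \<le> s)"
        "p - var 0 ^ ?i * shift_vars p' \<in> rel_ideal k ?i"
        using rel_ideal_decomposition[OF less.prems(2), of ?i k] by auto
      have "var 0 ^ ?i * shift_vars p' \<in> ann k ?i"
        using ann_diff[OF Suc.prems(2) rel_ideal_subset_ann[OF i p'(3)]] by simp
      then have "p' \<in> ann k (k - ?i)" using shift_in_ann_iff[OF i, of p'] by simp
      then have "p' \<in> rel_ideal k (k - ?i)"
        using less.hyps[of "m - ?i" "s - (m - ?i)" "k - ?i" p'] p' m by (auto intro: rel_zero)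
      then have "var 0 ^ ?i * shift_vars p' \<in> rel_ideal k ?i"
        using shift_rel_ideal[OF i] by simp
      from rel_ideal_add[OF p'(3) this] show ?case by simp
    qed
    then show ?thesis using less.prems(3) by blast
  qed
qed

theorem ann_decomposition:
  assumes "i \<le> k" "p \<in> hom m s" "i = 0 \<or> p \<in> ann k (i - 1)"
  shows "\<exists>p'. p' \<in> hom (m - i) (s - (m - i)) \<and> (p' = 0 \<or> (i \<le> m \<and> m - i \<le> s)) \<and>
    p - var 0 ^ i * shift_vars p' \<in> ann k i"
proof -
  have "i = 0 \<or> p \<in> rel_ideal k (i - 1)"
    using assms ann_subset_rel_ideal[OF _ assms(2)] by (meson diff_le_self le_trans)
  from rel_ideal_decomposition[OF assms(2) this] show ?thesis
    using rel_ideal_subset_ann[OF assms(1)] by blast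
qed

end

section \<open>The Sugawara operator\<close>

definition rcomm :: "'r::ring \<Rightarrow> 'r \<Rightarrow> 'r" where
  "rcomm A B = A * B - B * A"

lemma rcomm_mult_left: "rcomm (A * B) D = A * rcomm B D + rcomm A D * B"
  by (simp add: rcomm_def right_diff_distrib left_diff_distrib mult.assoc)

lemma rcomm_mult_right: "rcomm D (A * B) = A * rcomm D B + rcomm D A * B"
  by (simp add: rcomm_def right_diff_distrib left_diff_distrib mult.assoc)

lemma rcomm_add: "rcomm (A + B) D = rcomm A D + rcomm B D" "rcomm D (A + B) = rcomm D A + rcomm D B"
  by (simp_all add: rcomm_def distrib_left distrib_right)

lemma rcomm_diff: "rcomm (A - B) D = rcomm A D - rcomm B D" "rcomm D (A - B) = rcomm D A - rcomm D B"
  by (simp_all add: rcomm_def left_diff_distrib right_diff_distrib)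

lemma rcomm_lsum:
  assumes "loc_fin A"
  shows "rcomm (lsum A) D = lsum (\<lambda>x. rcomm (A x) D)"
  unfolding rcomm_def
    lsum_diff[OF loc_fin_mult_right[OF assms] loc_fin_mult_left[OF assms]]
    lsum_mult_left[OF assms] lsum_mult_right[OF assms] ..

text \<open>On each vector \<open>Y j\<close> vanishes for large \<open>j\<close>, so there is no
  boundary term at infinity.\<close>

lemma lsum_telescope:
  fixes Y :: "nat \<Rightarrow> 'v::ab_group_add aend"
  assumes "loc_fin Y"
  shows "lsum (\<lambda>j. Y (Suc j) - Y j) = - Y 0" "loc_fin (\<lambda>j. Y (Suc j) - Y j)"
proof -
  have 1: "\<exists>N. \<forall>j\<ge>N. app (Y j) f = 0" for f
  proof -
    have "finite {j. app (Y j) f \<noteq> 0}" using assms by (simp add: loc_fin_def)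
    then obtain N where "{j. app (Y j) f \<noteq> 0} \<subseteq> {..<N}" using finite_nat_iff_bounded by blast
    then show ?thesis by (intro exI[of _ N]) force
  qed
  show 2: "loc_fin (\<lambda>j. Y (Suc j) - Y j)"
    unfolding loc_fin_def
  proof
    fix f
    obtain N where N: "\<forall>j\<ge>N. app (Y j) f = 0" using 1 by blast
    have "app (Y (Suc j) - Y j) f = 0" if "\<not> j < N" for j using N that by simp
    then have "{j. app (Y (Suc j) - Y j) f \<noteq> 0} \<subseteq> {..<N}" by blast
    then show "finite {j. app (Y (Suc j) - Y j) f \<noteq> 0}" by (rule finite_subset) simp
  qed
  show "lsum (\<lambda>j. Y (Suc j) - Y j) = - Y 0"
  proof (rule aend_eqI)
    fix f
    obtain N where N: "\<forall>j\<ge>N. app (Y j) f = 0" using 1 by blast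
    have 0: "app (Y (Suc j) - Y j) f = 0" if "\<not> j < N" for j using N that by simp
    have "app (lsum (\<lambda>j. Y (Suc j) - Y j)) f = (\<Sum>j<N. app (Y (Suc j) - Y j) f)"
      by (rule app_lsum_superset[OF 2]) (use 0 in blast)+
    also have "\<dots> = app (Y N) f - app (Y 0) f"
      using sum_lessThan_telescope[of "\<lambda>j. app (Y j) f" N] by simp
    finally show "app (lsum (\<lambda>j. Y (Suc j) - Y j)) f = app (- Y 0) f" using N by simp
  qed
qed

section \<open>The Sugawara operator and its commutators with the generators\<close>

locale restricted_rep = sl2_rep sc E F H k
  for sc :: "complex \<Rightarrow> 'v::ab_group_add aend" and E F H k +
  assumes restricted: "\<exists>N. \<forall>n\<ge>N. app (E n) w = 0 \<and> app (F n) w = 0 \<and> app (H n) w = 0"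
begin

text \<open>Normally ordered Casimir terms, doubled to avoid the fraction in
  \<open>h h / 2 + e f + f e\<close>. Modes \<open>n\<close> and \<open>- n\<close> are merged,
  which gives the further factor 2 in \<open>sug\<close>; thus \<open>sug\<close> is
  \<open>4 (k + 2)\<close> times the usual L(0).\<close>

definition sug_term :: "int \<Rightarrow> 'v aend" where
  "sug_term n = H (- n) * H n + sc 2 * (E (- n) * F n) + sc 2 * (F (- n) * E n)"

definition sug :: "'v aend" where
  "sug = H 0 * H 0 + sc 2 * (E 0 * F 0 + F 0 * E 0) + sc 2 * lsum (\<lambda>j::nat. sug_term (int j + 1))"

lemma loc_finI:
  assumes "\<And>w. \<exists>N. \<forall>n\<ge>N. app (A n) w = 0" shows "loc_fin (\<lambda>j::nat. A (int j + d))"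
  unfolding loc_fin_def
proof
  fix w
  obtain N where N: "\<forall>n\<ge>N. app (A n) w = 0" using assms by blast
  have "app (A (int j + d)) w = 0" if "\<not> j \<le> nat (N - d)" for j using N that by simp
  then have "{j::nat. app (A (int j + d)) w \<noteq> 0} \<subseteq> {..nat (N - d)}" by blast
  then show "finite {j::nat. app (A (int j + d)) w \<noteq> 0}" by (rule finite_subset) simp
qed

lemma loc_fin_sug: "loc_fin (\<lambda>j::nat. sug_term (int j + 1))"
proof (rule loc_finI)
  fix w obtain N where "\<forall>n\<ge>N. app (E n) w = 0 \<and> app (F n) w = 0 \<and> app (H n) w = 0" using restricted by blast
  then show "\<exists>N. \<forall>n\<ge>N. app (sug_term n) w = 0" by (intro exI[of _ N]) (simp add: sug_term_def)
qed

lemma rcomm_basic: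
  "rcomm (H m) (E n) = sc 2 * E (m + n)"
  "rcomm (E m) (E n) = 0"
  "rcomm (F m) (E n) = - H (m + n) + (if m + n = 0 then sc (of_int m * of_nat k) else 0)"
  "rcomm (sc a) (E n) = 0"
proof -
  have "rcomm (F m) (E n) = - (E n * F m - F m * E n)" by (simp add: rcomm_def)
  also have "E n * F m - F m * E n = H (n + m) + (if n + m = 0 then sc (of_int n * of_nat k) else 0)"
    using EF[of n m] by simp
  finally show "rcomm (F m) (E n) = - H (m + n) + (if m + n = 0 then sc (of_int m * of_nat k) else 0)"
    by (auto simp: add.commute add_eq_0_iff sc_minus)
qed (simp_all add: rcomm_def HE EE sc_E)

lemma sc_two_mult: "sc 2 * A = A + A" "A * sc 2 = A + A"
proof -
  have "sc 2 = 1 + 1" using sc_add[of 1 1] by (simp add: sc_one)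
  then show "sc 2 * A = A + A" "A * sc 2 = A + A" by (simp_all add: distrib_right distrib_left)
qed

lemma rcomm_sug_term:
  "rcomm (sug_term n) (E m) =
     sc 2 * (H (- n) * E (n + m) + E (m - n) * H n - E (- n) * H (n + m) - H (m - n) * E n)
     + sc 2 * (E (- n) * (if n + m = 0 then sc (of_int n * of_nat k) else 0))
     + sc 2 * ((if m - n = 0 then sc (- (of_int n * of_nat k)) else 0) * E n)"
proof -
  have "rcomm (H (- n) * H n) (E m) = H (- n) * (sc 2 * E (n + m)) + sc 2 * E (m - n) * H n"
    by (simp add: rcomm_mult_left rcomm_basic)
  moreover have "rcomm (sc 2 * (E (- n) * F n)) (E m) =
      sc 2 * (E (- n) * (- H (n + m) + (if n + m = 0 then sc (of_int n * of_nat k) else 0)))"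
    by (simp only: rcomm_mult_left rcomm_basic mult_zero_left add_0_right)
  moreover have "rcomm (sc 2 * (F (- n) * E n)) (E m) =
      sc 2 * ((- H (m - n) + (if m - n = 0 then sc (- (of_int n * of_nat k)) else 0)) * E n)"
    using rcomm_basic(3)[of "- n" m]
    by (simp only: rcomm_mult_left rcomm_basic(2,4) mult_zero_left mult_zero_right add_0_right add_0_left) simp
  ultimately show ?thesis
    unfolding sug_term_def rcomm_add
    by (simp only: sc_two_mult distrib_left distrib_right right_diff_distrib left_diff_distrib
        mult_minus_left mult_minus_right) (simp only: add_ac diff_conv_add_uminus minus_add_distrib minus_minus)
qed

lemma rcomm_zero_modes:
  "rcomm (H 0 * H 0 + sc 2 * (E 0 * F 0 + F 0 * E 0)) (E m) =
     sc 2 * (H 0 * E m + E m * H 0 - E 0 * H m - H m * E 0)"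
proof -
  have "rcomm (F 0) (E m) = - H m" using rcomm_basic(3)[of 0 m] by (simp add: sc_zero)
  moreover have "rcomm (H 0) (E m) = sc 2 * E m" using rcomm_basic(1)[of 0 m] by simp
  ultimately show ?thesis
    by (simp only: rcomm_add rcomm_mult_left rcomm_basic(2,4) sc_two_mult distrib_left distrib_right
        mult_zero_left mult_zero_right mult_minus_left mult_minus_right right_diff_distrib left_diff_distrib)
      (simp only: add_ac diff_conv_add_uminus minus_add_distrib minus_minus add_0_left add_0_right)
qed

lemma rcomm_sug_eq: "rcomm sug (E m) = sc 2 * (H 0 * E m + E m * H 0 - E 0 * H m - H m * E 0) +
    sc 2 * lsum (\<lambda>j::nat. rcomm (sug_term (int j + 1)) (E m))"
  unfolding sug_def rcomm_add(1)[of _ "sc 2 * lsum _"] rcomm_zero_modes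
  by (simp add: rcomm_mult_left rcomm_basic rcomm_lsum[OF loc_fin_sug])

lemma loc_fin_shifted_pairs:
  "loc_fin (\<lambda>j::nat. sc 2 * (H (- (int j + d)) * E (int j + e) - E (- (int j + d)) * H (int j + e)))"
proof -
  have "loc_fin (\<lambda>j::nat. (\<lambda>n. sc 2 * (H (- (n + d)) * E (n + e) - E (- (n + d)) * H (n + e))) (int j + 0))"
  proof (rule loc_finI)
    fix w obtain N where N: "\<forall>n\<ge>N. app (E n) w = 0 \<and> app (F n) w = 0 \<and> app (H n) w = 0" using restricted by blast
    then show "\<exists>N. \<forall>n\<ge>N. app (sc 2 * (H (- (n + d)) * E (n + e) - E (- (n + d)) * H (n + e))) w = 0"
      by (intro exI[of _ "N - e"]) simp
  qed
  then show ?thesis by simp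
qed

lemma lsum_delta: "lsum (\<lambda>j::nat. if j = 0 then C else 0) = C" "loc_fin (\<lambda>j::nat. if j = 0 then C else 0)"
proof -
  show "lsum (\<lambda>j::nat. if j = 0 then C else 0) = C"
    by (subst lsum_finite[of "{0}"]) auto
qed (simp add: loc_fin_finite)

lemma rcomm_sug_E0: "rcomm sug (E 0) = 0"
proof -
  have "rcomm (sug_term (int j + 1)) (E 0) = 0" for j
    using rcomm_sug_term[of "int j + 1" 0] by simp
  moreover have "lsum (\<lambda>j::nat. 0 :: 'v aend) = 0" by (simp add: lsum_finite[of "{}"])
  ultimately show ?thesis unfolding rcomm_sug_eq by (simp add: sc_zero)
qed

lemma sc_level_mult:
  "sc (4 * (of_nat k + 2)) * A = A + A + A + A + A + A + A + A +
    (sc (of_nat k) * A + sc (of_nat k) * A + sc (of_nat k) * A + sc (of_nat k) * A)"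
proof -
  have "sc (4 * (of_nat k + 2)) = sc 2 * (sc 2 * (sc (of_nat k) + sc 2))"
    by (simp add: sc_add[symmetric] sc_mult[symmetric])
  then show ?thesis by (simp add: mult.assoc distrib_right sc_two_mult add_ac)
qed

text \<open>The commutators with successive terms telescope apart from one central contribution.
  That contribution gives \<open>4 k\<close>; putting the boundary terms into a common order gives
  the remaining 8, the shift by the dual Coxeter number.\<close>

lemma rcomm_sug_E_minus: "rcomm sug (E (- 1)) = sc (4 * (of_nat k + 2)) * E (- 1)"
proof -
  define Y where "Y j = sc 2 * (H (- (int j + 1)) * E (int j + 0) - E (- (int j + 1)) * H (int j + 0))" for j :: nat
  let ?C = "sc 2 * (E (- 1) * sc (of_nat k))"
  have Y: "loc_fin Y" unfolding Y_def by (rule loc_fin_shifted_pairs)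
  have "rcomm (sug_term (int j + 1)) (E (- 1)) = - (Y (Suc j) - Y j) + (if j = 0 then ?C else 0)" for j
    using rcomm_sug_term[of "int j + 1" "- 1"]
    by (simp add: Y_def right_diff_distrib distrib_left add.commute)
  then have "lsum (\<lambda>j. rcomm (sug_term (int j + 1)) (E (- 1))) = Y 0 + ?C"
    by (simp only: lsum_add[OF loc_fin_minus[OF lsum_telescope(2)[OF Y]] lsum_delta(2)]
        lsum_minus[OF lsum_telescope(2)[OF Y]] lsum_telescope(1)[OF Y] lsum_delta(1) minus_minus)
  then have "rcomm sug (E (- 1)) = sc 2 * (H 0 * E (- 1) + E (- 1) * H 0 - E 0 * H (- 1) - H (- 1) * E 0) +
      sc 2 * (sc 2 * (H (- 1) * E 0 - E (- 1) * H 0) + ?C)"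
    unfolding rcomm_sug_eq by (simp add: Y_def)
  also have "H 0 * E (- 1) = E (- 1) * H 0 + sc 2 * E (- 1)" using HE[of 0 "- 1"] by simp
  also have "H (- 1) * E 0 = E 0 * H (- 1) + sc 2 * E (- 1)" using HE[of "- 1" 0] by simp
  also have "E (- 1) * sc (of_nat k) = sc (of_nat k) * E (- 1)" by (rule sc_E[symmetric])
  finally show ?thesis unfolding sc_level_mult sc_two_mult by (simp add: algebra_simps)
qed

lemma rcomm_sug_E_plus: "rcomm sug (E 1) = - (sc (4 * (of_nat k + 2)) * E 1)"
proof -
  define Y where "Y j = sc 2 * (H (- (int j + 0)) * E (int j + 1) - E (- (int j + 0)) * H (int j + 1))" for j :: nat
  let ?C = "sc 2 * (- sc (of_nat k) * E 1)"
  have Y: "loc_fin Y" unfolding Y_def by (rule loc_fin_shifted_pairs)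
  have "rcomm (sug_term (int j + 1)) (E 1) = (Y (Suc j) - Y j) + (if j = 0 then ?C else 0)" for j
    using rcomm_sug_term[of "int j + 1" 1]
    by (simp add: Y_def right_diff_distrib distrib_left add.commute sc_minus)
  then have "lsum (\<lambda>j. rcomm (sug_term (int j + 1)) (E 1)) = - Y 0 + ?C"
    by (simp only: lsum_add[OF lsum_telescope(2)[OF Y] lsum_delta(2)] lsum_telescope(1)[OF Y] lsum_delta(1))
  then have "rcomm sug (E 1) = sc 2 * (H 0 * E 1 + E 1 * H 0 - E 0 * H 1 - H 1 * E 0) +
      sc 2 * (- (sc 2 * (H 0 * E 1 - E 0 * H 1)) + ?C)"
    unfolding rcomm_sug_eq by (simp add: Y_def)
  also have "H 0 * E 1 = E 1 * H 0 + sc 2 * E 1" using HE[of 0 1] by simp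
  also have "H 1 * E 0 = E 0 * H 1 + sc 2 * E 1" using HE[of 1 0] by simp
  finally show ?thesis unfolding sc_level_mult sc_two_mult by (simp add: algebra_simps)
qed

text \<open>The involution exchanging e and f and negating h. It leaves \<open>sug\<close>
  unchanged, so the commutators with \<open>F\<close> follow from those with
  \<open>E\<close>.\<close>

lemma flip_rep: "restricted_rep sc F E (\<lambda>n. - H n) k"
proof -
  have FE: "F m * E n = E n * F m - H (m + n) + (if m + n = 0 then sc (of_int m * of_nat k) else 0)" for m n
    using rcomm_basic(3)[of m n] by (simp add: rcomm_def algebra_simps)
  interpret f: sl2_rep sc F E "\<lambda>n. - H n" k
  proof (standard, goal_cases)
    case (9 m n) show ?case using HF[of m n] by simp
  next
    case (10 m n) show ?case using HE[of m n] by simp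
  next
    case (11 m n) show ?case using FE[of m n] by simp
  next
    case (12 m n) show ?case using HH[of m n] by simp
  qed (simp_all add: sc_add sc_mult sc_one sc_E sc_F sc_H EE FF)
  show ?thesis
  proof
    fix w show "\<exists>N. \<forall>n\<ge>N. app (F n) w = 0 \<and> app (E n) w = 0 \<and> app (- H n) w = 0"
      using restricted[of w] by (auto simp: conj_commute)
  qed
qed

lemma rcomm_sug_F:
  "rcomm sug (F 0) = 0" "rcomm sug (F (- 1)) = sc (4 * (of_nat k + 2)) * F (- 1)"
  "rcomm sug (F 1) = - (sc (4 * (of_nat k + 2)) * F 1)"
proof -
  interpret f: restricted_rep sc F E "\<lambda>n. - H n" k by (rule flip_rep)
  have "f.sug_term n = sug_term n" for n
    by (simp add: f.sug_term_def sug_term_def add_ac)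
  then have s: "f.sug = sug" by (simp add: f.sug_def sug_def add.commute)
  show "rcomm sug (F 0) = 0" "rcomm sug (F (- 1)) = sc (4 * (of_nat k + 2)) * F (- 1)"
    "rcomm sug (F 1) = - (sc (4 * (of_nat k + 2)) * F 1)"
    using f.rcomm_sug_E0 f.rcomm_sug_E_minus f.rcomm_sug_E_plus by (simp_all add: s)
qed

lemma sc_comm_sc: "sc a * sc b = sc b * sc a"
  by (simp only: sc_mult[symmetric] mult.commute)

lemma sc_sug: "sc a * sug = sug * sc a"
proof -
  have c: "sc a * (A * B) = A * B * sc a" if "sc a * A = A * sc a" "sc a * B = B * sc a" for A B
    using that by (metis mult.assoc)
  have "sc a * sug_term n = sug_term n * sc a" for n
    unfolding sug_term_def distrib_left distrib_right
    by (simp only: c sc_E sc_F sc_H sc_comm_sc)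
  then have "sc a * lsum (\<lambda>j::nat. sug_term (int j + 1)) = lsum (\<lambda>j::nat. sug_term (int j + 1)) * sc a"
    by (simp add: loc_fin_sug flip: lsum_mult_left lsum_mult_right)
  then show ?thesis unfolding sug_def distrib_left distrib_right
    by (simp only: c sc_E sc_F sc_H sc_comm_sc)
qed

text \<open>The normalised Sugawara operator plus a constant; \<open>deg_op 0\<close> turns out to
  be L(0).\<close>

definition deg_op :: "complex \<Rightarrow> 'v aend" where
  "deg_op c = sc (1 / (4 * (of_nat k + 2))) * sug + sc c"

lemma sc_deg_op: "sc a * deg_op c = deg_op c * sc a"
proof -
  have "sc a * (sc b * sug) = sc b * sug * sc a" for b
    by (metis mult.assoc sc_sug sc_comm_sc)
  then show ?thesis by (simp add: deg_op_def distrib_left distrib_right sc_comm_sc)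
qed

definition has_degree :: "'v aend \<Rightarrow> int \<Rightarrow> bool" where
  "has_degree A n \<longleftrightarrow> (\<forall>c. rcomm (deg_op c) A = - (sc (of_int n) * A))"

lemma rcomm_deg_op:
  assumes "\<And>a. sc a * A = A * sc a" "rcomm sug A = - (sc (of_int n * (4 * (of_nat k + 2))) * A)"
  shows "has_degree A n"
  unfolding has_degree_def
proof
  fix c
  have nz: "(4 * (of_nat k + 2) :: complex) \<noteq> 0"
  proof -
    have "(4 * (of_nat k + 2) :: complex) = of_nat (4 * (k + 2))" by simp
    then show ?thesis by (simp only: of_nat_eq_0_iff) simp
  qed
  have "rcomm (sc b) A = 0" for b by (simp add: rcomm_def assms(1))
  then have "rcomm (deg_op c) A = sc (1 / (4 * (of_nat k + 2))) * (- (sc (of_int n * (4 * (of_nat k + 2))) * A))"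
    by (simp add: deg_op_def rcomm_add rcomm_mult_left assms(2))
  also have "\<dots> = - (sc (1 / (4 * (of_nat k + 2)) * (of_int n * (4 * (of_nat k + 2)))) * A)"
    by (simp only: sc_mult mult_minus_right mult.assoc)
  also have "1 / (4 * (of_nat k + 2)) * (of_int n * (4 * (of_nat k + 2))) = (of_int n :: complex)"
    using nz by (simp add: field_simps)
  finally show "rcomm (deg_op c) A = - (sc (of_int n) * A)" .
qed

lemma has_degree_rcomm:
  assumes "has_degree A m" "has_degree B n"
    and cA: "\<And>a. sc a * A = A * sc a" and cB: "\<And>a. sc a * B = B * sc a"
  shows "has_degree (rcomm A B) (m + n)"
  unfolding has_degree_def
proof
  fix c
  let ?D = "deg_op c" and ?m = "sc (of_int m)" and ?n = "sc (of_int n)"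
  have "rcomm ?D (rcomm A B) = A * rcomm ?D B + rcomm ?D A * B - (B * rcomm ?D A + rcomm ?D B * A)"
    by (simp only: rcomm_def[of A B] rcomm_diff rcomm_mult_right)
  also have "\<dots> = - (A * (?n * B)) - ?m * A * B + B * (?m * A) + ?n * B * A"
    using assms(1,2) by (simp add: has_degree_def)
  also have "A * (?n * B) = ?n * (A * B)"
    by (metis cA mult.assoc)
  also have "B * (?m * A) = ?m * (B * A)"
    by (metis cB mult.assoc)
  also have "- (?n * (A * B)) - ?m * A * B + ?m * (B * A) + ?n * B * A = - ((?m + ?n) * rcomm A B)"
    unfolding rcomm_def distrib_right right_diff_distrib mult.assoc by simp
  finally show "rcomm ?D (rcomm A B) = - (sc (of_int (m + n)) * rcomm A B)"
    by (simp add: sc_add)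
qed

lemma has_degree_half: "has_degree (sc 2 * A) n \<Longrightarrow> has_degree A n"
proof -
  assume *: "has_degree (sc 2 * A) n"
  have half: "sc (1 / 2) * (sc 2 * X) = X" for X
    by (simp add: mult.assoc[symmetric] sc_mult[symmetric] sc_one)
  show "has_degree A n" unfolding has_degree_def
  proof
    fix c
    have "rcomm (deg_op c) (sc 2 * A) = sc 2 * rcomm (deg_op c) A"
      unfolding rcomm_mult_right by (simp add: rcomm_def sc_deg_op)
    moreover have "rcomm (deg_op c) (sc 2 * A) = - (sc 2 * (sc (of_int n) * A))"
      using * unfolding has_degree_def by (metis mult.assoc sc_comm_sc)
    ultimately have "sc 2 * rcomm (deg_op c) A = sc 2 * - (sc (of_int n) * A)" by simp
    then show "rcomm (deg_op c) A = - (sc (of_int n) * A)" by (metis half)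
  qed
qed

text \<open>Degrees add under brackets, so a few modes suffice: \<open>H n\<close> is the bracket of
  \<open>E n\<close> with \<open>F 0\<close>, and brackets with \<open>H 1\<close> and
  \<open>H (- 1)\<close> reach all modes of \<open>E\<close> and \<open>F\<close> step by step from
  mode 0.\<close>

lemma has_degree_EFH: "has_degree (E n) n" "has_degree (F n) n" "has_degree (H n) n"
proof -
  note scs = sc_E sc_F sc_H
  have E0: "has_degree (E 0) 0" "has_degree (F 0) 0"
    by (rule rcomm_deg_op; simp add: sc_E sc_F rcomm_sug_E0 rcomm_sug_F sc_zero)+
  have E1: "has_degree (E 1) 1" "has_degree (E (- 1)) (- 1)"
    by (rule rcomm_deg_op, rule sc_E, simp only: rcomm_sug_E_plus rcomm_sug_E_minus of_int_minus
        of_int_1 mult_minus_left mult_1 sc_minus minus_minus)+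
  have H: "has_degree (H n) n" if "has_degree (E n) n" for n
  proof -
    have "rcomm (E n) (F 0) = H n" using EF[of n 0] by (simp add: rcomm_def sc_zero)
    then show ?thesis using has_degree_rcomm[OF that E0(2)] by (simp add: sc_E sc_F)
  qed
  have E_step: "has_degree (E (n + d)) (n + d)" if "has_degree (E n) n" "has_degree (H d) d" for n d
  proof (rule has_degree_half)
    show "has_degree (sc 2 * E (n + d)) (n + d)"
      using has_degree_rcomm[OF that(2,1)] HE[of d n] by (simp add: rcomm_def sc_E sc_H add.commute)
  qed
  have F_step: "has_degree (F (n + d)) (n + d)" if "has_degree (F n) n" "has_degree (H d) d" for n d
  proof (rule has_degree_half)
    have "rcomm (F n) (H d) = sc 2 * F (n + d)" using HF[of d n] by (simp add: rcomm_def add.commute)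
    then show "has_degree (sc 2 * F (n + d)) (n + d)"
      using has_degree_rcomm[OF that] by (simp add: sc_F sc_H)
  qed
  show E: "has_degree (E n) n" for n
  proof (induction n rule: int_induct[of _ 0])
    case (step1 i) then show ?case using E_step[of i 1] H[OF E1(1)] by simp
  next
    case (step2 i) then show ?case using E_step[of i "- 1"] H[OF E1(2)] by simp
  qed (rule E0)
  show "has_degree (F n) n"
  proof (induction n rule: int_induct[of _ 0])
    case (step1 i) then show ?case using F_step[of i 1] H[OF E1(1)] by simp
  next
    case (step2 i) then show ?case using F_step[of i "- 1"] H[OF E1(2)] by simp
  qed (rule E0)
  show "has_degree (H n) n" by (rule H[OF E])
qed

lemma has_degree_gop: "has_degree (gp g) (snd g)"
  by (cases g; cases "fst g") (auto simp: has_degree_EFH)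

end

section \<open>Irreducible highest weight modules\<close>

lemma proj_in_hom: "proj m s p \<in> hom m s"
  by (auto simp: hom_def in_keys_iff lookup_proj split: if_splits)

lemma sum_proj:
  "(\<Sum>m\<in>size ` Poly_Mapping.keys p. \<Sum>s\<in>sum_mset ` Poly_Mapping.keys p. proj m s p) = p"
proof (rule poly_mapping_eqI)
  fix \<mu>
  let ?K = "Poly_Mapping.keys p"
  have "(\<Sum>m\<in>size ` ?K. \<Sum>s\<in>sum_mset ` ?K. Poly_Mapping.lookup (proj m s p) \<mu>) =
     (\<Sum>m\<in>size ` ?K. if m = size \<mu> then (\<Sum>s\<in>sum_mset ` ?K. if s = sum_mset \<mu> then Poly_Mapping.lookup p \<mu> else 0) else 0)"
    by (intro sum.cong refl) (auto simp: lookup_proj intro!: sum.cong)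
  also have "\<dots> = Poly_Mapping.lookup p \<mu>"
    by (cases "\<mu> \<in> ?K") (auto simp: in_keys_iff)
  finally show "Poly_Mapping.lookup (\<Sum>m\<in>size ` ?K. \<Sum>s\<in>sum_mset ` ?K. proj m s p) \<mu> = Poly_Mapping.lookup p \<mu>"
    by (simp add: lookup_sum)
qed

context sl2_rep
begin

lemma app_sc_sc: "app (sc a) (app (sc b) x) = app (sc (a * b)) x"
  by (simp add: sc_mult)

lemma app_sc_comm: "sc a * A = A * sc a \<Longrightarrow> app A (app (sc a) x) = app (sc a) (app A x)"
  by (metis app_simps(6))

lemma app_sc_eq_0: "app (sc a) x = 0 \<Longrightarrow> a \<noteq> 0 \<Longrightarrow> x = 0"
  using app_sc_sc[of "inverse a" a x] by (simp add: sc_one)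

lemma app_sc_diff: "app (sc (a - b)) x = app (sc a) x - app (sc b) x"
  by (simp add: sc_diff)

lemma eigen_independent:
  assumes "finite A" "inj_on e A" "\<And>a x. app T (app (sc a) x) = app (sc a) (app T x)"
    "\<And>d. d \<in> A \<Longrightarrow> app T (x d) = app (sc (e d)) (x d)" "(\<Sum>d\<in>A. x d) = 0"
  shows "\<forall>d\<in>A. x d = 0"
  using assms(1,2,4,5)
proof (induction A arbitrary: x)
  case (insert a A)
  have 0: "x a + (\<Sum>d\<in>A. x d) = 0" using insert by simp
  have "app (sc (e a)) (x a) + (\<Sum>d\<in>A. app (sc (e d)) (x d)) = app T (x a + (\<Sum>d\<in>A. x d))"
    using insert.prems(2) by (simp add: app_sum)
  also have "\<dots> = 0" unfolding 0 by simp
  also have "0 = app (sc (e a)) (x a + (\<Sum>d\<in>A. x d))" unfolding 0 by simp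
  also have "\<dots> = app (sc (e a)) (x a) + (\<Sum>d\<in>A. app (sc (e a)) (x d))"
    by (simp add: app_sum)
  finally have "(\<Sum>d\<in>A. app (sc (e d - e a)) (x d)) = 0"
    by (simp add: app_sc_diff sum_subtractf)
  then have "\<forall>d\<in>A. app (sc (e d - e a)) (x d) = 0"
    using insert.prems by (intro insert.IH) (auto simp: app_sc_sc mult.commute inj_on_def assms(3))
  moreover have "e d - e a \<noteq> 0" if "d \<in> A" for d
    using insert.hyps(2) insert.prems(1) that by (auto simp: inj_on_def)
  ultimately have "\<forall>d\<in>A. x d = 0" using app_sc_eq_0 by blast
  then show ?case using 0 by simp
qed simp

lemma eigen_component:
  assumes "finite A" "inj_on e A" and T: "\<And>a x. app T (app (sc a) x) = app (sc a) (app T x)"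
    and x: "\<And>d. d \<in> A \<Longrightarrow> app T (x d) = app (sc (e d)) (x d)"
    and w: "app T (\<Sum>d\<in>A. x d) = app (sc c) (\<Sum>d\<in>A. x d)"
  shows "(\<Sum>d\<in>A. x d) = (\<Sum>d\<in>{d\<in>A. e d = c}. x d)"
proof -
  have "(\<Sum>d\<in>A. app (sc (e d - c)) (x d)) = app T (\<Sum>d\<in>A. x d) - app (sc c) (\<Sum>d\<in>A. x d)"
    using x by (simp add: app_sc_diff sum_subtractf app_sum)
  also have "\<dots> = 0" using w by simp
  finally have "\<forall>d\<in>A. app (sc (e d - c)) (x d) = 0"
    using x by (intro eigen_independent[OF assms(1,2) T]) (auto simp: app_sc_sc mult.commute T)
  then have "x d = 0" if "d \<in> A" "e d \<noteq> c" for d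
    using that app_sc_eq_0[of "e d - c" "x d"] by auto
  then show ?thesis by (intro sum.mono_neutral_right assms(1)) auto
qed

end

text \<open>Normalised so that the two simple lowering operators, \<open>F 0\<close> and
  \<open>E (-1)\<close>, have degree 1.\<close>

fun principal_degree :: "gen \<times> int \<Rightarrow> int" where
  "principal_degree (GE, n) = - 2 * n - 1"
| "principal_degree (GF, n) = - 2 * n + 1"
| "principal_degree (GH, n) = - 2 * n"

section \<open>The contravariant functional of an irreducible highest weight module\<close>

locale irr_rep = hw_rep sc E F H k v lam
  for sc :: "complex \<Rightarrow> 'v::ab_group_add aend" and E F H k v lam +
  assumes v_nonzero: "v \<noteq> 0"
    and irreducible: "0 \<in> S \<Longrightarrow> (\<And>a b. a \<in> S \<Longrightarrow> b \<in> S \<Longrightarrow> a + b \<in> S) \<Longrightarrow>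
       (\<And>c a. a \<in> S \<Longrightarrow> app (sc c) a \<in> S) \<Longrightarrow> (\<And>g a. a \<in> S \<Longrightarrow> app (gp g) a \<in> S) \<Longrightarrow>
       S = {0} \<or> S = UNIV"
begin

lemma submodule_with_v:
  assumes "v \<in> S" "\<And>a b. a \<in> S \<Longrightarrow> b \<in> S \<Longrightarrow> a + b \<in> S"
       "\<And>c a. a \<in> S \<Longrightarrow> app (sc c) a \<in> S" "\<And>g a. a \<in> S \<Longrightarrow> app (gp g) a \<in> S"
  shows "S = UNIV"
proof -
  have "0 \<in> S" using assms(3)[OF assms(1), of 0] by (simp add: sc_zero)
  then show ?thesis using irreducible[of S] assms v_nonzero by blast
qed

text \<open>The vectors with this property form a submodule containing \<open>v\<close>, hence
  everything. It is what makes the Sugawara sum locally finite.\<close>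

lemma finally_killed: "\<exists>N\<ge>0. \<forall>g. snd g \<ge> N \<longrightarrow> app (gp g) w = 0"
proof -
  let ?S = "{w. \<exists>N\<ge>0. \<forall>g. snd g \<ge> N \<longrightarrow> app (gp g) w = 0}"
  have "?S = UNIV"
  proof (rule submodule_with_v)
    have "raising g" if "snd g \<ge> 1" for g using that by (cases g) auto
    then show "v \<in> ?S" by (auto intro!: exI[of _ 1] raising_v)
  next
    fix a b assume "a \<in> ?S" "b \<in> ?S"
    then obtain N N' where "N \<ge> 0" "\<forall>g. snd g \<ge> N \<longrightarrow> app (gp g) a = 0" "\<forall>g. snd g \<ge> N' \<longrightarrow> app (gp g) b = 0"
      by blast
    then show "a + b \<in> ?S" by (auto intro!: exI[of _ "max N N'"])
  next
    fix c a assume "a \<in> ?S"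
    then obtain N where "N \<ge> 0" "\<forall>g. snd g \<ge> N \<longrightarrow> app (gp g) a = 0" by blast
    moreover have "app (gp g) (app (sc c) a) = app (sc c) (app (gp g) a)" for g
      by (rule app_sc_comm[OF sc_gop])
    ultimately show "app (sc c) a \<in> ?S" by (auto intro!: exI[of _ N])
  next
    fix t a assume "a \<in> ?S"
    then obtain N where N: "N \<ge> 0" "\<forall>g. snd g \<ge> N \<longrightarrow> app (gp g) a = 0" by blast
    \<comment> \<open>The bound keeps the degree of the bracket at least \<open>N\<close> and makes
      \<open>snd g + snd t\<close> positive, which excludes a central term.\<close>
    have "app (gp g) (app (gp t) a) = 0" if g: "snd g \<ge> N + \<bar>snd t\<bar> + 1" for g
    proof -
      have "snd (br_gen g t) = snd g + snd t"
        by (cases g; cases t; cases "fst g"; cases "fst t") auto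
      then have "snd (br_gen g t) \<ge> N" "snd g \<ge> N" using N(1) g by auto
      then have "app (gp (br_gen g t)) a = 0" "app (gp g) a = 0" using N(2) by blast+
      moreover have "br_central k g t = 0" using g N(1)
        by (cases g; cases t; cases "fst g"; cases "fst t") auto
      ultimately show ?thesis
        using arg_cong[OF gop_bracket[of g t], of "\<lambda>x. app x a"] by (simp add: sc_zero)
    qed
    then show "app (gp t) a \<in> ?S"
      using N(1) by (auto intro!: exI[of _ "N + \<bar>snd t\<bar> + 1"])
  qed
  then show ?thesis by blast
qed

sublocale restricted_rep sc E F H k
proof
  fix w
  obtain N where "\<forall>g. snd g \<ge> N \<longrightarrow> app (gp g) w = 0" using finally_killed by blast
  then show "\<exists>N. \<forall>n\<ge>N. app (E n) w = 0 \<and> app (F n) w = 0 \<and> app (H n) w = 0"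
    by (metis gop.simps snd_conv)
qed

lemma sug_v: "app sug v = app (sc (lam * (lam + 2))) v"
proof -
  have "app (sug_term (int j + 1)) v = 0" for j
    by (simp add: sug_term_def E_v F_v H_v)
  then have "app (lsum (\<lambda>j::nat. sug_term (int j + 1))) v = 0"
    by (simp add: app_lsum loc_fin_sug)
  moreover have "app (E 0 * F 0) v = app (H 0) v"
    using E_v[of 0] by (subst EF) (simp add: sc_zero)
  moreover have "app (H 0) (app (H 0) v) = app (sc (lam * lam)) v"
    by (simp add: H0_v app_sc_comm[OF sc_H] app_sc_sc)
  ultimately show ?thesis
    using E_v[of 0] by (simp add: sug_def H0_v distrib_left sc_add sc_mult mult.commute[of lam 2])
qed

lemma deg_op_v: "app (deg_op c) v = app (sc (lam * (lam + 2) / (4 * (of_nat k + 2)) + c)) v"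
  by (simp add: deg_op_def sug_v app_sc_sc sc_add)

lemma deg_op_gop: "app (deg_op c) (app (gp g) w) =
    app (gp g) (app (deg_op c) w) - app (sc (of_int (snd g))) (app (gp g) w)"
  using arg_cong[OF has_degree_gop[of g, unfolded has_degree_def, rule_format, of c], of "\<lambda>x. app x w"]
  by (simp add: rcomm_def algebra_simps)

text \<open>The principal grading: all lowering operators have positive degree, so that \<open>v\<close> is separated
  from the image of the lowering operators by a single operator.\<close>

definition pgrad :: "'v aend" where
  "pgrad = sc 2 * deg_op 0 - sc (1 / 2) * H 0"

lemma pgrad_sc: "app pgrad (app (sc a) w) = app (sc a) (app pgrad w)"
  by (simp add: pgrad_def app_sc_comm[OF sc_deg_op] app_sc_comm[OF sc_H] app_sc_sc mult.commute)

lemma pgrad_gop: "app pgrad (app (gp g) w) =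
    app (gp g) (app pgrad w) + app (sc (of_int (principal_degree g))) (app (gp g) w)"
proof -
  obtain x n where g: "g = (x, n)" by (cases g)
  define e :: complex where "e = (case x of GE \<Rightarrow> 2 | GF \<Rightarrow> -2 | GH \<Rightarrow> 0)"
  have *: "H 0 * gp g = gp g * H 0 + sc e * gp g"
    using HE[of 0 n] HF[of 0 n] HH[of 0 n]
    by (cases x) (simp_all add: g e_def sc_minus sc_zero)
  have "app (H 0) (app (gp g) w) = app (H 0 * gp g) w" by simp
  also have "\<dots> = app (gp g) (app (H 0) w) + app (sc e) (app (gp g) w)"
    unfolding * by simp
  finally have H: "app (H 0) (app (gp g) w) = app (gp g) (app (H 0) w) + app (sc e) (app (gp g) w)" .
  have "app pgrad (app (gp g) w) =
      app (sc 2) (app (gp g) (app (deg_op 0) w) - app (sc (of_int n)) (app (gp g) w))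
      - app (sc (1 / 2)) (app (gp g) (app (H 0) w) + app (sc e) (app (gp g) w))"
    unfolding pgrad_def app_simps H deg_op_gop by (simp add: g)
  also have "\<dots> = app (gp g) (app pgrad w)
      + (app (sc (- (2 * of_int n))) (app (gp g) w) - app (sc (1 / 2 * e)) (app (gp g) w))"
    unfolding pgrad_def app_simps app_add app_diff app_sc_sc app_sc_comm[OF sc_gop] sc_minus by simp
  finally have "app pgrad (app (gp g) w) = app (gp g) (app pgrad w)
      + (app (sc (- (2 * of_int n))) (app (gp g) w) - app (sc (1 / 2 * e)) (app (gp g) w))" .
  also have "app (sc (- (2 * of_int n))) (app (gp g) w) - app (sc (1 / 2 * e)) (app (gp g) w)
      = app (sc (- (2 * of_int n) - 1 / 2 * e)) (app (gp g) w)"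
    by (simp only: app_sc_diff)
  also have "- (2 * of_int n) - 1 / 2 * e = of_int (principal_degree g)"
    by (cases x) (simp_all add: g e_def)
  finally show ?thesis .
qed

definition p0 :: complex where
  "p0 = 2 * (lam * (lam + 2) / (4 * (of_nat k + 2))) - 1 / 2 * lam"

lemma pgrad_v: "app pgrad v = app (sc p0) v"
  by (simp add: pgrad_def deg_op_v H0_v p0_def sc_diff sc_mult app_sc_sc)

text \<open>Described by eigenvalues of \<open>pgrad\<close> rather than as the image of the
  lowering operators, so that \<open>v\<close> can be excluded by its eigenvalue alone.\<close>

inductive_set pos_part :: "'v set" where
  pos_zero: "0 \<in> pos_part"
| pos_add: "a \<in> pos_part \<Longrightarrow> app pgrad b = app (sc (p0 + of_nat (Suc d))) b \<Longrightarrow> a + b \<in> pos_part"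

lemma pos_part_add: "b \<in> pos_part \<Longrightarrow> a \<in> pos_part \<Longrightarrow> a + b \<in> pos_part"
proof (induction rule: pos_part.induct)
  case (pos_add b c d)
  then show ?case using pos_part.pos_add[of "a + b" c d] by (simp add: add.assoc)
qed simp

lemma pos_part_sc: "a \<in> pos_part \<Longrightarrow> app (sc c) a \<in> pos_part"
proof (induction rule: pos_part.induct)
  case (pos_add a b d)
  have "app pgrad (app (sc c) b) = app (sc (p0 + of_nat (Suc d))) (app (sc c) b)"
    by (simp only: pgrad_sc pos_add.hyps app_sc_sc mult.commute)
  then show ?case using pos_part.pos_add[OF pos_add.IH] by simp
qed (simp add: pos_zero)

lemma pgrad_lower:
  assumes "lowering t" "app pgrad b = app (sc (p0 + of_nat d)) b"
  shows "\<exists>d'. app pgrad (app (gp t) b) = app (sc (p0 + of_nat (Suc d'))) (app (gp t) b)"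
proof -
  have "principal_degree t \<ge> 1" using assms(1) by (cases t; cases "fst t") auto
  define d' where "d' = nat (principal_degree t - 1)"
  then have d': "principal_degree t = int (Suc d')" using \<open>principal_degree t \<ge> 1\<close> by simp
  have "app pgrad (app (gp t) b) =
      app (sc (p0 + of_nat d)) (app (gp t) b) + app (sc (of_int (principal_degree t))) (app (gp t) b)"
    by (simp only: pgrad_gop assms(2) app_sc_comm[OF sc_gop])
  also have "\<dots> = app (sc (p0 + of_nat d + of_int (principal_degree t))) (app (gp t) b)"
    by (simp only: sc_add[of "p0 + of_nat d"] app_simps)
  also have "p0 + of_nat d + of_int (principal_degree t) = p0 + of_nat (Suc (d + d'))"
    by (simp add: d')
  finally show ?thesis by blast
qed

lemma pos_part_lower: "a \<in> pos_part \<Longrightarrow> lowering t \<Longrightarrow> app (gp t) a \<in> pos_part"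
proof (induction rule: pos_part.induct)
  case (pos_add a b d)
  obtain d' where "app pgrad (app (gp t) b) = app (sc (p0 + of_nat (Suc d'))) (app (gp t) b)"
    using pgrad_lower[OF pos_add.prems pos_add.hyps(2)] by blast
  from pos_part.pos_add[OF pos_add.IH[OF pos_add.prems] this] show ?case by simp
qed (simp add: pos_zero)

lemma lower_v_pos: "lowering t \<Longrightarrow> app (gp t) v \<in> pos_part"
proof -
  assume t: "lowering t"
  have "app pgrad v = app (sc (p0 + of_nat 0)) v" by (simp add: pgrad_v)
  from pgrad_lower[OF t this] obtain d' where
    "app pgrad (app (gp t) v) = app (sc (p0 + of_nat (Suc d'))) (app (gp t) v)" by blast
  from pos_part.pos_add[OF pos_zero this] show ?thesis by simp
qed

text \<open>A product of factors \<open>pgrad - sc (p0 + d)\<close> with non-zero \<open>d\<close>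
  kills a given element of \<open>pos_part\<close>, but acts on \<open>v\<close> by a non-zero
  scalar.\<close>

lemma v_not_pos: "app (sc c) v \<in> pos_part \<Longrightarrow> c = 0"
proof -
  let ?P = "\<lambda>ds. prod_list (map (\<lambda>d. pgrad - sc (p0 + d)) ds)"
  have eig: "\<exists>e. app (?P ds) b = app (sc e) b \<and> (x \<notin> set ds \<longrightarrow> e \<noteq> 0)"
    if "app pgrad b = app (sc (p0 + x)) b" for ds b x
  proof (induction ds)
    case Nil
    then show ?case by (intro exI[of _ 1]) (simp add: sc_one)
  next
    case (Cons d ds)
    then obtain e where e: "app (?P ds) b = app (sc e) b" "x \<notin> set ds \<longrightarrow> e \<noteq> 0" by blast
    have "app (?P (d # ds)) b = app (sc e) (app pgrad b) - app (sc (p0 + d)) (app (sc e) b)"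
      by (simp add: e pgrad_sc)
    also have "\<dots> = app (sc (e * (p0 + x) - (p0 + d) * e)) b"
      by (simp only: that app_sc_sc app_sc_diff)
    finally show ?case using e(2)
      by (intro exI[of _ "e * (p0 + x) - (p0 + d) * e"]) (auto simp: algebra_simps)
  qed
  have kill: "\<exists>ds. 0 \<notin> set ds \<and> app (?P ds) a = 0" if "a \<in> pos_part" for a
    using that
  proof (induction rule: pos_part.induct)
    case pos_zero
    then show ?case by (intro exI[of _ "[]"]) simp
  next
    case (pos_add a b d)
    then obtain ds where ds: "0 \<notin> set ds" "app (?P ds) a = 0" by blast
    obtain e where e: "app (?P ds) b = app (sc e) b" using eig[OF pos_add.hyps(2)] by blast
    have "app (pgrad - sc (p0 + of_nat (Suc d))) (app (sc e) b) = 0"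
      by (simp only: app_simps pgrad_sc pos_add.hyps(2) app_sc_sc mult.commute diff_self)
    then have "app (?P (of_nat (Suc d) # ds)) (a + b) = 0" using ds e by simp
    moreover have "0 \<notin> set (of_nat (Suc d) # ds :: complex list)" using ds(1) by (simp del: of_nat_Suc)
    ultimately show ?case by blast
  qed
  assume "app (sc c) v \<in> pos_part"
  then obtain ds where ds: "0 \<notin> set ds" "app (?P ds) (app (sc c) v) = 0" using kill by blast
  have "app pgrad (app (sc c) v) = app (sc (p0 + 0)) (app (sc c) v)"
    by (simp add: pgrad_sc pgrad_v app_sc_sc mult.commute)
  from eig[OF this, of ds] ds obtain e where "app (sc e) (app (sc c) v) = 0" "e \<noteq> 0" by auto
  then have "app (sc c) v = 0" using app_sc_eq_0 by blast
  then show "c = 0" using app_sc_eq_0 v_nonzero by blast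
qed

text \<open>Comparing the module with itself, \<open>graph\<close> is the diagonal and exhibits
  every vector as obtained from \<open>v\<close> by sums, scalars and lowering operators; the latter
  lead into \<open>pos_part\<close>.\<close>

lemma decompose: "\<exists>c. w - app (sc c) v \<in> pos_part"
proof -
  interpret two_hw sc E F H v sc E F H v k lam ..
  have "graph w w" for w
  proof -
    have "{w. graph w w} = UNIV"
      by (rule submodule_with_v) (auto intro: graph.intros graph_gop)
    then show ?thesis by blast
  qed
  moreover have "\<exists>c. a - app (sc c) v \<in> pos_part" if "graph a b" for a b
    using that
  proof (induction rule: graph.induct)
    case base
    then show ?case by (intro exI[of _ 1]) (simp add: sc_one pos_zero)
  next
    case (add a1 a2 b1 b2)
    then obtain c c' where "a1 - app (sc c) v \<in> pos_part" "b1 - app (sc c') v \<in> pos_part" by blast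
    from pos_part_add[OF this(2,1)] show ?case
      by (intro exI[of _ "c + c'"]) (simp add: sc_add algebra_simps)
  next
    case (sc a1 a2 c)
    then obtain c' where "a1 - app (sc c') v \<in> pos_part" by blast
    from pos_part_sc[OF this, of c] show ?case
      by (intro exI[of _ "c * c'"]) (simp add: app_sc_sc)
  next
    case (lower a1 a2 t)
    then obtain c where "a1 - app (sc c) v \<in> pos_part" by blast
    from pos_part_lower[OF this lower.hyps(2)]
    have "app (gp t) a1 - app (gp t) (app (sc c) v) \<in> pos_part" by simp
    moreover have "app (gp t) (app (sc c) v) = app (sc c) (app (gp t) v)"
      by (rule app_sc_comm[OF sc_gop])
    then have "app (gp t) (app (sc c) v) \<in> pos_part"
      using pos_part_sc[OF lower_v_pos[OF lower.hyps(2)]] by simp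
    ultimately have "app (gp t) a1 \<in> pos_part"
      using pos_part_add[of "app (gp t) (app (sc c) v)"] by fastforce
    then show ?case by (intro exI[of _ 0]) (simp add: sc_zero)
  qed
  ultimately show ?thesis by blast
qed

definition coord :: "'v \<Rightarrow> complex" where
  "coord w = (THE c. w - app (sc c) v \<in> pos_part)"

lemma coord_eqI: "w - app (sc c) v \<in> pos_part \<Longrightarrow> coord w = c"
proof -
  assume c: "w - app (sc c) v \<in> pos_part"
  have "c' = c" if "w - app (sc c') v \<in> pos_part" for c'
  proof -
    have "(w - app (sc c) v) + app (sc (- 1)) (w - app (sc c') v) \<in> pos_part"
      using pos_part_add[OF pos_part_sc[OF that] c] .
    also have "(w - app (sc c) v) + app (sc (- 1)) (w - app (sc c') v) = app (sc (c' - c)) v"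
      by (simp add: sc_minus sc_one sc_diff)
    finally show ?thesis using v_not_pos by fastforce
  qed
  then show ?thesis unfolding coord_def using c by (intro the_equality)
qed

lemma coord_mem: "w - app (sc (coord w)) v \<in> pos_part"
  using decompose[of w] coord_eqI by metis

lemma coord_add: "coord (a + b) = coord a + coord b"
  using pos_part_add[OF coord_mem[of b] coord_mem[of a]]
  by (intro coord_eqI) (simp add: sc_add algebra_simps)

lemma coord_sc: "coord (app (sc c) a) = c * coord a"
  using pos_part_sc[OF coord_mem[of a], of c] by (intro coord_eqI) (simp add: app_sc_sc)

lemma coord_v: "coord v = 1"
  by (rule coord_eqI) (simp add: sc_one pos_zero)

text \<open>The vectors whose descendants all have coordinate 0 form a submodule that does not
  contain \<open>v\<close>, hence the zero submodule by irreducibility.\<close>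

sublocale faithful_hw sc E F H k v lam coord
proof
  fix g a assume g: "lowering g"
  have *: "app (gp g) (app (sc c) v) = app (sc c) (app (gp g) v)" for c
    by (rule app_sc_comm[OF sc_gop])
  have "app (gp g) (a - app (sc (coord a)) v) + app (sc (coord a)) (app (gp g) v) \<in> pos_part"
    by (intro pos_part_add pos_part_sc lower_v_pos pos_part_lower coord_mem g)
  then show "coord (app (gp g) a) = 0"
    by (intro coord_eqI) (simp add: * sc_zero)
next
  have z: "coord 0 = 0" using coord_add[of 0 0] by simp
  let ?W = "\<lambda>gs. prod_list (map gp gs)"
  let ?S = "{a. \<forall>gs. coord (app (?W gs) a) = 0}"
  have comm: "app (?W gs) (app (sc c) a) = app (sc c) (app (?W gs) a)" for gs c a
  proof (induction gs)
    case (Cons g gs)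
    then show ?case by (simp add: app_sc_comm[OF sc_gop])
  qed simp
  have "?S = {0} \<or> ?S = UNIV"
  proof (rule irreducible)
    fix g a assume a: "a \<in> ?S"
    have "coord (app (?W gs) (app (gp g) a)) = 0" for gs
      using a[unfolded mem_Collect_eq, rule_format, of "gs @ [g]"] by simp
    then show "app (gp g) a \<in> ?S" by simp
  qed (auto simp: z coord_add comm coord_sc)
  moreover have "v \<notin> ?S" using coord_v by (auto intro!: exI[of _ "[]"])
  ultimately have S: "?S = {0}" by blast
  fix a assume "a \<in> cyc v" "\<And>gs. coord (app (?W gs) a) = 0"
  then have "a \<in> ?S" by simp
  then show "a = 0" using S by blast
qed (fact coord_add coord_sc coord_v)+

section \<open>The bigrading by charge and weight\<close>

lemma ev_sum: "ev (sum f A) = (\<Sum>a\<in>A. ev (f a))"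
  by (rule pe.peval_sum)

text \<open>Each factor \<open>var n\<close> raises the eigenvalue by \<open>a + b n\<close>. This
  covers both gradings: \<open>a = 2\<close>, \<open>b = 0\<close> for \<open>H 0\<close> and
  \<open>a = b = 1\<close> for \<open>deg_op\<close>.\<close>

lemma ev_hom_eigen:
  assumes T: "\<And>a. sc a * T = T * sc a" "app T v = app (sc h) v"
    and E: "\<And>n y. app T (app (E (- int n - 1)) y) =
        app (E (- int n - 1)) (app T y) + app (sc (a + b * of_nat n)) (app (E (- int n - 1)) y)"
  shows "p \<in> hom m s \<Longrightarrow> app T (app (ev p) v) = app (sc (h + a * of_nat m + b * of_nat s)) (app (ev p) v)"
proof (induction rule: hom_induct)
  case (add p \<mu> c)
  let ?X = "mmon (\<lambda>m. E (- int m - 1))"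
  have "app T (app (?X \<mu>) v) = app (sc (h + a * of_nat (size \<mu>) + b * of_nat (sum_mset \<mu>))) (app (?X \<mu>) v)"
  proof (induction \<mu>)
    case empty
    then show ?case by (simp add: T(2))
  next
    case (add n \<mu>)
    let ?e = "E (- int n - 1)" and ?y = "app (?X \<mu>) v" and ?h = "h + a * of_nat (size \<mu>) + b * of_nat (sum_mset \<mu>)"
    have "app T (app ?e ?y) = app (sc ?h) (app ?e ?y) + app (sc (a + b * of_nat n)) (app ?e ?y)"
      by (simp only: E add.IH app_sc_comm[OF sc_E])
    also have "\<dots> = app (sc (?h + (a + b * of_nat n))) (app ?e ?y)"
      by (simp only: sc_add[of ?h] app_simps)
    finally show ?case by (simp add: pe.mmon_add_mset algebra_simps)
  qed
  then have "app T (app (sc c * ?X \<mu>) v) = app (sc (h + a * of_nat m + b * of_nat s)) (app (sc c * ?X \<mu>) v)"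
    using add.hyps by (simp add: app_sc_comm[OF T(1)] app_sc_sc mult.commute)
  then show ?case using add.IH by (simp add: pe.peval_add pe.peval_single)
qed simp

lemma H0_ev_hom:
  assumes "p \<in> hom m s"
  shows "app (H 0) (app (ev p) v) = app (sc (lam + 2 * of_nat m)) (app (ev p) v)"
proof -
  have "app (H 0) (app (E n) y) = app (E n) (app (H 0) y) + app (sc 2) (app (E n) y)" for n y
    using arg_cong[OF HE[of 0 n], of "\<lambda>x. app x y"] by simp
  then show ?thesis using ev_hom_eigen[OF sc_H H0_v _ assms, where a = 2 and b = 0] by simp
qed

lemma deg_op_ev_hom:
  assumes "app (deg_op c) v = app (sc h) v" "p \<in> hom m s"
  shows "app (deg_op c) (app (ev p) v) = app (sc (h + of_nat (m + s))) (app (ev p) v)"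
proof -
  have "app (deg_op c) (app (E (- int n - 1)) y) =
      app (E (- int n - 1)) (app (deg_op c) y) + app (sc (1 + 1 * of_nat n)) (app (E (- int n - 1)) y)" for n y
    using deg_op_gop[of c "(GE, - int n - 1)" y] by (simp add: sc_add sc_minus sc_diff sc_one)
  from ev_hom_eigen[OF sc_deg_op assms(1) this assms(2)] show ?thesis by (simp add: add.assoc)
qed

text \<open>Homogeneous components are joint eigenvectors with distinct pairs of eigenvalues, so
  only the one of charge \<open>m\<close> and weight \<open>n\<close> survives. Weight is
  \<open>m + s\<close>, whence \<open>s = n - m\<close>, and nothing survives if
  \<open>n < m\<close>.\<close>

lemma bigraded_component:
  assumes D: "app (deg_op c) v = app (sc h) v"
    and H: "app (H 0) (app (ev p) v) = app (sc (lam + 2 * of_nat m)) (app (ev p) v)"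
    and deg: "app (deg_op c) (app (ev p) v) = app (sc (h + of_nat n)) (app (ev p) v)"
  shows "app (ev p) v \<in> (\<lambda>q. app (ev q) v) ` (if m \<le> n then hom m (n - m) else {0})"
proof -
  define A B where "A = size ` Poly_Mapping.keys p" and "B = (sum_mset ` Poly_Mapping.keys p :: nat set)"
  have fin: "finite A" "finite B" by (auto simp: A_def B_def)
  let ?w = "app (ev p) v"
  define x where "x m s = app (ev (proj m s p)) v" for m s
  have w: "?w = (\<Sum>m\<in>A. \<Sum>s\<in>B. x m s)"
    unfolding x_def app_sum_left[symmetric] ev_sum[symmetric] A_def B_def sum_proj ..
  have eH: "app (H 0) (x m s) = app (sc (lam + 2 * of_nat m)) (x m s)" for m s
    unfolding x_def by (rule H0_ev_hom[OF proj_in_hom])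
  have eD: "app (deg_op c) (x m s) = app (sc (h + of_nat (m + s))) (x m s)" for m s
    unfolding x_def by (rule deg_op_ev_hom[OF D proj_in_hom])
  have "?w = (\<Sum>m'\<in>{m'\<in>A. lam + 2 * of_nat m' = lam + 2 * of_nat m}. \<Sum>s\<in>B. x m' s)"
    unfolding w
  proof (rule eigen_component[where T = "H 0", OF fin(1)])
    show "app (H 0) (app (sc a) y) = app (sc a) (app (H 0) y)" for a y
      by (rule app_sc_comm[OF sc_H])
    show "app (H 0) (\<Sum>m\<in>A. \<Sum>s\<in>B. x m s) = app (sc (lam + 2 * of_nat m)) (\<Sum>m\<in>A. \<Sum>s\<in>B. x m s)"
      unfolding w[symmetric] by (rule H)
  qed (auto simp: inj_on_def app_sum eH)
  also have "{m'\<in>A. lam + 2 * of_nat m' = lam + 2 * of_nat m} = (if m \<in> A then {m} else {})"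
    by auto
  finally have w1: "?w = (if m \<in> A then \<Sum>s\<in>B. x m s else 0)" by simp
  show ?thesis
  proof (cases "m \<in> A")
    case True
    then have w2: "?w = (\<Sum>s\<in>B. x m s)" using w1 by simp
    have "?w = (\<Sum>s\<in>{s\<in>B. h + of_nat (m + s) = h + of_nat n}. x m s)"
      unfolding w2
    proof (rule eigen_component[where T = "deg_op c", OF fin(2)])
      show "app (deg_op c) (app (sc a) y) = app (sc a) (app (deg_op c) y)" for a y
        by (rule app_sc_comm[OF sc_deg_op])
      show "app (deg_op c) (\<Sum>s\<in>B. x m s) = app (sc (h + of_nat n)) (\<Sum>s\<in>B. x m s)"
        unfolding w2[symmetric] by (rule deg)
    qed (auto simp: inj_on_def eD simp del: of_nat_add)
    also have "{s\<in>B. h + of_nat (m + s) = h + of_nat n} = (if m \<le> n \<and> n - m \<in> B then {n - m} else {})"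
      by (auto simp del: of_nat_add)
    finally have "?w = (if m \<le> n \<and> n - m \<in> B then x m (n - m) else 0)" by simp
    moreover have "x m (n - m) \<in> (\<lambda>q. app (ev q) v) ` hom m (n - m)"
      unfolding x_def by (rule imageI[OF proj_in_hom])
    moreover have "0 \<in> (\<lambda>q. app (ev q) v) ` (if m \<le> n then hom m (n - m) else {0})"
      by (rule image_eqI[of _ _ 0]) auto
    ultimately show ?thesis by (auto split: if_splits)
  next
    case False
    then have "?w = 0" using w1 by simp
    then show ?thesis by (intro image_eqI[of _ _ 0]) auto
  qed
qed

end

section \<open>Dimension count\<close>

text \<open>A basis of the kernel is extended to a basis of \<open>S\<close>; the map is injective
  on the span of the added vectors. The ambient space may have infinite dimension, so finiteness
  comes from \<open>T\<close>.\<close>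

lemma (in Vector_Spaces.linear) rank_nullity:
  assumes S: "vs1.subspace S" and fin: "finite T" "S \<subseteq> vs1.span T"
  shows "vs2.dim (f ` S) + vs1.dim (S \<inter> {x. f x = 0}) = vs1.dim S"
proof -
  let ?K = "S \<inter> {x. f x = 0}"
  obtain A where A: "A \<subseteq> ?K" "vs1.independent A" "?K \<subseteq> vs1.span A"
    using vs1.maximal_independent_subset[of ?K] by blast
  have AS: "A \<subseteq> S" using A(1) by blast
  obtain C where C: "A \<subseteq> C" "C \<subseteq> S" "vs1.independent C" "S \<subseteq> vs1.span C"
    using vs1.maximal_independent_subset_extend[OF AS A(2)] by blast
  have finC: "finite C"
    using vs1.independent_span_bound[OF fin(1) C(3)] C(2) fin(2) by blast
  have inj: "inj_on f (vs1.span (C - A))"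
    unfolding inj_on_iff_eq_0[OF vs1.subspace_span]
  proof (intro ballI impI)
    fix x assume x: "x \<in> vs1.span (C - A)" "f x = 0"
    have "vs1.span (C - A) \<subseteq> S" using C(2) by (intro vs1.span_minimal[OF _ S]) blast
    then have xA: "x \<in> vs1.span A" using x A(3) by blast
    have 1: "vs1.representation C x = vs1.representation (C - A) x"
      by (rule vs1.representation_extend[OF C(3) x(1)]) blast
    have 2: "vs1.representation C x = vs1.representation A x"
      by (rule vs1.representation_extend[OF C(3) xA C(1)])
    have z: "vs1.representation A x b = 0" for b
      using vs1.representation_ne_zero[of "C - A" x b] vs1.representation_ne_zero[of A x b] 1 2 by fastforce
    have "(\<Sum>b | vs1.representation A x b \<noteq> 0. s1 (vs1.representation A x b) b) = x"
      by (rule vs1.sum_nonzero_representation_eq[OF A(2) xA])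
    then show "x = 0" by (simp add: z)
  qed
  have "vs1.independent (C - A)" by (rule vs1.independent_mono[OF C(3)]) blast
  then have ind: "vs2.independent (f ` (C - A))"
    using independent_injective_image inj by blast
  have "f ` S \<subseteq> vs2.span (f ` (C - A))"
  proof -
    have "f ` S \<subseteq> vs2.span (f ` C)" using C(4) span_image[of C] by blast
    moreover have "f ` C \<subseteq> insert 0 (f ` (C - A))" using A(1) by blast
    then have "vs2.span (f ` C) \<subseteq> vs2.span (f ` (C - A))"
      using vs2.span_mono vs2.span_insert_0 by metis
    ultimately show ?thesis by blast
  qed
  moreover have "f ` (C - A) \<subseteq> f ` S" using C(2) by blast
  ultimately have "vs2.dim (f ` S) = card (f ` (C - A))"
    using ind by (intro vs2.dim_unique) auto
  also have "\<dots> = card (C - A)"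
    by (intro card_image inj_on_subset[OF inj] vs1.span_superset)
  also have "\<dots> = card C - card A"
    using C(1) finC by (simp add: card_Diff_subset finite_subset)
  finally have "vs2.dim (f ` S) = card C - card A" .
  moreover have "vs1.dim S = card C" using C by (intro vs1.dim_unique) auto
  moreover have "vs1.dim ?K = card A" using A by (intro vs1.dim_unique) auto
  moreover have "card A \<le> card C" using C(1) finC by (rule card_mono[rotated])
  ultimately show ?thesis by simp
qed

definition pscale :: "complex \<Rightarrow> mpoly \<Rightarrow> mpoly" where
  "pscale c p = cst c * p"

interpretation pvs: vector_space pscale
  by standard (simp_all add: pscale_def distrib_left distrib_right mult.assoc)

lemma pscale_hom: "p \<in> hom m s \<Longrightarrow> pscale c p \<in> hom m s"
  using hom_mult[of "cst c" 0 0 p m s] hom_single[of "{#}" 0 0 c] by (simp add: pscale_def cst_def)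

lemma subspace_hom: "pvs.subspace (hom m s)"
  by (simp add: pvs.subspace_def hom_add pscale_hom)

lemma finite_hom_basis: "finite (pmon ` {\<mu>. size \<mu> = m \<and> sum_mset \<mu> = s})"
proof -
  have "{\<mu>. size \<mu> = m \<and> sum_mset \<mu> = s} \<subseteq> mset ` {xs. set xs \<subseteq> {..s} \<and> length xs = m}"
  proof
    fix \<mu> :: "nat multiset" assume \<mu>: "\<mu> \<in> {\<mu>. size \<mu> = m \<and> sum_mset \<mu> = s}"
    obtain xs where xs: "\<mu> = mset xs" by (metis ex_mset)
    have "n \<le> s" if "n \<in># \<mu>" for n
      using \<mu> that by (auto dest!: multi_member_split)
    then show "\<mu> \<in> mset ` {xs. set xs \<subseteq> {..s} \<and> length xs = m}"
      using \<mu> xs by (intro image_eqI[of _ _ xs]) auto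
  qed
  then have "finite {\<mu>. size \<mu> = m \<and> sum_mset \<mu> = s}"
    by (rule finite_subset) (intro finite_imageI finite_lists_length_eq finite_atMost)
  then show ?thesis by simp
qed

lemma hom_span: "hom m s \<subseteq> pvs.span (pmon ` {\<mu>. size \<mu> = m \<and> sum_mset \<mu> = s})"
proof
  fix p assume "p \<in> hom m s"
  then show "p \<in> pvs.span (pmon ` {\<mu>. size \<mu> = m \<and> sum_mset \<mu> = s})"
  proof (induction rule: hom_induct)
    case (add p \<mu> c)
    then have "pscale c (pmon \<mu>) \<in> pvs.span (pmon ` {\<mu>. size \<mu> = m \<and> sum_mset \<mu> = s})"
      by (intro pvs.span_scale pvs.span_base) auto
    moreover have "Poly_Mapping.single \<mu> c = pscale c (pmon \<mu>)"
      by (simp only: pscale_def single_eq_cst_pmon)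
    ultimately show ?case using pvs.span_add[OF add.IH] by simp
  qed (rule pvs.span_zero)
qed

context sl2_rep
begin

lemma sc_vector_space: "vector_space (\<lambda>c. app (sc c))"
  by standard (simp_all add: sc_add sc_mult sc_one)

lemma ev_linear: "Vector_Spaces.linear pscale (\<lambda>c. app (sc c)) (\<lambda>p. app (ev p) v)"
  unfolding Vector_Spaces.linear_iff
  using sc_vector_space pvs.vector_space_axioms
  by (simp add: pe.peval_add pe.peval_mult pscale_def)

lemma dim_ev_hom:
  "vector_space.dim (\<lambda>c. app (sc c)) ((\<lambda>p. app (ev p) v) ` hom m s)
    + pvs.dim (hom m s \<inter> {p. app (ev p) v = 0}) = pvs.dim (hom m s)"
  by (rule linear.rank_nullity[OF ev_linear subspace_hom finite_hom_basis hom_span])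

end

section \<open>Dimensions of the bigraded pieces and their recursion\<close>

context fock_level
begin

text \<open>The dimension of the bidegree \<open>(m, s)\<close> piece of P/I_i.\<close>

definition rk :: "nat \<Rightarrow> nat \<Rightarrow> nat \<Rightarrow> nat" where
  "rk i m s = pvs.dim (hom m s) - pvs.dim (hom m s \<inter> ann k i)"

lemma ann_alt: "ann k i = {p. app (ev p) (fvac k i) = 0}"
  by (simp add: ann_def)

lemma rk_add: "rk i m s + pvs.dim (hom m s \<inter> ann k i) = pvs.dim (hom m s)"
  using dim_ev_hom[of "fvac k i" m s] by (simp add: rk_def ann_alt)

text \<open>By \<open>shift_in_ann_iff\<close> the kernel of the map is the annihilator for
  \<open>k - i\<close>: the injectivity in the exact sequence.\<close>

lemma rk_shift:
  assumes "i \<le> k"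
  shows "vector_space.dim (\<lambda>c. app (fsc c))
     ((\<lambda>p. app (ev (var 0 ^ i * shift_vars p)) (fvac k i)) ` hom m s) = rk (k - i) m s"
proof -
  let ?g = "\<lambda>p. app (ev (var 0 ^ i * shift_vars p)) (fvac k i)"
  have "Vector_Spaces.linear pscale (\<lambda>c. app (fsc c)) ?g"
    unfolding Vector_Spaces.linear_iff
    using sc_vector_space pvs.vector_space_axioms
    by (simp add: pe.peval_add pe.peval_mult pscale_def shift_vars_simps distrib_left mult.left_commute[of _ "cst _"])
  from linear.rank_nullity[OF this subspace_hom finite_hom_basis hom_span, of m s]
  have "vector_space.dim (\<lambda>c. app (fsc c)) (?g ` hom m s) + pvs.dim (hom m s \<inter> {p. ?g p = 0}) = pvs.dim (hom m s)" .
  moreover have "{p. ?g p = 0} = ann k (k - i)"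
    using shift_in_ann_iff[OF assms] by (auto simp: ann_alt)
  ultimately show ?thesis using rk_add[of "k - i" m s] by simp
qed

text \<open>Exactness in the middle: inside P/I_i, the image of I_(i-1) is that of the
  multiplication map. For \<open>i = 0\<close> the whole polynomial ring takes the place of I_(i-1),
  so both recursions are served.\<close>

lemma image_shift:
  assumes i: "i \<le> k" and A: "A = (if i = 0 then hom m s else hom m s \<inter> ann k (i - 1))"
  shows "(\<lambda>p. app (ev p) (fvac k i)) ` A =
    (\<lambda>p. app (ev (var 0 ^ i * shift_vars p)) (fvac k i)) `
      (if i \<le> m \<and> m - i \<le> s then hom (m - i) (s - (m - i)) else {0})"
    (is "?f ` A = ?g ` ?B")
proof
  show "?f ` A \<subseteq> ?g ` ?B"
  proof
    fix y assume "y \<in> ?f ` A"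
    then obtain p where p: "p \<in> A" "y = ?f p" by blast
    then have "p \<in> hom m s" "i = 0 \<or> p \<in> ann k (i - 1)" using A by (auto split: if_splits)
    then obtain p' where p': "p' \<in> hom (m - i) (s - (m - i))" "p' = 0 \<or> (i \<le> m \<and> m - i \<le> s)"
      "p - var 0 ^ i * shift_vars p' \<in> ann k i"
      using ann_decomposition[OF i] by blast
    have "?f p = ?g p'" using p'(3) by (simp add: ann_alt pe.peval_diff)
    then show "y \<in> ?g ` ?B" using p(2) p'(1,2) by auto
  qed
  show "?g ` ?B \<subseteq> ?f ` A"
  proof
    fix y assume "y \<in> ?g ` ?B"
    then obtain p where p: "p \<in> ?B" "y = ?f (var 0 ^ i * shift_vars p)" by blast
    have "var 0 ^ i * shift_vars p \<in> hom m s"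
    proof (cases "i \<le> m \<and> m - i \<le> s")
      case True
      have "var 0 ^ i \<in> hom (i * 1) (i * 0)" by (intro hom_power hom_var)
      moreover have "shift_vars p \<in> hom (m - i) (s - (m - i) + (m - i))"
        using p(1) True by (intro hom_shift_vars) simp
      ultimately have "var 0 ^ i * shift_vars p \<in> hom (i * 1 + (m - i)) (i * 0 + (s - (m - i) + (m - i)))"
        by (rule hom_mult)
      also have "i * 1 + (m - i) = m" using True by simp
      also have "i * 0 + (s - (m - i) + (m - i)) = s"
        using True by (simp only: mult_0_right add_0_left le_add_diff_inverse2)
      finally show ?thesis .
    next
      case False
      then have "p = 0" using p(1) by (auto split: if_splits)
      then show ?thesis by (simp add: shift_vars_simps)
    qed
    moreover have "i = 0 \<or> var 0 ^ i * shift_vars p \<in> ann k (i - 1)"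
      using ann_mult[OF var_pow_in_ann[of "i - 1"], of "shift_vars p"] i
      by (cases i) (simp_all add: mult.commute)
    ultimately show "y \<in> ?f ` A" using p(2) A by auto
  qed
qed

lemma dim_image_shift:
  assumes "i \<le> k"
  shows "vector_space.dim (\<lambda>c. app (fsc c)) ((\<lambda>p. app (ev (var 0 ^ i * shift_vars p)) (fvac k i)) `
      (if i \<le> m \<and> m - i \<le> s then hom (m - i) (s - (m - i)) else {0}))
    = (if i \<le> m \<and> m - i \<le> s then rk (k - i) (m - i) (s - (m - i)) else 0)"
proof -
  interpret v: vector_space "\<lambda>c. app (fsc c)" by (rule sc_vector_space)
  have "v.dim {0} = 0" using v.dim_span[of "{}"] v.dim_eq_card_independent[OF v.independent_empty] by simp
  then show ?thesis using rk_shift[OF assms] by (simp add: shift_vars_simps)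
qed

text \<open>The difference of the two ranks is the dimension of I_(i-1)/I_i in this bidegree, which
  the shift identifies with a piece of P/I_(k-i).\<close>

theorem rk_recursion:
  assumes "1 \<le> i" "i \<le> k"
  shows "rk i m s = (if i \<le> m \<and> m - i \<le> s then rk (k - i) (m - i) (s - (m - i)) else 0) + rk (i - 1) m s"
proof -
  let ?A = "hom m s \<inter> ann k (i - 1)" and ?f = "\<lambda>p. app (ev p) (fvac k i)"
  have sub: "pvs.subspace ?A"
    using subspace_hom[of m s] by (auto simp: pvs.subspace_def ann_zero ann_add ann_mult pscale_def)
  have "vector_space.dim (\<lambda>c. app (fsc c)) (?f ` ?A) + pvs.dim (?A \<inter> {p. ?f p = 0}) = pvs.dim ?A"
    using hom_span by (intro linear.rank_nullity[OF ev_linear sub finite_hom_basis]) blast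
  moreover have "?A \<inter> {p. ?f p = 0} = hom m s \<inter> ann k i"
    using ann_antimono[OF assms] by (auto simp: ann_alt)
  moreover have "vector_space.dim (\<lambda>c. app (fsc c)) (?f ` ?A) =
      (if i \<le> m \<and> m - i \<le> s then rk (k - i) (m - i) (s - (m - i)) else 0)"
    using image_shift[OF assms(2), of ?A m s] dim_image_shift[OF assms(2), of m s] assms(1) by simp
  ultimately show ?thesis using rk_add[of i m s] rk_add[of "i - 1" m s]
    by (simp only:)
qed

theorem rk_0: "rk 0 m s = (if m \<le> s then rk k m (s - m) else 0)"
proof -
  have "vector_space.dim (\<lambda>c. app (fsc c)) ((\<lambda>p. app (ev p) (fvac k 0)) ` hom m s) = rk 0 m s"
    using dim_ev_hom[of "fvac k 0" m s] by (simp add: rk_def ann_alt)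
  then show ?thesis
    using image_shift[of 0 "hom m s" m s] dim_image_shift[of 0 m s] by simp
qed

end

section \<open>Standard modules\<close>

lemma mat_scale_simps:
  "mat_scale 0 A = 0" "mat_scale s 0 = 0" "mat_scale s A + mat_scale t A = mat_scale (s + t) A"
  by (simp_all add: mat_scale_def vec_eq_iff distrib_right)

lemmas mat2_simps = vec_eq_iff forall_2 sum_2 matrix_matrix_mult_def commutator_def tr_form_def trace_def
  sl2_h_def sl2_pos_def sl2_neg_def mat_scale_def vector_2

lemma sl2_commutators:
  "commutator A A = 0"
  "commutator sl2_h sl2_pos = mat_scale 2 sl2_pos" "commutator sl2_h sl2_neg = mat_scale (- 2) sl2_neg"
  "commutator sl2_pos sl2_neg = sl2_h"
  by (simp_all add: mat2_simps)

lemma sl2_forms: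
  "tr_form sl2_pos sl2_pos = 0" "tr_form sl2_neg sl2_neg = 0" "tr_form sl2_h sl2_pos = 0"
  "tr_form sl2_h sl2_neg = 0" "tr_form sl2_pos sl2_neg = 1" "tr_form sl2_h sl2_h = 2"
  by (simp_all add: mat2_simps)

lemma sl2_mem: "sl2_h \<in> sl2" "sl2_pos \<in> sl2" "sl2_neg \<in> sl2" "0 \<in> sl2"
  by (simp_all add: sl2_def mat2_simps)

lemma sl2_closed:
  "A \<in> sl2 \<Longrightarrow> mat_scale s A \<in> sl2" "A \<in> sl2 \<Longrightarrow> B \<in> sl2 \<Longrightarrow> A + B \<in> sl2" "commutator A B \<in> sl2"
proof -
  show "A \<in> sl2 \<Longrightarrow> mat_scale s A \<in> sl2"
    by (simp add: sl2_def trace_def mat_scale_def sum_2 flip: distrib_left)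
  show "A \<in> sl2 \<Longrightarrow> B \<in> sl2 \<Longrightarrow> A + B \<in> sl2"
    by (simp add: sl2_def trace_def sum_2 add_eq_0_iff algebra_simps)
  show "commutator A B \<in> sl2"
    by (simp add: sl2_def trace_def sum_2 commutator_def matrix_matrix_mult_def algebra_simps)
qed

lemma sl2_decomposition:
  assumes "A \<in> sl2"
  shows "A = mat_scale (A $ 1 $ 1) sl2_h + (mat_scale (A $ 1 $ 2) sl2_pos + mat_scale (A $ 2 $ 1) sl2_neg)"
proof -
  have "A $ 2 $ 2 = - (A $ 1 $ 1)"
    using assms by (simp add: sl2_def trace_def sum_2 eq_neg_iff_add_eq_0 add.commute)
  then show ?thesis by (simp add: mat2_simps)
qed

lemma tensor_t_add: "tensor_t (A + B) n = tensor_t A n + tensor_t B n"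
  by (simp add: tensor_t_def single_add)

lemma tensor_t_scale: "tensor_t (mat_scale s A) n = hat_scale s (tensor_t A n)"
proof -
  have "Poly_Mapping.map (mat_scale s) (Poly_Mapping.single n A) = Poly_Mapping.single n (mat_scale s A)"
    by (rule poly_mapping_eqI)
      (auto simp: Poly_Mapping.map.rep_eq lookup_single when_def mat_scale_simps)
  then show ?thesis by (simp add: tensor_t_def hat_scale_def)
qed

lemma tensor_t_mem: "A \<in> sl2 \<Longrightarrow> tensor_t A n \<in> sl2_hat"
  by (simp add: tensor_t_def sl2_hat_def lookup_single when_def sl2_mem)

lemma central_mem: "central_c \<in> sl2_hat"
  by (simp add: central_c_def sl2_hat_def sl2_mem)

lemma hat_scale_mem: "u \<in> sl2_hat \<Longrightarrow> hat_scale s u \<in> sl2_hat"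
  by (simp add: hat_scale_def sl2_hat_def Poly_Mapping.map.rep_eq when_def sl2_closed sl2_mem)

lemma n_plus_sub: "u \<in> n_plus_hat \<Longrightarrow> u \<in> sl2_hat"
  unfolding n_plus_hat_def sl2_hat_def by (auto, metis sl2_closed(1) sl2_mem(2))

section \<open>Standard modules as irreducible highest weight representations\<close>

locale standard =
  fixes k0 k1 :: nat and M :: "('v::ab_group_add) hat_module"
  assumes std: "standard_module k0 k1 M"
begin

lemma hat: "is_hat_module M"
  using std by (simp add: standard_module_def)

sublocale M: vector_space "scale M"
  using hat by (simp add: is_hat_module_def)

lemma act_linear:
  assumes "u \<in> sl2_hat"
  shows "act M u (x + y) = act M u x + act M u y" "act M u (scale M c x) = scale M c (act M u x)"
proof -
  have "Vector_Spaces.linear (scale M) (scale M) (act M u)"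
    using hat assms by (simp add: is_hat_module_def)
  then show "act M u (x + y) = act M u x + act M u y" "act M u (scale M c x) = scale M c (act M u x)"
    by (simp_all add: Vector_Spaces.linear_iff)
qed

lemma act_add: "u \<in> sl2_hat \<Longrightarrow> u' \<in> sl2_hat \<Longrightarrow> act M (u + u') w = act M u w + act M u' w"
  using hat by (simp add: is_hat_module_def)

lemma act_scale: "u \<in> sl2_hat \<Longrightarrow> act M (hat_scale s u) w = scale M s (act M u w)"
  using hat by (simp add: is_hat_module_def)

lemma act_central: "act M central_c w = scale M (of_nat (k0 + k1)) w"
  using std by (simp add: standard_module_def)

lemma act_zero: "act M 0 w = 0"
proof -
  have "(0 :: loop_ext) \<in> sl2_hat" by (simp add: sl2_hat_def sl2_mem)
  from act_add[OF this this, of w] show ?thesis by simp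
qed

lemma act_tensor_scale: "A \<in> sl2 \<Longrightarrow> act M (tensor_t (mat_scale s A) n) w = scale M s (act M (tensor_t A n) w)"
  by (simp add: tensor_t_scale act_scale tensor_t_mem)

lemma act_tensor_add:
  "A \<in> sl2 \<Longrightarrow> B \<in> sl2 \<Longrightarrow> act M (tensor_t (A + B) n) w = act M (tensor_t A n) w + act M (tensor_t B n) w"
  by (simp add: tensor_t_add act_add tensor_t_mem)

lemma act_tensor_zero: "act M (tensor_t 0 n) w = 0"
  using act_zero[of w] by (simp add: tensor_t_def zero_prod_def)

lemma act_bracket:
  assumes A: "A \<in> sl2" and B: "B \<in> sl2"
  shows "act M (tensor_t A m) (act M (tensor_t B n) w) = act M (tensor_t B n) (act M (tensor_t A m) w)
    + act M (tensor_t (commutator A B) (m + n)) w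
    + scale M ((if m + n = 0 then of_int m * tr_form A B else 0) * of_nat (k0 + k1)) w"
proof -
  have "act M (hat_bracket (tensor_t A m) (tensor_t B n)) w =
      act M (tensor_t A m) (act M (tensor_t B n) w) - act M (tensor_t B n) (act M (tensor_t A m) w)"
    using hat tensor_t_mem[OF A] tensor_t_mem[OF B] by (simp add: is_hat_module_def)
  moreover have "act M (hat_bracket (tensor_t A m) (tensor_t B n)) w =
      act M (tensor_t (commutator A B) (m + n)) w
      + scale M ((if m + n = 0 then of_int m * tr_form A B else 0) * of_nat (k0 + k1)) w"
    unfolding hat_bracket_tensor_t
    by (simp only: act_add tensor_t_mem sl2_closed hat_scale_mem central_mem act_scale act_central M.scale_scale)
  ultimately show ?thesis by (simp add: algebra_simps)
qed

definition MS :: "complex \<Rightarrow> 'v aend" where "MS c = Aend (scale M c)"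
definition MA :: "mat2 \<Rightarrow> int \<Rightarrow> 'v aend" where "MA A n = Aend (act M (tensor_t A n))"

lemma app_MS [simp]: "app (MS c) w = scale M c w"
  unfolding MS_def by (subst app_Aend) (simp_all add: M.scale_right_distrib)

lemma app_MA: "A \<in> sl2 \<Longrightarrow> app (MA A n) w = act M (tensor_t A n) w"
  unfolding MA_def by (subst app_Aend) (simp_all add: act_linear tensor_t_mem)

abbreviation "ME \<equiv> MA sl2_pos"
abbreviation "MF \<equiv> MA sl2_neg"
abbreviation "MH \<equiv> MA sl2_h"

lemma app_ops [simp]:
  "app (ME n) w = act M (tensor_t sl2_pos n) w" "app (MF n) w = act M (tensor_t sl2_neg n) w"
  "app (MH n) w = act M (tensor_t sl2_h n) w"
  by (simp_all add: app_MA sl2_mem)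

sublocale sl2_rep MS ME MF MH "k0 + k1"
proof (standard, goal_cases)
  case (1 a b) show ?case by (rule aend_eqI) (simp add: M.scale_left_distrib)
next
  case (2 a b) show ?case by (rule aend_eqI) simp
next
  case 3 show ?case by (rule aend_eqI) simp
next
  case (4 a n) show ?case by (rule aend_eqI) (simp add: act_linear tensor_t_mem sl2_mem)
next
  case (5 a n) show ?case by (rule aend_eqI) (simp add: act_linear tensor_t_mem sl2_mem)
next
  case (6 a n) show ?case by (rule aend_eqI) (simp add: act_linear tensor_t_mem sl2_mem)
next
  case (7 m n)
  show ?case using act_bracket[OF sl2_mem(2,2), of m n]
    by (intro aend_eqI) (simp add: sl2_commutators sl2_forms act_tensor_zero)
next
  case (8 m n)
  show ?case using act_bracket[OF sl2_mem(3,3), of m n]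
    by (intro aend_eqI) (simp add: sl2_commutators sl2_forms act_tensor_zero)
next
  case (9 m n)
  show ?case using act_bracket[OF sl2_mem(1,2), of m n]
    by (intro aend_eqI) (simp add: sl2_commutators sl2_forms act_tensor_scale sl2_mem)
next
  case (10 m n)
  show ?case using act_bracket[OF sl2_mem(1,3), of m n]
    by (intro aend_eqI) (simp add: sl2_commutators sl2_forms act_tensor_scale sl2_mem)
next
  case (11 m n)
  show ?case using act_bracket[OF sl2_mem(2,3), of m n]
    by (intro aend_eqI) (simp add: sl2_commutators sl2_forms)
next
  case (12 m n)
  show ?case using act_bracket[OF sl2_mem(1,1), of m n]
    by (intro aend_eqI) (simp add: sl2_commutators sl2_forms act_tensor_zero mult_ac)
qed

lemma act_tensor_in_subspace:
  assumes "M.subspace S" "A \<in> sl2" "\<And>g. app (gp g) w \<in> S"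
  shows "act M (tensor_t A n) w \<in> S"
proof -
  have "act M (tensor_t A n) w = scale M (A $ 1 $ 1) (app (gp (GH, n)) w)
      + (scale M (A $ 1 $ 2) (app (gp (GE, n)) w) + scale M (A $ 2 $ 1) (app (gp (GF, n)) w))"
    by (subst sl2_decomposition[OF assms(2)])
      (simp only: act_tensor_add act_tensor_scale sl2_closed sl2_mem gop.simps app_ops)
  then show ?thesis
    using assms(1,3) by (simp only:) (intro M.subspace_add M.subspace_scale)
qed

lemma act_in_subspace:
  assumes S: "M.subspace S" and u: "u \<in> sl2_hat"
    and *: "\<And>n. act M (tensor_t (Poly_Mapping.lookup (fst u) n) n) w \<in> S" "snd u \<noteq> 0 \<Longrightarrow> w \<in> S"
  shows "act M u w \<in> S"
proof -
  let ?t = "\<lambda>n. tensor_t (Poly_Mapping.lookup (fst u) n) n"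
  have l: "Poly_Mapping.lookup (fst u) n \<in> sl2" for n using u by (simp add: sl2_hat_def)
  have "(\<Sum>n\<in>N. ?t n) \<in> sl2_hat \<and>
      act M (\<Sum>n\<in>N. ?t n) w \<in> S" if "finite N" for N
    using that
  proof (induction N)
    case empty
    then show ?case using M.subspace_0[OF S] by (simp add: act_zero) (simp add: sl2_hat_def sl2_mem)
  next
    case (insert n N)
    have "?t n \<in> sl2_hat" by (rule tensor_t_mem[OF l])
    moreover have "x + y \<in> sl2_hat" if "x \<in> sl2_hat" "y \<in> sl2_hat" for x y
      using that by (simp add: sl2_hat_def lookup_add sl2_closed)
    ultimately show ?case using insert *(1) by (simp add: act_add M.subspace_add[OF S])
  qed
  then have sum: "(\<Sum>n\<in>Poly_Mapping.keys (fst u). ?t n) \<in> sl2_hat"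
      "act M (\<Sum>n\<in>Poly_Mapping.keys (fst u). ?t n) w \<in> S"
    by auto
  have "(\<Sum>n\<in>N. ?t n) = (\<Sum>n\<in>N. Poly_Mapping.single n (Poly_Mapping.lookup (fst u) n), 0)" for N
    by (induction N rule: infinite_finite_induct) (auto simp: tensor_t_def zero_prod_def)
  then have u_eq: "u = (\<Sum>n\<in>Poly_Mapping.keys (fst u). ?t n) + hat_scale (snd u) central_c"
    by (simp add: sum_single_lookup hat_scale_def central_c_def prod_eq_iff)
      (rule poly_mapping_eqI, simp add: Poly_Mapping.map.rep_eq)
  have "act M u w = act M (\<Sum>n\<in>Poly_Mapping.keys (fst u). ?t n) w
      + scale M (snd u) (scale M (of_nat (k0 + k1)) w)"
    by (subst u_eq)
      (simp only: act_add[OF sum(1) hat_scale_mem[OF central_mem]] act_scale[OF central_mem] act_central)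
  moreover have "scale M (snd u) (scale M (of_nat (k0 + k1)) w) \<in> S"
    using *(2) M.subspace_0[OF S] M.subspace_scale[OF S] by (cases "snd u = 0") auto
  ultimately show ?thesis using sum(2) M.subspace_add[OF S] by simp
qed

sublocale irr_rep MS ME MF MH "k0 + k1" "hwv M" "of_nat k1"
proof
  fix g assume g: "raising g"
  have "act M (tensor_t x n) (hwv M) = 0" if "x \<in> sl2" "n \<ge> 1" for x n
    using std that by (simp add: standard_module_def)
  moreover have "act M (tensor_t sl2_pos 0) (hwv M) = 0" using std by (simp add: standard_module_def)
  ultimately show "app (gp g) (hwv M) = 0"
    using g sl2_mem by (cases g; cases "fst g") auto
next
  show "app (MH 0) (hwv M) = app (MS (of_nat k1)) (hwv M)" "hwv M \<noteq> 0"
    using std by (simp_all add: standard_module_def)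
next
  fix S
  assume S: "0 \<in> S" "\<And>a b. a \<in> S \<Longrightarrow> b \<in> S \<Longrightarrow> a + b \<in> S" "\<And>c a. a \<in> S \<Longrightarrow> app (MS c) a \<in> S"
    "\<And>g a. a \<in> S \<Longrightarrow> app (gp g) a \<in> S"
  have sub: "M.subspace S" using S by (simp add: M.subspace_def)
  have "act M u w \<in> S" if "u \<in> sl2_hat" "w \<in> S" for u w
  proof (rule act_in_subspace[OF sub that(1)])
    have "Poly_Mapping.lookup (fst u) n \<in> sl2" for n using that(1) by (simp add: sl2_hat_def)
    then show "act M (tensor_t (Poly_Mapping.lookup (fst u) n) n) w \<in> S" for n
      using S(4)[OF that(2)] by (intro act_tensor_in_subspace[OF sub])
  qed (rule that(2))
  then show "S = {0} \<or> S = UNIV"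
    using std sub by (simp add: standard_module_def irreducible_module_def)
qed

lemma deg_op_hwv: "app (deg_op 0) (hwv M) = scale M (lowest_weight k0 k1) (hwv M)"
  unfolding deg_op_v by (simp add: lowest_weight_def algebra_simps)

text \<open>Uniqueness: two operators with the defining properties agree on a submodule containing
  the highest weight vector.\<close>

lemma virasoro_L0_eq: "virasoro_L0 k0 k1 M = app (deg_op 0)"
  unfolding virasoro_L0_def
proof (rule the_equality, intro conjI ballI allI)
  show "Vector_Spaces.linear (scale M) (scale M) (app (deg_op 0))"
    using app_sc_comm[OF sc_deg_op[of _ 0]] M.vector_space_axioms by (simp add: Vector_Spaces.linear_iff)
  show "app (deg_op 0) (hwv M) = scale M (lowest_weight k0 k1) (hwv M)" by (rule deg_op_hwv)
  fix x n w assume x: "x \<in> sl2"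
  let ?S = "\<lambda>w. app (deg_op 0) (act M (tensor_t x n) w) - act M (tensor_t x n) (app (deg_op 0) w)
      - scale M (- of_int n) (act M (tensor_t x n) w)"
  let ?c = "\<lambda>g. app (deg_op 0) (app (gp g) w) = app (gp g) (app (deg_op 0) w)
    - scale M (of_int (snd g)) (app (gp g) w)"
  have c: "?c g" for g using deg_op_gop[of 0 g w] by simp
  have d: "app (deg_op 0) (scale M a y) = scale M a (app (deg_op 0) y)" for a y
    using app_sc_comm[OF sc_deg_op[of a 0], of y] by simp
  have e: "act M (tensor_t x n) y = scale M (x $ 1 $ 1) (act M (tensor_t sl2_h n) y)
      + (scale M (x $ 1 $ 2) (act M (tensor_t sl2_pos n) y) + scale M (x $ 2 $ 1) (act M (tensor_t sl2_neg n) y))" for y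
    by (subst sl2_decomposition[OF x])
      (simp only: act_tensor_add act_tensor_scale sl2_closed sl2_mem)
  show "app (deg_op 0) (act M (tensor_t x n) w) - act M (tensor_t x n) (app (deg_op 0) w)
      = scale M (- of_int n) (act M (tensor_t x n) w)"
    using c[of "(GE, n)"] c[of "(GF, n)"] c[of "(GH, n)"]
    by (simp add: e d M.scale_right_distrib M.scale_right_diff_distrib mult.commute)
next
  fix D
  assume D: "Vector_Spaces.linear (scale M) (scale M) D \<and> D (hwv M) = scale M (lowest_weight k0 k1) (hwv M) \<and>
    (\<forall>x\<in>sl2. \<forall>n w. D (act M (tensor_t x n) w) - act M (tensor_t x n) (D w) = scale M (- of_int n) (act M (tensor_t x n) w))"
  then have lin: "D (x + y) = D x + D y" "D (scale M c x) = scale M c (D x)" for x y c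
    by (simp_all add: Vector_Spaces.linear_iff)
  have "{w. D w = app (deg_op 0) w} = UNIV"
  proof (rule submodule_with_v)
    show "hwv M \<in> {w. D w = app (deg_op 0) w}" using D deg_op_hwv by simp
  next
    fix g a assume a: "a \<in> {w. D w = app (deg_op 0) w}"
    have Dc: "D (act M (tensor_t x n) w) = act M (tensor_t x n) (D w) + scale M (- of_int n) (act M (tensor_t x n) w)"
      if "x \<in> sl2" for x n w
      using D that by (simp add: diff_eq_eq add.commute)
    have "D (app (gp g) a) = app (gp g) (D a) + scale M (- of_int (snd g)) (app (gp g) a)"
      by (cases g; cases "fst g") (simp_all add: Dc sl2_mem)
    then show "app (gp g) a \<in> {w. D w = app (deg_op 0) w}"
      using a deg_op_gop[of 0 g a] by simp
  next
    fix c a assume "a \<in> {w. D w = app (deg_op 0) w}"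
    then show "app (MS c) a \<in> {w. D w = app (deg_op 0) w}"
      using app_sc_comm[OF sc_deg_op[of c 0], of a] by (simp add: lin)
  qed (simp add: lin)
  then show "D = app (deg_op 0)" by (intro ext) blast
qed

section \<open>The principal subspace and its bigraded pieces\<close>

lemma subspace_range_ev: "M.subspace (range (\<lambda>p. app (ev p) (hwv M)))"
  unfolding M.subspace_def
proof (intro conjI ballI allI; (elim rangeE)?; (hypsubst)?)
  show "0 \<in> range (\<lambda>p. app (ev p) (hwv M))" by (rule range_eqI[of _ _ 0]) simp
  show "app (ev p) (hwv M) + app (ev q) (hwv M) \<in> range (\<lambda>p. app (ev p) (hwv M))" for p q
    by (rule range_eqI[of _ _ "p + q"]) (simp add: pe.peval_add)
  show "scale M c (app (ev p) (hwv M)) \<in> range (\<lambda>p. app (ev p) (hwv M))" for c p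
    by (rule range_eqI[of _ _ "cst c * p"]) (simp add: pe.peval_mult)
qed

text \<open>Non-negative modes of x_\<alpha> commute with all evaluated polynomials and kill the
  highest weight vector, so only the modes represented by variables generate.\<close>

lemma principal_subspace_eq: "principal_subspace M = range (\<lambda>p. app (ev p) (hwv M))"
proof
  let ?R = "range (\<lambda>p. app (ev p) (hwv M))" and ?X = "\<lambda>m. ME (- int m - 1)"
  have E: "app (ME n) w \<in> ?R" if w: "w \<in> ?R" for n w
  proof -
    obtain p where p: "w = app (ev p) (hwv M)" using w by blast
    show ?thesis
    proof (cases "n \<ge> 0")
      case True
      have "ev p * ME n = ME n * ev p" by (rule pe.peval_comm_right) (simp_all only: sc_E EE)
      then have "app (ME n) w = app (ev p) (app (ME n) (hwv M))" unfolding p by (metis app_simps(6))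
      also have "\<dots> = app (ev 0) (hwv M)" using E_v[OF True] by simp
      finally show ?thesis by blast
    next
      case False
      then have "app (ME n) w = app (ev (var (nat (- n - 1)) * p)) (hwv M)"
        by (simp add: p pe.peval_mult)
      then show ?thesis by blast
    qed
  qed
  have act: "act M u w \<in> ?R" if u: "u \<in> n_plus_hat" and w: "w \<in> ?R" for u w
  proof (rule act_in_subspace[OF subspace_range_ev n_plus_sub[OF u]])
    show "act M (tensor_t (Poly_Mapping.lookup (fst u) n) n) w \<in> ?R" for n
    proof -
      obtain s where "Poly_Mapping.lookup (fst u) n = mat_scale s sl2_pos"
        using u by (auto simp: n_plus_hat_def)
      then have "act M (tensor_t (Poly_Mapping.lookup (fst u) n) n) w = scale M s (app (ME n) w)"
        by (simp add: act_tensor_scale sl2_mem)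
      then show ?thesis using M.subspace_scale[OF subspace_range_ev E[OF w]] by simp
    qed
  qed (rule w)
  have "foldr (act M) us (hwv M) \<in> ?R" if "set us \<subseteq> n_plus_hat" for us
    using that
  proof (induction us)
    case Nil
    have "hwv M = app (ev 1) (hwv M)" by simp
    then show ?case by (simp only: foldr.simps id_apply) blast
  qed (auto intro: act)
  then show "principal_subspace M \<subseteq> ?R"
    unfolding principal_subspace_def by (intro M.span_minimal subspace_range_ev) blast
  let ?G = "{foldr (act M) us (hwv M) | us. set us \<subseteq> n_plus_hat}"
  have mon: "app (mmon ?X \<mu>) (hwv M) \<in> ?G" for \<mu>
  proof (induction \<mu>)
    case empty
    show ?case by (auto intro!: exI[of _ "[]"])
  next
    case (add n \<mu>)
    then obtain us where us: "app (mmon ?X \<mu>) (hwv M) = foldr (act M) us (hwv M)" "set us \<subseteq> n_plus_hat" by blast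
    have "tensor_t sl2_pos (- int n - 1) \<in> n_plus_hat"
    proof -
      have "sl2_pos = mat_scale 1 sl2_pos" "0 = mat_scale 0 sl2_pos" by (simp_all add: mat_scale_def vec_eq_iff)
      then show ?thesis by (auto simp: n_plus_hat_def tensor_t_def lookup_single when_def)
    qed
    then show ?case using us
      by (auto simp: pe.mmon_add_mset intro!: exI[of _ "tensor_t sl2_pos (- int n - 1) # us"])
  qed
  have "app (ev p) (hwv M) \<in> M.span ?G" for p
  proof (induction p rule: poly_mapping_single_induct)
    case (add p \<mu> c)
    then show ?case using M.span_add M.span_scale[OF M.span_base[OF mon[of \<mu>]], of c]
      by (simp add: pe.peval_add pe.peval_single)
  qed (simp add: M.span_zero)
  then show "?R \<subseteq> principal_subspace M" unfolding principal_subspace_def by blast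
qed

lemma graded_piece_eq:
  "graded_piece k0 k1 M (of_nat k1 / 2 + of_nat m) (lowest_weight k0 k1 + of_nat n) =
    (\<lambda>p. app (ev p) (hwv M)) ` (if m \<le> n then hom m (n - m) else {0})" (is "?L = ?R")
proof
  have D: "app (deg_op 0) (hwv M) = app (MS (lowest_weight k0 k1)) (hwv M)"
    using deg_op_hwv by simp
  have half: "scale M (1 / 2) x = scale M (of_nat k1 / 2 + of_nat m) y \<longleftrightarrow> x = scale M (of_nat k1 + 2 * of_nat m) y" for x y
  proof
    assume "scale M (1 / 2) x = scale M (of_nat k1 / 2 + of_nat m) y"
    then have "scale M 2 (scale M (1 / 2) x) = scale M 2 (scale M (of_nat k1 / 2 + of_nat m) y)" by (rule arg_cong)
    moreover have "(2 :: complex) * (of_nat k1 / 2 + of_nat m) = of_nat k1 + 2 * of_nat m" by simp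
    ultimately show "x = scale M (of_nat k1 + 2 * of_nat m) y" by (simp only: M.scale_scale) simp
  next
    assume "x = scale M (of_nat k1 + 2 * of_nat m) y"
    moreover have "(1 / 2 :: complex) * (of_nat k1 + 2 * of_nat m) = of_nat k1 / 2 + of_nat m" by (simp add: field_simps)
    ultimately show "scale M (1 / 2) x = scale M (of_nat k1 / 2 + of_nat m) y" by (simp only: M.scale_scale)
  qed
  show "?L \<subseteq> ?R"
  proof
    fix w assume w: "w \<in> ?L"
    then obtain p where p: "w = app (ev p) (hwv M)"
      by (auto simp: graded_piece_def principal_subspace_eq)
    have "app (MH 0) w = app (MS (of_nat k1 + 2 * of_nat m)) w"
      using w by (simp add: graded_piece_def half)
    moreover have "app (deg_op 0) w = app (MS (lowest_weight k0 k1 + of_nat n)) w"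
      using w by (simp add: graded_piece_def virasoro_L0_eq)
    ultimately show "w \<in> ?R" unfolding p by (rule bigraded_component[OF D])
  qed
  show "?R \<subseteq> ?L"
  proof
    fix w assume "w \<in> ?R"
    then obtain p where p: "w = app (ev p) (hwv M)" "p \<in> (if m \<le> n then hom m (n - m) else {0})" by blast
    have "app (MH 0) w = app (MS (of_nat k1 + 2 * of_nat m)) w \<and>
        app (deg_op 0) w = app (MS (lowest_weight k0 k1 + of_nat n)) w"
    proof (cases "m \<le> n")
      case True
      then have "p \<in> hom m (n - m)" using p(2) by simp
      from H0_ev_hom[OF this] deg_op_ev_hom[OF D this] show ?thesis
        using True unfolding p(1) by simp
    next
      case False
      then have "p = 0" using p(2) by simp
      then have "w = 0" by (simp add: p(1))
      then show ?thesis by simp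
    qed
    then show "w \<in> ?L"
      using p(1) by (simp add: graded_piece_def half virasoro_L0_eq principal_subspace_eq)
  qed
qed

lemma dim_graded_piece:
  "M.dim (graded_piece k0 k1 M (of_nat k1 / 2 + of_nat m) (lowest_weight k0 k1 + of_nat n)) =
    (if m \<le> n then fock_level.rk (k0 + k1) k0 m (n - m) else 0)"
proof (cases "m \<le> n")
  case True
  \<comment> \<open>The weight \<open>k1\<close> is rewritten as level minus \<open>k0\<close>,
    which identifies the index of the annihilator as \<open>k0\<close>.\<close>
  have fw: "faithful_hw MS ME MF MH (k0 + k1) (hwv M) (of_nat (k0 + k1) - of_nat k0) coord"
    using faithful_hw_axioms by simp
  have scale_eq: "scale M = (\<lambda>c. app (MS c))" by (intro ext) simp
  have "{p. app (ev p) (hwv M) = 0} = ann (k0 + k1) k0"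
    using ann_iff[OF fw] by auto
  then show ?thesis
    using dim_ev_hom[of "hwv M" m "n - m"] True
    by (simp add: graded_piece_eq fock_level.rk_def scale_eq)
next
  case False
  have "M.dim {0} = 0" using M.dim_span[of "{}"] M.dim_eq_card_independent[OF M.independent_empty] by simp
  then show ?thesis using False by (simp add: graded_piece_eq)
qed

lemma modified_gdim_nth:
  "fps_nth (fps_nth (modified_gdim k0 k1 M) m) n =
    of_nat (if m \<le> n then fock_level.rk (k0 + k1) k0 m (n - m) else 0)"
  by (simp add: modified_gdim_def dim_graded_piece)

end

section \<open>Coefficients of the series and the Rogers-Selberg recursions\<close>

lemma subst_xq_nth:
  "fps_nth (fps_nth (subst_xq f) m) n = (if m \<le> n then fps_nth (fps_nth f m) (n - m) else 0)"
proof -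
  have "subst_xq f = Abs_fps (\<lambda>n. fps_X ^ n * fps_nth f n)"
    unfolding subst_xq_def mult.commute[of fps_X] fps_compose_linear ..
  then show ?thesis by (simp add: fps_X_power_mult_nth)
qed

lemma xq_power_mult_nth:
  "fps_nth (fps_nth ((x_var * q_var) ^ i * f) m) n =
    (if i \<le> m \<and> i \<le> n then fps_nth (fps_nth f (m - i)) (n - i) else 0)"
proof -
  have *: "(x_var * q_var) ^ i * f = fps_X ^ i * (fps_const (fps_X ^ i) * f)"
    by (simp only: power_mult_distrib fps_const_power mult.assoc)
  show ?thesis unfolding * by (simp add: fps_X_power_mult_nth)
qed

text \<open>The coefficient of x^m q^n is the rank at charge \<open>m\<close> and excess
  \<open>n - m\<close>, so both identities reduce coefficientwise to \<open>rk_recursion\<close> and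
  \<open>rk_0\<close>.\<close>

theorem mainTheorem2:
  fixes k :: nat
  assumes "k \<ge> 1"
  shows
    "(\<forall>i (L :: ('a::ab_group_add) hat_module) (L' :: ('b::ab_group_add) hat_module)
         (L'' :: ('c::ab_group_add) hat_module).
        1 \<le> i \<and> i \<le> k \<and>
        standard_module i (k - i) L \<and>
        standard_module (k - i) i L' \<and>
        standard_module (i - 1) (k - i + 1) L'' \<longrightarrow>
        modified_gdim i (k - i) L - (x_var * q_var) ^ i * subst_xq (modified_gdim (k - i) i L')
          = modified_gdim (i - 1) (k - i + 1) L'') \<and>
     (\<forall>(L :: 'a hat_module) (L' :: 'b hat_module).
        standard_module 0 k L \<and> standard_module k 0 L' \<longrightarrow>
        modified_gdim 0 k L = subst_xq (modified_gdim k 0 L'))"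
proof (intro conjI allI impI)
  fix i :: nat and L :: "'a hat_module" and L' :: "'b hat_module" and L'' :: "'c hat_module"
  assume "1 \<le> i \<and> i \<le> k \<and> standard_module i (k - i) L \<and> standard_module (k - i) i L' \<and>
        standard_module (i - 1) (k - i + 1) L''"
  then have i: "1 \<le> i" "i \<le> k" and L: "standard i (k - i) L" "standard (k - i) i L'"
    "standard (i - 1) (k - i + 1) L''"
    by (simp_all add: standard_def)
  have sums: "i + (k - i) = k" "k - i + i = k" "i - 1 + (k - i + 1) = k" using i by auto
  note nth = L[THEN standard.modified_gdim_nth, unfolded sums]
  have rec: "fock_level.rk k i m (n - m) =
      (if i \<le> m \<and> m \<le> n \<and> m - i \<le> n - m then fock_level.rk k (k - i) (m - i) (n - m - (m - i)) else 0)
      + fock_level.rk k (i - 1) m (n - m)" if "m \<le> n" for m n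
    using fock_level.rk_recursion[OF i, of m "n - m"] that by simp
  show "modified_gdim i (k - i) L - (x_var * q_var) ^ i * subst_xq (modified_gdim (k - i) i L')
          = modified_gdim (i - 1) (k - i + 1) L''"
  proof (intro fps_ext)
    fix m n
    \<comment> \<open>The factor (xq)^i lowers the exponent of q by \<open>i\<close>, and the
      substitution lowers it by the remaining exponent \<open>m - i\<close> of x.\<close>
    have idx: "n - i - (m - i) = n - m" if "i \<le> m" using that by simp
    have *: "fps_nth (fps_nth ((x_var * q_var) ^ i * subst_xq (modified_gdim (k - i) i L')) m) n =
      of_nat (if i \<le> m \<and> m \<le> n \<and> m - i \<le> n - m then fock_level.rk k (k - i) (m - i) (n - m - (m - i)) else 0)"
      unfolding xq_power_mult_nth subst_xq_nth nth by (auto simp: idx)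
    show "fps_nth (fps_nth (modified_gdim i (k - i) L - (x_var * q_var) ^ i * subst_xq (modified_gdim (k - i) i L')) m) n
          = fps_nth (fps_nth (modified_gdim (i - 1) (k - i + 1) L'') m) n"
      unfolding fps_sub_nth * nth using rec[of m n] by (cases "m \<le> n") simp_all
  qed
next
  fix L :: "'a hat_module" and L' :: "'b hat_module"
  assume "standard_module 0 k L \<and> standard_module k 0 L'"
  then have L: "standard 0 k L" "standard k 0 L'" by (simp_all add: standard_def)
  show "modified_gdim 0 k L = subst_xq (modified_gdim k 0 L')"
  proof (intro fps_ext)
    fix m n
    show "fps_nth (fps_nth (modified_gdim 0 k L) m) n = fps_nth (fps_nth (subst_xq (modified_gdim k 0 L')) m) n"
      using fock_level.rk_0[of k m "n - m"]
      by (simp add: subst_xq_nth L[THEN standard.modified_gdim_nth])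
  qed
qed

end
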